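(* Let $\rho$ be a strongly cuspidal representation of $\mathrm{GL}_3(\mathfrak o_2)$ and $\chi$ a character of $\mathrm{GL}_1(\mathfrak o_2)=\mathfrak o_2^\times$. Let $\pi=\mathrm{Ind}_Q^{\mathrm{GL}_4(\mathfrak o_2)}(\rho\otimes\chi)$, where $\rho\otimes\chi$ is regarded as a representation of $Q$ via $Q\twoheadrightarrow Q/U\cong\mathrm{GL}_3(\mathfrak o_2)\times\mathrm{GL}_1(\mathfrak o_2)$, and let $\omega_\pi$ be the character by which the centre of $\mathrm{GL}_4(\mathfrak o_2)$ acts on $\pi$. Let $m_0\in\mathbb F_q$ be such that $\psi_0(2m_0x)=\omega_\pi(1+\varpi\tilde x)$ for all $x\in\mathbb F_q$, where $\tilde x\in\mathfrak o_2$ is any lift of $x$. Then, as representations of $\mathrm{GL}_2(\mathfrak o_2)$, $$\pi_{N,\psi}\cong\bigoplus_B\mathrm{Ind}_{Z\cdot J_2^1}^{\mathrm{GL}_2(\mathfrak o_2)}(\omega_\pi\phi_B),$$ where $B$ runs over a set of representatives of the conjugacy (similarity) classes of all regular elements of $M_2(\mathbb F_q)$ with trace $2m_0$.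
   Context: Let $F$ be a finite unramified extension of $\mathbb Q_p$ or of $\mathbb F_p((t))$, with $p$ odd, $\mathfrak o$ its ring of integers, $\varpi$ a uniformizer, $\mathfrak o/(\varpi)\cong\mathbb F_q$, and $\mathfrak o_2=\mathfrak o/(\varpi^2)$. All representations are finite-dimensional and complex. Fix an additive character $\psi_0:\mathfrak o_2\to\mathbb C^\times$ that is nontrivial on $\varpi\mathfrak o_2$; for $x\in\mathbb F_q$ write $\psi_0(x):=\psi_0(\varpi\tilde x)$ for any lift $\tilde x\in\mathfrak o_2$ of $x$. $Q\subset\mathrm{GL}_4(\mathfrak o_2)$ is the subgroup of matrices $\begin{pmatrix}h_1&Y\\0&h_2\end{pmatrix}$ with $h_1\in\mathrm{GL}_3(\mathfrak o_2)$, $h_2\in\mathrm{GL}_1(\mathfrak o_2)$, $Y\in M_{3\times1}(\mathfrak o_2)$, and $U$ is its subgroup $h_1=I_3,h_2=1$. $N\cong M_2(\mathfrak o_2)$ is the group of matrices $\begin{pmatrix}I_2&X\\0&I_2\end{pmatrix}$, $X\in M_2(\mathfrak o_2)$, and $\psi:N\to\mathbb C^\times$ is $\psi(X)=\psi_0(\mathrm{tr}\,X)$. The degenerate Whittaker space of a representation $(\pi,V)$ of $\mathrm{GL}_4(\mathfrak o_2)$ is $\pi_{N,\psi}=\{v\in V:\pi(n)v=\psi(n)v\ \forall n\in N\}$, a representation of $\mathrm{GL}_2(\mathfrak o_2)$ via $g\mapsto\mathrm{diag}(g,g)$. For $n\ge1$ let $J_n^1(n\times n)=I_n+\varpi M_n(\mathfrak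 o_2)$; for $n=2$ it is denoted $J_2^1$. For $B\in M_n(\mathbb F_q)$, $\phi_B(I_n+\varpi X)=\psi_0(\mathrm{tr}(B\bar X))$ ($\bar X$ the reduction mod $\varpi$) is a character of $I_n+\varpi M_n(\mathfrak o_2)$, and $I(\phi_B)$ is its stabilizer in $\mathrm{GL}_n(\mathfrak o_2)$ under conjugation. $B$ is regular if its characteristic and minimal polynomials coincide; then $\phi_B$ extends to one-dimensional characters $\tilde\phi_B$ of $I(\phi_B)$ and $\mathrm{Ind}_{I(\phi_B)}^{\mathrm{GL}_n(\mathfrak o_2)}\tilde\phi_B$ is irreducible. It is called strongly cuspidal when the characteristic polynomial of $B$ is irreducible over $\mathbb F_q$. $Z\cong\mathfrak o_2^\times$ is the centre of $\mathrm{GL}_2(\mathfrak o_2)$; central characters are viewed as characters of $\mathfrak o_2^\times$, and $\omega_\pi\phi_B$ is the character $zj\mapsto\omega_\pi(z)\phi_B(j)$ of $Z\cdot J_2^1$ (well defined when $\mathrm{tr}(B)=2m_0$). *)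

theory Defs
  imports
    "Jordan_Normal_Form.Char_Poly"
    "Berlekamp_Zassenhaus.Finite_Field"
    "HOL-Computational_Algebra.Computational_Algebra"
    "HOL-Library.Function_Algebras"
    "HOL-Algebra.Group"
begin

text \<open>
  The prime \<open>p\<close> is \<open>CARD('p)\<close> for a type \<open>'p\<close> of prime cardinality, so that the field with \<open>p\<close>
  elements is \<open>'p mod_ring\<close> and its Laurent series field is \<open>'p mod_ring fls\<close>.
  The \<open>p\<close>-adic integers are the inverse limit of the rings of integers modulo \<open>p ^ n\<close>, with
  residues represented in \<open>{0..<p ^ n}\<close>; the \<open>p\<close>-adic numbers are \<open>'p padic_int fract\<close>.
\<close>

abbreviation p_pow :: "'p::prime_card itself \<Rightarrow> nat \<Rightarrow> int" where
  "p_pow _ n \<equiv> int CARD('p) ^ n"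

typedef (overloaded) ('p::prime_card) padic_int =
  "{a :: nat \<Rightarrow> int. \<forall>n. 0 \<le> a n \<and> a n < p_pow TYPE('p) n \<and> a (Suc n) mod p_pow TYPE('p) n = a n}"
  morphisms padic_residue Abs_padic_int
proof
  show "(\<lambda>_. 0) \<in> {a :: nat \<Rightarrow> int. \<forall>n. 0 \<le> a n \<and> a n < p_pow TYPE('p) n
      \<and> a (Suc n) mod p_pow TYPE('p) n = a n}"
    using prime_card[where 'a='p] by (auto simp: prime_gt_0_nat)
qed

setup_lifting type_definition_padic_int

lemma p_pow_pos: "0 < p_pow TYPE('p::prime_card) n"
  using prime_card[where 'a='p] by (simp add: prime_gt_0_nat)

lemma mod_p_pow_Suc: "(x mod p_pow TYPE('p::prime_card) (Suc n)) mod p_pow TYPE('p) n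
    = x mod p_pow TYPE('p) n"
  by (rule mod_mod_cancel) simp

instantiation padic_int :: (prime_card) comm_ring_1
begin

lift_definition zero_padic_int :: "'a padic_int" is "\<lambda>_. 0"
  using p_pow_pos[where 'p='a] by simp

lift_definition one_padic_int :: "'a padic_int" is "\<lambda>n. 1 mod p_pow TYPE('a) n"
  using p_pow_pos[where 'p='a] mod_p_pow_Suc[where 'p='a] by simp

lift_definition plus_padic_int :: "'a padic_int \<Rightarrow> 'a padic_int \<Rightarrow> 'a padic_int"
  is "\<lambda>a b n. (a n + b n) mod p_pow TYPE('a) n"
  using p_pow_pos[where 'p='a] mod_p_pow_Suc[where 'p='a] by (simp add: mod_add_eq) (metis mod_add_eq)

lift_definition uminus_padic_int :: "'a padic_int \<Rightarrow> 'a padic_int"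
  is "\<lambda>a n. (- a n) mod p_pow TYPE('a) n"
  using p_pow_pos[where 'p='a] mod_p_pow_Suc[where 'p='a] by simp (metis mod_minus_eq)

lift_definition minus_padic_int :: "'a padic_int \<Rightarrow> 'a padic_int \<Rightarrow> 'a padic_int"
  is "\<lambda>a b n. (a n - b n) mod p_pow TYPE('a) n"
  using p_pow_pos[where 'p='a] mod_p_pow_Suc[where 'p='a] by simp (metis mod_diff_eq)

lift_definition times_padic_int :: "'a padic_int \<Rightarrow> 'a padic_int \<Rightarrow> 'a padic_int"
  is "\<lambda>a b n. (a n * b n) mod p_pow TYPE('a) n"
  using p_pow_pos[where 'p='a] mod_p_pow_Suc[where 'p='a] by simp (metis mod_mult_eq)

instance
proof
  fix a b c :: "'a padic_int"
  show "a + b + c = a + (b + c)" by transfer (auto simp: mod_simps algebra_simps)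
  show "a + b = b + a" by transfer (auto simp: algebra_simps)
  show "0 + a = a" by transfer auto
  show "- a + a = 0" by transfer (auto simp: mod_simps)
  show "a - b = a + - b" by transfer (auto simp: mod_simps)
  show "a * b * c = a * (b * c)" by transfer (auto simp: mod_simps algebra_simps)
  show "a * b = b * a" by transfer (auto simp: algebra_simps)
  show "1 * a = a" by transfer (auto simp: mod_simps)
  show "(a + b) * c = a * c + b * c" by transfer (auto simp: mod_simps algebra_simps)
  show "(0 :: 'a padic_int) \<noteq> 1"
  proof transfer
    have "1 < int CARD('a)" using prime_card[where 'a='a] by (simp add: prime_gt_Suc_0_nat)
    then have "(0::int) \<noteq> 1 mod p_pow TYPE('a) (Suc 0)" by simp
    then show "(\<lambda>_. 0) \<noteq> (\<lambda>n. 1 mod p_pow TYPE('a) n)" by metis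
  qed
qed

end

lemma padic_residue_mod:
  "padic_residue (a :: 'p::prime_card padic_int) (n + k) mod p_pow TYPE('p) n = padic_residue a n"
proof (induction k)
  case 0
  then show ?case using padic_residue[of a] by simp
next
  case (Suc k)
  have "padic_residue a (n + k) = padic_residue a (Suc (n + k)) mod p_pow TYPE('p) (n + k)"
    using padic_residue[of a] by simp
  then have "padic_residue a (n + k) mod p_pow TYPE('p) n
      = padic_residue a (Suc (n + k)) mod p_pow TYPE('p) n"
    by (simp add: mod_mod_cancel le_imp_power_dvd)
  then show ?case using Suc by simp
qed

instance padic_int :: (prime_card) idom
proof
  fix a b :: "'a padic_int"
  assume "a \<noteq> 0" "b \<noteq> 0"
  have ex: "\<exists>n. padic_residue c n \<noteq> 0" if "c \<noteq> 0" for c :: "'a padic_int"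
    using that by transfer auto
  let ?p = "int CARD('a)"
  have p: "prime ?p" using prime_card[where 'a='a] by simp
  obtain n m where n: "padic_residue a n \<noteq> 0" and m: "padic_residue b m \<noteq> 0"
    using ex \<open>a \<noteq> 0\<close> \<open>b \<noteq> 0\<close> by blast
  let ?x = "padic_residue a (n + m)" and ?y = "padic_residue b (n + m)"
  have x: "\<not> ?p ^ n dvd ?x" using n padic_residue_mod[of a n m] by (simp add: dvd_eq_mod_eq_0)
  have y: "\<not> ?p ^ m dvd ?y"
    using m padic_residue_mod[of b m n] by (simp add: dvd_eq_mod_eq_0 add.commute)
  have xy0: "?x \<noteq> 0" "?y \<noteq> 0" using x y by auto
  have "multiplicity ?p ?x < n" "multiplicity ?p ?y < m"
    using x y by (meson multiplicity_dvd' not_le)+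
  then have "multiplicity ?p (?x * ?y) < n + m"
    using prime_elem_multiplicity_mult_distrib[of ?p ?x ?y] p xy0 by simp
  moreover have "\<not> is_unit ?p" using p by (metis not_prime_unit)
  ultimately have "\<not> ?p ^ (n + m) dvd ?x * ?y"
    using xy0 by (meson multiplicity_geI mult_eq_0_iff not_le)
  then have "padic_residue (a * b) (n + m) \<noteq> 0"
    by (simp add: times_padic_int.rep_eq dvd_eq_mod_eq_0)
  then show "a * b \<noteq> 0" by (auto simp: zero_padic_int.rep_eq)
qed

text \<open>A generator of the maximal ideal of a local subring \<open>R\<close> of a field, where the maximal ideal
  is the set of nonunits of \<open>R\<close>.\<close>

definition uniformizer :: "'f::field set \<Rightarrow> 'f \<Rightarrow> bool" where
  "uniformizer R w \<longleftrightarrow> w \<noteq> 0 \<and> {x \<in> R. \<forall>y\<in>R. x * y \<noteq> 1} = {w * y |y. y \<in> R}"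

definition field_embedding :: "('k::field \<Rightarrow> 'f::field) \<Rightarrow> bool" where
  "field_embedding \<iota> \<longleftrightarrow> \<iota> 1 = 1 \<and> (\<forall>x y. \<iota> (x + y) = \<iota> x + \<iota> y) \<and> (\<forall>x y. \<iota> (x * y) = \<iota> x * \<iota> y)"

definition finite_extension :: "('k::field \<Rightarrow> 'f::field) \<Rightarrow> bool" where
  "finite_extension \<iota> \<longleftrightarrow> field_embedding \<iota> \<and>
     (\<exists>S. finite S \<and> (\<forall>x. \<exists>c. x = (\<Sum>s\<in>S. \<iota> (c s) * s)))"

definition integral_closure :: "('k::field \<Rightarrow> 'f::field) \<Rightarrow> 'k set \<Rightarrow> 'f set" where
  "integral_closure \<iota> R = {x. \<exists>f. lead_coeff f = 1 \<and> (\<forall>i. poly.coeff f i \<in> R) \<and>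
     poly (map_poly \<iota> f) x = 0}"

text \<open>Residue fields of the fields considered here are finite, hence perfect, so that unramified
  just means that the ramification index is one.\<close>

definition unramified :: "('k::field \<Rightarrow> 'f::field) \<Rightarrow> 'k set \<Rightarrow> bool" where
  "unramified \<iota> R \<longleftrightarrow> (\<exists>w. uniformizer R w \<and> uniformizer (integral_closure \<iota> R) (\<iota> w))"

text \<open>\<open>'f\<close> is a finite unramified extension of the \<open>p\<close>-adic numbers or of the Laurent series
  field over the field with \<open>p\<close> elements, and \<open>R\<close> is its ring of integers.\<close>

definition unramified_integers :: "'p::prime_card itself \<Rightarrow> 'f::field set \<Rightarrow> bool" where
  "unramified_integers _ R \<longleftrightarrow>
     (\<exists>\<iota> :: 'p padic_int fract \<Rightarrow> 'f. finite_extension \<iota> \<and>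
        unramified \<iota> (range to_fract) \<and> R = integral_closure \<iota> (range to_fract)) \<or>
     (\<exists>\<iota> :: 'p mod_ring fls \<Rightarrow> 'f. finite_extension \<iota> \<and>
        unramified \<iota> (range fps_to_fls) \<and> R = integral_closure \<iota> (range fps_to_fls))"

text \<open>The type \<open>'b\<close> is, through \<open>f\<close>, the quotient of the ring \<open>R\<close> by its ideal \<open>I\<close>.\<close>

definition quotient_map :: "'a::comm_ring_1 set \<Rightarrow> 'a set \<Rightarrow> ('a \<Rightarrow> 'b::comm_ring_1) \<Rightarrow> bool" where
  "quotient_map R I f \<longleftrightarrow> f 1 = 1 \<and> (\<forall>x\<in>R. \<forall>y\<in>R. f (x + y) = f x + f y \<and> f (x * y) = f x * f y) \<and>
     f ` R = UNIV \<and> {x \<in> R. f x = 0} = I"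

text \<open>The representation space is a subspace of an ambient complex vector space, namely the type
  \<open>'v\<close> with scalar multiplication \<open>rep_scale\<close>; only the values of \<open>rep_act\<close> on the group and
  on \<open>rep_space\<close> matter.\<close>

record ('g, 'v) rep =
  rep_scale :: "complex \<Rightarrow> 'v \<Rightarrow> 'v"
  rep_space :: "'v set"
  rep_act :: "'g \<Rightarrow> 'v \<Rightarrow> 'v"

definition representation :: "('g, 'c) monoid_scheme \<Rightarrow> ('g, 'v::ab_group_add) rep \<Rightarrow> bool" where
  "representation G \<rho> \<longleftrightarrow>
     vector_space (rep_scale \<rho>) \<and> module.subspace (rep_scale \<rho>) (rep_space \<rho>) \<and>
     (\<exists>S. finite S \<and> rep_space \<rho> = module.span (rep_scale \<rho>) S) \<and>
     (\<forall>g\<in>carrier G. \<forall>v\<in>rep_space \<rho>. rep_act \<rho> g v \<in> rep_space \<rho>) \<and>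
     (\<forall>g\<in>carrier G. \<forall>v\<in>rep_space \<rho>. \<forall>w\<in>rep_space \<rho>.
        rep_act \<rho> g (v + w) = rep_act \<rho> g v + rep_act \<rho> g w) \<and>
     (\<forall>g\<in>carrier G. \<forall>c. \<forall>v\<in>rep_space \<rho>.
        rep_act \<rho> g (rep_scale \<rho> c v) = rep_scale \<rho> c (rep_act \<rho> g v)) \<and>
     (\<forall>v\<in>rep_space \<rho>. rep_act \<rho> \<one>\<^bsub>G\<^esub> v = v) \<and>
     (\<forall>g\<in>carrier G. \<forall>h\<in>carrier G. \<forall>v\<in>rep_space \<rho>.
        rep_act \<rho> (g \<otimes>\<^bsub>G\<^esub> h) v = rep_act \<rho> g (rep_act \<rho> h v))"

definition rep_iso ::
  "('g, 'c) monoid_scheme \<Rightarrow> ('g, 'v::ab_group_add) rep \<Rightarrow> ('g, 'w::ab_group_add) rep \<Rightarrow> bool" where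
  "rep_iso G \<rho> \<sigma> \<longleftrightarrow> representation G \<rho> \<and> representation G \<sigma> \<and>
     (\<exists>T. bij_betw T (rep_space \<rho>) (rep_space \<sigma>) \<and>
        (\<forall>v\<in>rep_space \<rho>. \<forall>w\<in>rep_space \<rho>. T (v + w) = T v + T w) \<and>
        (\<forall>c. \<forall>v\<in>rep_space \<rho>. T (rep_scale \<rho> c v) = rep_scale \<sigma> c (T v)) \<and>
        (\<forall>g\<in>carrier G. \<forall>v\<in>rep_space \<rho>. T (rep_act \<rho> g v) = rep_act \<sigma> g (T v)))"

definition induced ::
  "('g, 'c) monoid_scheme \<Rightarrow> 'g set \<Rightarrow> ('g, 'v::ab_group_add) rep \<Rightarrow> ('g, 'g \<Rightarrow> 'v) rep" where
  "induced G H \<sigma> = \<lparr>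
     rep_scale = (\<lambda>c f x. rep_scale \<sigma> c (f x)),
     rep_space = {f. (\<forall>x\<in>carrier G. f x \<in> rep_space \<sigma>) \<and> (\<forall>x. x \<notin> carrier G \<longrightarrow> f x = 0) \<and>
                     (\<forall>h\<in>H. \<forall>x\<in>carrier G. f (h \<otimes>\<^bsub>G\<^esub> x) = rep_act \<sigma> h (f x))},
     rep_act = (\<lambda>g f x. if x \<in> carrier G then f (x \<otimes>\<^bsub>G\<^esub> g) else 0)\<rparr>"

definition direct_sum ::
  "'i set \<Rightarrow> ('i \<Rightarrow> ('g, 'v::ab_group_add) rep) \<Rightarrow> ('g, 'i \<Rightarrow> 'v) rep" where
  "direct_sum I \<sigma> = \<lparr>
     rep_scale = (\<lambda>c f i. rep_scale (\<sigma> i) c (f i)),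
     rep_space = {f. (\<forall>i\<in>I. f i \<in> rep_space (\<sigma> i)) \<and> (\<forall>i. i \<notin> I \<longrightarrow> f i = 0) \<and> finite {i. f i \<noteq> 0}},
     rep_act = (\<lambda>g f i. if i \<in> I then rep_act (\<sigma> i) g (f i) else 0)\<rparr>"

definition is_character :: "('g, 'c) monoid_scheme \<Rightarrow> 'g set \<Rightarrow> ('g \<Rightarrow> complex) \<Rightarrow> bool" where
  "is_character G H \<theta> \<longleftrightarrow> (\<forall>x\<in>H. \<theta> x \<noteq> 0) \<and> (\<forall>x\<in>H. \<forall>y\<in>H. \<theta> (x \<otimes>\<^bsub>G\<^esub> y) = \<theta> x * \<theta> y)"

definition char_rep :: "('g \<Rightarrow> complex) \<Rightarrow> ('g, complex) rep" where
  "char_rep \<theta> = \<lparr>rep_scale = (*), rep_space = UNIV, rep_act = (\<lambda>g v. \<theta> g * v)\<rparr>"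

definition unit_character :: "('r::comm_ring_1 \<Rightarrow> complex) \<Rightarrow> bool" where
  "unit_character \<chi> \<longleftrightarrow> (\<forall>x. x dvd 1 \<longrightarrow> \<chi> x \<noteq> 0) \<and>
     (\<forall>x y. x dvd 1 \<longrightarrow> y dvd 1 \<longrightarrow> \<chi> (x * y) = \<chi> x * \<chi> y)"

definition additive_character :: "('r::comm_ring_1 \<Rightarrow> complex) \<Rightarrow> bool" where
  "additive_character \<psi> \<longleftrightarrow> (\<forall>x. \<psi> x \<noteq> 0) \<and> (\<forall>x y. \<psi> (x + y) = \<psi> x * \<psi> y)"

definition mat_trace :: "'a::comm_monoid_add mat \<Rightarrow> 'a" where
  "mat_trace A = (\<Sum>i<dim_row A. A $$ (i, i))"

definition poly_mat :: "'a::comm_ring_1 poly \<Rightarrow> 'a mat \<Rightarrow> 'a mat" where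
  "poly_mat f A = mat (dim_row A) (dim_row A) (\<lambda>ij. \<Sum>k\<le>degree f. poly.coeff f k * (A ^\<^sub>m k) $$ ij)"

definition min_poly :: "'a::field mat \<Rightarrow> 'a poly" where
  "min_poly A = (THE f. lead_coeff f = 1 \<and>
     (\<forall>g. poly_mat g A = 0\<^sub>m (dim_row A) (dim_row A) \<longleftrightarrow> f dvd g))"

definition regular_mat :: "'a::field mat \<Rightarrow> bool" where
  "regular_mat A \<longleftrightarrow> char_poly A = min_poly A"

text \<open>Below \<open>'r\<close> is the ring of length two, \<open>w\<close> a generator of its maximal ideal,
  \<open>res\<close> its reduction map onto the residue field \<open>'k\<close> and \<open>\<psi>0\<close> the additive character.\<close>

definition GL :: "nat \<Rightarrow> 'r::comm_ring_1 mat monoid" where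
  "GL n = units_of (ring_mat TYPE('r) n ())"

definition J1 :: "'r::comm_ring_1 \<Rightarrow> nat \<Rightarrow> 'r mat set" where
  "J1 w n = {1\<^sub>m n + w \<cdot>\<^sub>m X |X. X \<in> carrier_mat n n}"

definition psi_res ::
  "('r::comm_ring_1 \<Rightarrow> complex) \<Rightarrow> 'r \<Rightarrow> ('r \<Rightarrow> 'k::field) \<Rightarrow> 'k \<Rightarrow> complex" where
  "psi_res \<psi>0 w res x = \<psi>0 (w * (SOME y. res y = x))"

definition phi :: "('r::comm_ring_1 \<Rightarrow> complex) \<Rightarrow> 'r \<Rightarrow> ('r \<Rightarrow> 'k::field) \<Rightarrow> nat \<Rightarrow> 'k mat \<Rightarrow>
    'r mat \<Rightarrow> complex" where
  "phi \<psi>0 w res n B g = psi_res \<psi>0 w res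
     (mat_trace (B * map_mat res (SOME X. X \<in> carrier_mat n n \<and> g = 1\<^sub>m n + w \<cdot>\<^sub>m X)))"

definition stabilizer :: "('r::comm_ring_1 \<Rightarrow> complex) \<Rightarrow> 'r \<Rightarrow> ('r \<Rightarrow> 'k::field) \<Rightarrow> nat \<Rightarrow> 'k mat \<Rightarrow>
    'r mat set" where
  "stabilizer \<psi>0 w res n B = {g \<in> carrier (GL n). \<forall>j\<in>J1 w n.
     phi \<psi>0 w res n B (g \<otimes>\<^bsub>GL n\<^esub> j \<otimes>\<^bsub>GL n\<^esub> inv\<^bsub>GL n\<^esub> g) = phi \<psi>0 w res n B j}"

definition strongly_cuspidal :: "('r::comm_ring_1 \<Rightarrow> complex) \<Rightarrow> 'r \<Rightarrow> ('r \<Rightarrow> 'k::field) \<Rightarrow> nat \<Rightarrow>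
    ('r mat, 'v::ab_group_add) rep \<Rightarrow> bool" where
  "strongly_cuspidal \<psi>0 w res n \<rho> \<longleftrightarrow>
     (\<exists>A \<theta>. A \<in> carrier_mat n n \<and> regular_mat A \<and> irreducible (char_poly A) \<and>
        is_character (GL n) (stabilizer \<psi>0 w res n A) \<theta> \<and>
        (\<forall>j\<in>J1 w n. \<theta> j = phi \<psi>0 w res n A j) \<and>
        rep_iso (GL n) \<rho> (induced (GL n) (stabilizer \<psi>0 w res n A) (char_rep \<theta>)))"

definition Q31 :: "'r::comm_ring_1 mat set" where
  "Q31 = {four_block_mat h1 Y (0\<^sub>m 1 3) h2 |h1 Y h2.
     h1 \<in> carrier (GL 3) \<and> Y \<in> carrier_mat 3 1 \<and> h2 \<in> carrier (GL 1)}"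

text \<open>The representation \<open>\<rho> \<otimes> \<chi>\<close> inflated to \<open>Q31\<close>; as \<open>\<chi>\<close> is one-dimensional, it lives
  on the space of \<open>\<rho>\<close>.\<close>

definition inflate_tensor ::
  "('r::comm_ring_1 mat, 'v::ab_group_add) rep \<Rightarrow> ('r \<Rightarrow> complex) \<Rightarrow> ('r mat, 'v) rep" where
  "inflate_tensor \<rho> \<chi> = \<lparr>
     rep_scale = rep_scale \<rho>,
     rep_space = rep_space \<rho>,
     rep_act = (\<lambda>q v. case split_block q 3 3 of (h1, Y, L, h2) \<Rightarrow>
        rep_scale \<rho> (\<chi> (h2 $$ (0, 0))) (rep_act \<rho> h1 v))\<rparr>"

definition parabolic_induction ::
  "('r::comm_ring_1 mat, 'v::ab_group_add) rep \<Rightarrow> ('r \<Rightarrow> complex) \<Rightarrow> ('r mat, 'r mat \<Rightarrow> 'v) rep" where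
  "parabolic_induction \<rho> \<chi> = induced (GL 4) Q31 (inflate_tensor \<rho> \<chi>)"

definition degenerate_whittaker :: "('r::comm_ring_1 \<Rightarrow> complex) \<Rightarrow>
    ('r mat, 'v::ab_group_add) rep \<Rightarrow> ('r mat, 'v) rep" where
  "degenerate_whittaker \<psi>0 \<pi> = \<lparr>
     rep_scale = rep_scale \<pi>,
     rep_space = {v \<in> rep_space \<pi>. \<forall>X\<in>carrier_mat 2 2.
        rep_act \<pi> (four_block_mat (1\<^sub>m 2) X (0\<^sub>m 2 2) (1\<^sub>m 2)) v = rep_scale \<pi> (\<psi>0 (mat_trace X)) v},
     rep_act = (\<lambda>g. rep_act \<pi> (four_block_mat g (0\<^sub>m 2 2) (0\<^sub>m 2 2) g))\<rparr>"

text \<open>\<open>\<omega>\<close> is the character by which the centre of the general linear group, identified with the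
  units of the ring, acts on \<open>\<pi>\<close>.\<close>

definition central_character ::
  "nat \<Rightarrow> ('r::comm_ring_1 mat, 'v::ab_group_add) rep \<Rightarrow> ('r \<Rightarrow> complex) \<Rightarrow> bool" where
  "central_character n \<pi> \<omega> \<longleftrightarrow> unit_character \<omega> \<and>
     (\<forall>z. z dvd 1 \<longrightarrow> (\<forall>v\<in>rep_space \<pi>. rep_act \<pi> (z \<cdot>\<^sub>m 1\<^sub>m n) v = rep_scale \<pi> (\<omega> z) v))"

definition ZJ :: "'r::comm_ring_1 \<Rightarrow> 'r mat set" where
  "ZJ w = {z \<cdot>\<^sub>m j |z j. z dvd 1 \<and> j \<in> J1 w 2}"

definition omega_phi :: "('r::comm_ring_1 \<Rightarrow> complex) \<Rightarrow> 'r \<Rightarrow> ('r \<Rightarrow> 'k::field) \<Rightarrow>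
    ('r \<Rightarrow> complex) \<Rightarrow> 'k mat \<Rightarrow> 'r mat \<Rightarrow> complex" where
  "omega_phi \<psi>0 w res \<omega> B g =
     (THE c. \<exists>z j. z dvd 1 \<and> j \<in> J1 w 2 \<and> g = z \<cdot>\<^sub>m j \<and> c = \<omega> z * phi \<psi>0 w res 2 B j)"

definition class_representatives :: "'a::field mat set \<Rightarrow> 'a mat set \<Rightarrow> bool" where
  "class_representatives S R \<longleftrightarrow> R \<subseteq> S \<and> (\<forall>A\<in>S. \<exists>!B. B \<in> R \<and> similar_mat A B)"

end

theory Submission
  imports Defs
begin

text \<open>Write \<open>R\<close> for the ring of length two, \<open>w\<close> for the generator of its maximal ideal, \<open>k\<close> for its residue
  field and \<open>J\<close> for the group \<open>1 + w M\<^sub>4(R)\<close>. The representations \<open>\<rho>\<close> and \<open>\<pi>\<close> are induced from characters, and the theorem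
  is Mackey theory as soon as \<open>\<pi>\<close> is induced from the right one.

  By definition \<open>\<rho>\<close> is induced from a character \<open>\<theta>\<close> of the stabilizer of \<open>\<phi>\<^sub>A\<close>, where \<open>A\<close> is a cubic matrix over
  \<open>k\<close> with irreducible characteristic polynomial. So \<open>\<pi>\<close> is induced from a character of a subgroup
  of \<open>Q\<close>. On \<open>1 + w R\<close> the character \<open>\<chi>\<close> is \<open>1 + w y \<mapsto> \<psi>\<^sub>0 (w c y)\<close> with \<open>c = 2 m\<^sub>0 - tr A\<close>, because the centre acts
  through \<open>\<omega>\<close> (\<open>chi_1_w\<close>). Therefore the characters of \<open>J\<close> that occur in \<open>\<pi>\<close> are the \<open>\<phi>\<^sub>C\<close> for the conjugates \<open>C\<close>
  of the block diagonal matrix \<open>C0 = diag (A, c)\<close>. Each of them occurs once, since \<open>c\<close> is not an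
  eigenvalue of \<open>A\<close>: conjugation by \<open>U\<close> then moves the upper right block of \<open>C0\<close> freely. Consequently \<open>\<pi>\<close> is
  also induced from a character \<open>\<mu>\<close> of the stabilizer of \<open>\<phi>\<close> at \<open>C0\<close> (\<open>change_of_polarization\<close>, \<open>model_C0\<close>).

  In this description \<open>\<pi>\<close> is a sum of lines indexed by the conjugates \<open>C\<close> of \<open>C0\<close>. On the line of \<open>C\<close> the group
  \<open>N \<inter> J\<close> acts through the lower left block of \<open>C\<close>, by \<open>\<psi>\<close> exactly if this block is \<open>1\<close>. The
  quotient of \<open>N\<close> by \<open>N \<inter> J\<close> permutes the lines with this property freely, so that each orbit contributes one line to the Whittaker space. In
  each orbit there is exactly one matrix \<open>C = [B, b; 1, 0]\<close>, called a tower below. An element \<open>g\<close> of the group \<open>GL\<^sub>2\<close>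
  acts on towers by conjugating \<open>B\<close> and \<open>b\<close> simultaneously, and its subgroup \<open>1 + w M\<^sub>2(R)\<close> acts on the line of
  the tower by \<open>\<phi>\<^sub>B\<close>.

  What remains is linear algebra over \<open>k\<close> (\<open>tower_classification\<close>): the \<open>B\<close> that occur are the regular matrices of
  trace \<open>t + c = 2 m\<^sub>0\<close>, where \<open>t = tr A\<close>; for a given \<open>B\<close> all possible \<open>b\<close> are conjugate under the centralizer of \<open>B\<close>; and
  only scalars fix both \<open>B\<close> and \<open>b\<close>. Hence each conjugacy class of such \<open>B\<close> contributes the
  representation induced from the character \<open>\<omega> \<phi>\<^sub>B\<close> of \<open>Z J\<^sub>2\<close>
  (\<open>isotypic_part_decomposition\<close>). To see the classification, view \<open>k\<^sup>4\<close> as \<open>L \<times> k\<close> with \<open>L = k[x]/(char_poly A)\<close>, where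
  \<open>C0\<close> acts as multiplication by \<open>(x, c)\<close>. The first two columns of a matrix that conjugates \<open>C0\<close> to a tower span
  a plane \<open>W\<close> with \<open>W + C0 W = k\<^sup>4\<close>. Up to the units of \<open>L \<times> k\<close>, which are the centralizer of \<open>C0\<close>,
  this plane is spanned by \<open>(x - c, 0)\<close> and \<open>(x\<^sup>2 + e, 1)\<close> for a unique scalar \<open>e\<close>. Expressing \<open>C0\<^sup>2 W\<close> through \<open>C0 W\<close> and \<open>W\<close>
  gives \<open>B\<close> and \<open>b\<close>; here \<open>B\<close> has trace \<open>t + c\<close> and determinant \<open>s - e\<close>, where \<open>s\<close> is the linear coefficient of
  \<open>char_poly A\<close>. A regular matrix of size two is determined up to conjugacy by its trace and determinant, so that
  \<open>e\<close> runs over the conjugacy classes in question.\<close>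

section \<open>Representations of finite groups\<close>

lemma finite_span_subspace:
  assumes "vector_space s" and "module.subspace s V" and "finite S" and "V \<subseteq> module.span s S"
  shows "\<exists>T. finite T \<and> V = module.span s T"
proof -
  interpret vector_space s by fact
  obtain T where T: "T \<subseteq> V" "independent T" "V \<subseteq> span T"
    using maximal_independent_subset[of V] by blast
  have "finite T"
    using independent_span_bound[of S T] T assms by auto
  moreover have "span T = V"
    using T assms(2) span_minimal by blast
  ultimately show ?thesis by blast
qed

lemma vector_space_pointwise:
  assumes "\<And>x. vector_space (s x)"
  shows "vector_space (\<lambda>c f x. s x c (f x))"
proof -
  interpret v: vector_space "s x" for x by fact
  show ?thesis
    by unfold_locales (auto simp: fun_eq_iff v.scale_right_distrib v.scale_left_distrib)
qed

lemma sum_fun_apply: "(\<Sum>i\<in>A. f i) x = (\<Sum>i\<in>A. f i x)" for f :: "'i \<Rightarrow> 'a \<Rightarrow> 'b::comm_monoid_add"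
  by (induction A rule: infinite_finite_induct) auto

text \<open>Functions supported on a finite set with values in finite-dimensional spaces are
  spanned by the functions that are supported at one point and have a spanning vector as value.\<close>

lemma finite_dim_pointwise:
  assumes vs: "\<And>x. vector_space (s x)" and "finite X"
    and fin: "\<And>x. x \<in> X \<Longrightarrow> finite (S x)"
    and mem: "\<And>f x. f \<in> W \<Longrightarrow> x \<in> X \<Longrightarrow> f x \<in> module.span (s x) (S x)"
    and zero: "\<And>f x. f \<in> W \<Longrightarrow> x \<notin> X \<Longrightarrow> f x = 0"
    and sub: "module.subspace (\<lambda>c f x. s x c (f x)) W"
  shows "\<exists>T. finite T \<and> W = module.span (\<lambda>c f x. s x c (f x)) T"
proof -
  interpret v: vector_space "s x" for x by (rule vs)
  let ?s = "\<lambda>c f x. s x c (f x)"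
  let ?\<delta> = "\<lambda>x u y. if y = x then u else 0"
  interpret p: vector_space ?s by (rule vector_space_pointwise) (rule vs)
  let ?T = "\<Union>x\<in>X. ?\<delta> x ` S x"
  have \<delta>: "?\<delta> x u \<in> p.span ?T" if "x \<in> X" "u \<in> v.span x (S x)" for x u
    using that(2)
  proof (induction rule: v.span_induct_alt)
    case base
    have eq: "?\<delta> x 0 = 0" by (simp add: fun_eq_iff)
    show ?case unfolding eq by (rule p.span_zero)
  next
    case (step c a b)
    have eq: "?\<delta> x (s x c a + b) = ?s c (?\<delta> x a) + ?\<delta> x b"
      by (auto simp: fun_eq_iff)
    have "?\<delta> x a \<in> p.span ?T" using step(1) that(1) by (intro p.span_base) blast
    from p.span_add[OF p.span_scale[OF this] step(2)] show ?case
      unfolding eq .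
  qed
  have "f \<in> p.span ?T" if "f \<in> W" for f
  proof -
    have "f = (\<Sum>x\<in>X. ?\<delta> x (f x))"
    proof
      fix y
      show "f y = (\<Sum>x\<in>X. ?\<delta> x (f x)) y"
        using zero[OF that, of y] \<open>finite X\<close> by (cases "y \<in> X") (auto simp: sum_fun_apply)
    qed
    moreover have "(\<Sum>x\<in>X. ?\<delta> x (f x)) \<in> p.span ?T"
      using \<delta> mem[OF that] by (intro p.span_sum) auto
    ultimately show ?thesis by simp
  qed
  then show ?thesis
    using assms(2) fin sub by (intro finite_span_subspace[of ?s W ?T] p.vector_space_axioms) auto
qed

lemma representation_induced:
  assumes "group G" and "finite (carrier G)" and HG: "H \<subseteq> carrier G"
    and vs: "vector_space (rep_scale \<sigma>)" and sub: "module.subspace (rep_scale \<sigma>) (rep_space \<sigma>)"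
    and fin: "\<exists>S. finite S \<and> rep_space \<sigma> = module.span (rep_scale \<sigma>) S"
    and add: "\<And>h v w. h \<in> H \<Longrightarrow> v \<in> rep_space \<sigma> \<Longrightarrow> w \<in> rep_space \<sigma> \<Longrightarrow>
      rep_act \<sigma> h (v + w) = rep_act \<sigma> h v + rep_act \<sigma> h w"
    and scale: "\<And>h c v. h \<in> H \<Longrightarrow> v \<in> rep_space \<sigma> \<Longrightarrow>
      rep_act \<sigma> h (rep_scale \<sigma> c v) = rep_scale \<sigma> c (rep_act \<sigma> h v)"
  shows "representation G (induced G H \<sigma>)"
proof -
  interpret group G by fact
  interpret v: vector_space "rep_scale \<sigma>" by fact
  let ?s = "\<lambda>c f x. rep_scale \<sigma> c (f x)"
  interpret p: vector_space ?s by (rule vector_space_pointwise) (rule vs)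
  let ?W = "rep_space (induced G H \<sigma>)"
  obtain S where S: "finite S" "rep_space \<sigma> = v.span S" using fin by blast
  have zero: "rep_act \<sigma> h 0 = 0" if "h \<in> H" for h
    using scale[OF that, of 0 0] v.subspace_0[OF sub] by simp
  let ?I = "induced G H \<sigma>"
  have W: "p.subspace ?W"
    unfolding p.subspace_def
    using v.subspace_0[OF sub] v.subspace_add[OF sub] v.subspace_scale[OF sub]
    by (simp add: induced_def zero add scale)
  have "\<exists>T. finite T \<and> ?W = p.span T"
  proof (rule finite_dim_pointwise[of "\<lambda>_. rep_scale \<sigma>" "carrier G" "\<lambda>_. S"])
    show "f x \<in> v.span S" if "f \<in> ?W" "x \<in> carrier G" for f x
      using that S(2) by (simp add: induced_def)
    show "f x = 0" if "f \<in> ?W" "x \<notin> carrier G" for f x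
      using that by (simp add: induced_def)
  qed (use vs \<open>finite (carrier G)\<close> S(1) W in simp_all)
  moreover have "rep_act ?I g f \<in> ?W" if "g \<in> carrier G" "f \<in> ?W" for g f
    using that HG m_assoc by (simp add: induced_def subset_eq)
  moreover have "rep_act ?I g (f + f') = rep_act ?I g f + rep_act ?I g f'" for g f f'
    by (simp add: induced_def fun_eq_iff)
  moreover have "rep_act ?I g (?s c f) = ?s c (rep_act ?I g f)" for g c f
    by (simp add: induced_def fun_eq_iff)
  moreover have "rep_act ?I \<one>\<^bsub>G\<^esub> f = f" if "f \<in> ?W" for f
    using that by (simp add: induced_def fun_eq_iff)
  moreover have "rep_act ?I (g \<otimes>\<^bsub>G\<^esub> h) f = rep_act ?I g (rep_act ?I h f)"
    if "g \<in> carrier G" "h \<in> carrier G" for g h f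
    using that m_assoc by (simp add: induced_def fun_eq_iff)
  moreover have "rep_scale ?I = ?s"
    by (simp add: induced_def)
  ultimately show ?thesis
    unfolding representation_def using W p.vector_space_axioms by simp
qed

lemma representation_char_rep_induced:
  assumes "group G" and "finite (carrier G)" and "H \<subseteq> carrier G"
  shows "representation G (induced G H (char_rep \<theta>))"
proof -
  interpret c: vector_space "(*) :: complex \<Rightarrow> complex \<Rightarrow> complex"
    by unfold_locales (auto simp: algebra_simps)
  have "c.span {1} = UNIV"
    using c.span_singleton[of 1] by auto
  then have "\<exists>S. finite S \<and> rep_space (char_rep \<theta>) = c.span S"
    by (intro exI[of _ "{1}"]) (simp add: char_rep_def)
  then show ?thesis
    using c.vector_space_axioms c.subspace_UNIV
    by (intro representation_induced assms) (simp_all add: char_rep_def distrib_left)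
qed

lemma representation_direct_sum:
  fixes \<sigma> :: "'i \<Rightarrow> ('g, 'v::ab_group_add) rep"
  assumes "finite I" and "group G"
    and rep: "\<And>i. i \<in> I \<Longrightarrow> representation G (\<sigma> i)"
    and vs: "\<And>i. vector_space (rep_scale (\<sigma> i))"
  shows "representation G (direct_sum I \<sigma>)"
proof -
  interpret group G by fact
  interpret v: vector_space "rep_scale (\<sigma> i)" for i by (rule vs)
  let ?s = "\<lambda>c f i. rep_scale (\<sigma> i) c (f i)"
  interpret p: vector_space ?s by (rule vector_space_pointwise) (rule vs)
  let ?W = "rep_space (direct_sum I \<sigma>)"
  have fin: "finite {i. f i \<noteq> 0}" if "\<forall>i. i \<notin> I \<longrightarrow> f i = 0" for f :: "'i \<Rightarrow> 'v"
    by (rule finite_subset[OF _ \<open>finite I\<close>]) (use that in auto)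
  have space: "?W = {f. (\<forall>i\<in>I. f i \<in> rep_space (\<sigma> i)) \<and> (\<forall>i. i \<notin> I \<longrightarrow> f i = 0)}"
    using fin by (auto simp: direct_sum_def)
  have sub: "v.subspace i (rep_space (\<sigma> i))" if "i \<in> I" for i
    using rep[OF that] by (simp add: representation_def)
  have W: "p.subspace ?W"
    unfolding p.subspace_def space
    using v.subspace_0[OF sub] v.subspace_add[OF sub] v.subspace_scale[OF sub] by auto
  have "\<forall>i\<in>I. \<exists>S. finite S \<and> rep_space (\<sigma> i) = v.span i S"
    using rep by (simp add: representation_def)
  then obtain S where S: "\<And>i. i \<in> I \<Longrightarrow> finite (S i)" "\<And>i. i \<in> I \<Longrightarrow> rep_space (\<sigma> i) = v.span i (S i)"
    by metis
  have "\<exists>T. finite T \<and> ?W = p.span T"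
    by (rule finite_dim_pointwise[of "\<lambda>i. rep_scale (\<sigma> i)" I S])
      (use \<open>finite I\<close> vs W S in \<open>auto simp: space\<close>)
  moreover have "rep_act (direct_sum I \<sigma>) g f \<in> ?W" if "g \<in> carrier G" "f \<in> ?W" for g f
    using that rep unfolding space by (auto simp: direct_sum_def representation_def)
  moreover have "\<forall>g\<in>carrier G. \<forall>f\<in>?W. \<forall>f'\<in>?W. rep_act (direct_sum I \<sigma>) g (f + f')
      = rep_act (direct_sum I \<sigma>) g f + rep_act (direct_sum I \<sigma>) g f'"
    using rep unfolding space by (auto simp: direct_sum_def representation_def fun_eq_iff)
  moreover have "\<forall>g\<in>carrier G. \<forall>c. \<forall>f\<in>?W. rep_act (direct_sum I \<sigma>) g (?s c f)
      = ?s c (rep_act (direct_sum I \<sigma>) g f)"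
    using rep unfolding space by (auto simp: direct_sum_def representation_def fun_eq_iff)
  moreover have "\<forall>f\<in>?W. rep_act (direct_sum I \<sigma>) \<one>\<^bsub>G\<^esub> f = f"
    using rep unfolding space by (auto simp: direct_sum_def representation_def fun_eq_iff)
  moreover have "\<forall>g\<in>carrier G. \<forall>h\<in>carrier G. \<forall>f\<in>?W. rep_act (direct_sum I \<sigma>) (g \<otimes>\<^bsub>G\<^esub> h) f
      = rep_act (direct_sum I \<sigma>) g (rep_act (direct_sum I \<sigma>) h f)"
    using rep unfolding space by (auto simp: direct_sum_def representation_def fun_eq_iff)
  moreover have "rep_scale (direct_sum I \<sigma>) = ?s"
    by (simp add: direct_sum_def)
  ultimately show ?thesis
    unfolding representation_def using W p.vector_space_axioms by simp
qed

section \<open>Monomial representations and Mackey theory\<close>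

locale finite_group_rep = group G for G :: "('g, 'c) monoid_scheme" (structure) +
  fixes \<pi> :: "('g, 'v::ab_group_add) rep"
  assumes finite_group: "finite (carrier G)" and rep: "representation G \<pi>"
begin

abbreviation "V \<equiv> rep_space \<pi>"
abbreviation "act \<equiv> rep_act \<pi>"
abbreviation "scale \<equiv> rep_scale \<pi>"

sublocale vs: vector_space scale
  using rep by (simp add: representation_def)

lemma subspace_V: "vs.subspace V"
  using rep by (simp add: representation_def)

lemma act_closed: "g \<in> carrier G \<Longrightarrow> v \<in> V \<Longrightarrow> act g v \<in> V"
  and act_add: "g \<in> carrier G \<Longrightarrow> v \<in> V \<Longrightarrow> w \<in> V \<Longrightarrow> act g (v + w) = act g v + act g w"
  and act_scale: "g \<in> carrier G \<Longrightarrow> v \<in> V \<Longrightarrow> act g (scale c v) = scale c (act g v)"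
  and act_one: "v \<in> V \<Longrightarrow> act \<one> v = v"
  and act_mult: "g \<in> carrier G \<Longrightarrow> h \<in> carrier G \<Longrightarrow> v \<in> V \<Longrightarrow> act (g \<otimes> h) v = act g (act h v)"
  using rep by (auto simp: representation_def)

lemma zero_V: "0 \<in> V"
  and add_V: "v \<in> V \<Longrightarrow> w \<in> V \<Longrightarrow> v + w \<in> V"
  and scale_V: "v \<in> V \<Longrightarrow> scale c v \<in> V"
  and diff_V: "v \<in> V \<Longrightarrow> w \<in> V \<Longrightarrow> v - w \<in> V"
  and sum_V: "(\<And>i. i \<in> I \<Longrightarrow> f i \<in> V) \<Longrightarrow> sum f I \<in> V"
  using subspace_V vs.subspace_0 vs.subspace_add vs.subspace_scale vs.subspace_diff
    vs.subspace_sum by blast+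

lemma act_zero: "g \<in> carrier G \<Longrightarrow> act g 0 = 0"
  using act_scale[of g 0 0] zero_V by simp

lemma act_sum:
  "g \<in> carrier G \<Longrightarrow> (\<And>i. i \<in> I \<Longrightarrow> f i \<in> V) \<Longrightarrow> act g (sum f I) = (\<Sum>i\<in>I. act g (f i))"
  by (induction I rule: infinite_finite_induct) (auto simp: act_zero act_add sum_V)

end

text \<open>A representation is induced from the character \<open>\<mu>\<close> of \<open>H\<close> exactly if it has such a functional
  \<open>ev\<close> and vector \<open>e\<close>: in the space of functions \<open>f\<close> with \<open>f (h x) = \<mu> h * f x\<close> they are
  evaluation at the unit and the extension of \<open>\<mu>\<close> by zero. Induction in stages, and an
  induction from another subgroup, only change this pair, so that no isomorphism has to be
  written down until the end.\<close>

locale monomial_model = finite_group_rep G \<pi>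
  for G :: "('g, 'c) monoid_scheme" (structure) and \<pi> :: "('g, 'v::ab_group_add) rep" +
  fixes H :: "'g set" and \<mu> :: "'g \<Rightarrow> complex" and ev :: "'v \<Rightarrow> complex" and e :: 'v
  assumes H: "subgroup H G"
    and e_V: "e \<in> V" and ev_e: "ev e = 1"
    and ev_add: "v \<in> V \<Longrightarrow> w \<in> V \<Longrightarrow> ev (v + w) = ev v + ev w"
    and ev_scale: "v \<in> V \<Longrightarrow> ev (scale c v) = c * ev v"
    and ev_act: "h \<in> H \<Longrightarrow> v \<in> V \<Longrightarrow> ev (act h v) = \<mu> h * ev v"
    and ev_act_e: "g \<in> carrier G \<Longrightarrow> g \<notin> H \<Longrightarrow> ev (act g e) = 0"
    and separating: "v \<in> V \<Longrightarrow> (\<And>g. g \<in> carrier G \<Longrightarrow> ev (act g v) = 0) \<Longrightarrow> v = 0"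
begin

lemma H_carrier: "h \<in> H \<Longrightarrow> h \<in> carrier G"
  using H subgroup.subset by blast

lemma ev_zero: "ev 0 = 0"
  using ev_scale[of 0 0] zero_V by simp

lemma ev_sum: "(\<And>i. i \<in> I \<Longrightarrow> f i \<in> V) \<Longrightarrow> ev (sum f I) = (\<Sum>i\<in>I. ev (f i))"
  by (induction I rule: infinite_finite_induct) (auto simp: ev_zero ev_add sum_V)

lemma char_eq: "h \<in> H \<Longrightarrow> \<mu> h = ev (act h e)"
  using ev_act e_V ev_e by simp

lemma char_mult: "h \<in> H \<Longrightarrow> k \<in> H \<Longrightarrow> \<mu> (h \<otimes> k) = \<mu> h * \<mu> k"
  using char_eq[of "h \<otimes> k"] subgroup.m_closed[OF H, of h k] act_mult[of h k e] ev_act[of h "act k e"]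
    H_carrier e_V act_closed by (simp add: char_eq[of k])

text \<open>The average of \<open>ev\<close> over a normal subgroup \<open>K\<close> against a character \<open>\<phi>\<close> that agrees with
  \<open>\<mu>\<close> on \<open>K \<inter> H\<close> exhibits the representation as induced from the stabilizer of \<open>\<phi>\<close>. Outside the
  stabilizer the matrix coefficient vanishes because it transforms under \<open>K\<close> by two different
  characters. The average still separates vectors: summing it over \<open>U\<close> cancels all of \<open>K - H\<close>
  and gives back a multiple of \<open>ev\<close>.\<close>

theorem change_of_polarization:
  fixes K U :: "'g set" and \<phi> :: "'g \<Rightarrow> complex"
  defines "stab \<equiv> {g \<in> carrier G. \<forall>k\<in>K. \<phi> (g \<otimes> k \<otimes> inv g) = \<phi> k}"
  assumes K: "K \<lhd> G"
    and \<phi>_mult: "\<And>k k'. k \<in> K \<Longrightarrow> k' \<in> K \<Longrightarrow> \<phi> (k \<otimes> k') = \<phi> k * \<phi> k'"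
    and \<phi>_nz: "\<And>k. k \<in> K \<Longrightarrow> \<phi> k \<noteq> 0"
    and agree: "\<And>k. k \<in> K \<Longrightarrow> k \<in> H \<Longrightarrow> \<mu> k = \<phi> k"
    and stab: "\<And>g. g \<in> stab \<Longrightarrow> \<exists>k\<in>K. \<exists>h\<in>H. h \<in> stab \<and> g = k \<otimes> h"
    and U: "subgroup U G" "U \<subseteq> H" "\<And>u. u \<in> U \<Longrightarrow> \<mu> u = 1"
    and cancel: "\<And>k. k \<in> K \<Longrightarrow> k \<notin> H \<Longrightarrow> \<exists>u0\<in>U. \<exists>\<zeta>. \<zeta> \<noteq> 1 \<and>
      (\<forall>u\<in>U. \<phi> ((u \<otimes> u0) \<otimes> k \<otimes> inv (u \<otimes> u0)) = \<zeta> * \<phi> (u \<otimes> k \<otimes> inv u))"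
  shows "\<exists>\<mu>' ev' e'. monomial_model G \<pi> stab \<mu>' ev' e' \<and> (\<forall>k\<in>K. \<mu>' k = \<phi> k)"
proof -
  have Ksub: "subgroup K G" using K normal_imp_subgroup by blast
  have Kc[simp]: "k \<in> carrier G" if "k \<in> K" for k using that subgroup.subset[OF Ksub] by blast
  have Kconj: "g \<otimes> k \<otimes> inv g \<in> K" if "g \<in> carrier G" "k \<in> K" for g k
    using normal.inv_op_closed2[OF K] that by blast
  have Kconj': "inv g \<otimes> k \<otimes> g \<in> K" if "g \<in> carrier G" "k \<in> K" for g k
    using normal.inv_op_closed1[OF K] that by blast
  have Kmult: "k \<otimes> k' \<in> K" and Kinv: "inv k \<in> K" if "k \<in> K" "k' \<in> K" for k k'
    using that subgroup.m_closed[OF Ksub] subgroup.m_inv_closed[OF Ksub] by auto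
  have finK: "finite K" using finite_group subgroup.subset[OF Ksub] finite_subset by blast
  have \<phi>_one: "\<phi> \<one> = 1"
    using \<phi>_mult[of \<one> \<one>] \<phi>_nz[of \<one>] subgroup.one_closed[OF Ksub] by simp
  have \<phi>_inv: "\<phi> (inv k) = 1 / \<phi> k" if "k \<in> K" for k
    using \<phi>_mult[of k "inv k"] Kinv[OF that that] that \<phi>_one \<phi>_nz[OF that] by (simp add: field_simps)
  define avg where "avg v = (\<Sum>k\<in>K. scale (1 / \<phi> k) (act k v))" for v
  have avg_V: "avg v \<in> V" if "v \<in> V" for v
    unfolding avg_def using that by (intro sum_V scale_V act_closed) auto
  have act_avg: "act k (avg v) = scale (\<phi> k) (avg v)" if k: "k \<in> K" and v: "v \<in> V" for k v
  proof -
    have "act k (avg v) = (\<Sum>k'\<in>K. scale (1 / \<phi> k') (act (k \<otimes> k') v))"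
      unfolding avg_def using k v by (simp add: act_sum scale_V act_closed act_scale act_mult)
    also have "\<dots> = (\<Sum>k'\<in>K. scale (\<phi> k / \<phi> k') (act k' v))"
      by (rule sum.reindex_bij_witness[of _ "\<lambda>k'. inv k \<otimes> k'" "\<lambda>k'. k \<otimes> k'"])
        (use k \<phi>_nz in \<open>auto simp: Kmult Kinv \<phi>_mult m_assoc[symmetric]\<close>)
    also have "\<dots> = scale (\<phi> k) (avg v)"
      unfolding avg_def by (simp add: vs.scale_sum_right)
    finally show ?thesis .
  qed
  have avg_act: "avg (act k v) = scale (\<phi> k) (avg v)" if k: "k \<in> K" and v: "v \<in> V" for k v
  proof -
    have "avg (act k v) = (\<Sum>k'\<in>K. scale (1 / \<phi> k') (act (k' \<otimes> k) v))"
      unfolding avg_def using k v by (intro sum.cong) (auto simp: act_mult)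
    also have "\<dots> = (\<Sum>k'\<in>K. scale (\<phi> k / \<phi> k') (act k' v))"
      by (rule sum.reindex_bij_witness[of _ "\<lambda>k'. k' \<otimes> inv k" "\<lambda>k'. k' \<otimes> k"])
        (use k \<phi>_nz in \<open>auto simp: Kmult Kinv \<phi>_mult m_assoc\<close>)
    also have "\<dots> = scale (\<phi> k) (avg v)"
      unfolding avg_def by (simp add: vs.scale_sum_right)
    finally show ?thesis .
  qed
  have ev_avg: "ev (avg v) = (\<Sum>k\<in>K. ev (act k v) / \<phi> k)" if "v \<in> V" for v
    unfolding avg_def using that by (simp add: ev_sum scale_V act_closed ev_scale)
  have stabG: "g \<in> carrier G" if "g \<in> stab" for g using that by (simp add: stab_def)
  have stab_conj: "\<phi> (g \<otimes> k \<otimes> inv g) = \<phi> k" if "g \<in> stab" "k \<in> K" for g k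
    using that by (simp add: stab_def)
  have stab_mult: "g \<otimes> h \<in> stab" if "g \<in> stab" "h \<in> stab" for g h
  proof -
    have "\<phi> (g \<otimes> h \<otimes> k \<otimes> inv (g \<otimes> h)) = \<phi> k" if k: "k \<in> K" for k
    proof -
      have "g \<otimes> h \<otimes> k \<otimes> inv (g \<otimes> h) = g \<otimes> (h \<otimes> k \<otimes> inv h) \<otimes> inv g"
        using stabG \<open>g \<in> stab\<close> \<open>h \<in> stab\<close> k by (simp add: inv_mult_group m_assoc)
      then show ?thesis
        using stab_conj \<open>g \<in> stab\<close> \<open>h \<in> stab\<close> k Kconj[of h k] stabG by simp
    qed
    then show ?thesis using stabG that by (simp add: stab_def)
  qed
  have stab_inv: "inv g \<in> stab" if "g \<in> stab" for g
  proof -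
    have "\<phi> (inv g \<otimes> k \<otimes> inv (inv g)) = \<phi> k" if k: "k \<in> K" for k
      using stab_conj[OF \<open>g \<in> stab\<close>, of "inv g \<otimes> k \<otimes> g"] Kconj'[OF stabG[OF \<open>g \<in> stab\<close>] k]
        stabG[OF \<open>g \<in> stab\<close>] k by (simp add: m_assoc) (simp add: m_assoc[symmetric])
    then show ?thesis using stabG[OF that] by (simp add: stab_def)
  qed
  have K_stab: "k \<in> stab" if "k \<in> K" for k
    using that \<phi>_nz[OF that] by (simp add: stab_def \<phi>_mult Kmult Kinv \<phi>_inv)
  have stab_sub: "subgroup stab G"
    by (intro subgroupI) (use stabG stab_mult stab_inv K_stab subgroup.one_closed[OF Ksub] in blast)+
  \<comment> \<open>Conjugation by \<open>h\<close> permutes the terms of the average and fixes \<open>\<phi>\<close>.\<close>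
  have ev_avg_H: "ev (avg (act h v)) = \<mu> h * ev (avg v)" if h: "h \<in> H" "h \<in> stab" and v: "v \<in> V" for h v
  proof -
    have hG: "h \<in> carrier G" using h H_carrier by blast
    have "ev (avg (act h v)) = (\<Sum>k\<in>K. ev (act k (act h v)) / \<phi> k)"
      using ev_avg act_closed hG v by blast
    also have "\<dots> = (\<Sum>k\<in>K. ev (act (h \<otimes> k) v) / \<phi> k)"
    proof (rule sum.reindex_bij_witness[of _ "\<lambda>k. h \<otimes> k \<otimes> inv h" "\<lambda>k. inv h \<otimes> k \<otimes> h"])
      fix k assume k: "k \<in> K"
      have "h \<otimes> (inv h \<otimes> k \<otimes> h) = k \<otimes> h" using k hG by (simp add: m_assoc[symmetric])
      moreover have "\<phi> (inv h \<otimes> k \<otimes> h) = \<phi> k"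
        using stab_conj[OF stab_inv[OF h(2)] k] hG by simp
      ultimately show "ev (act (h \<otimes> (inv h \<otimes> k \<otimes> h)) v) / \<phi> (inv h \<otimes> k \<otimes> h)
          = ev (act k (act h v)) / \<phi> k"
        using k hG v by (simp add: act_mult)
      show "h \<otimes> (inv h \<otimes> k \<otimes> h) \<otimes> inv h = k" using k hG by (simp add: m_assoc[symmetric]) (simp add: m_assoc)
      show "inv h \<otimes> (h \<otimes> k \<otimes> inv h) \<otimes> h = k" using k hG by (simp add: m_assoc[symmetric]) (simp add: m_assoc)
    qed (use hG Kconj Kconj' in auto)
    also have "\<dots> = \<mu> h * ev (avg v)"
      unfolding ev_avg[OF v] sum_distrib_left
      using h(1) hG v by (intro sum.cong) (auto simp: act_mult act_closed ev_act)
    finally show ?thesis .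
  qed
  define c where "c = ev (avg (avg e))"
  have c: "c \<noteq> 0"
  proof -
    have "ev (act k e) / \<phi> k = (if k \<in> K \<inter> H then 1 else 0)" if "k \<in> K" for k
      using that agree[OF that] \<phi>_nz[OF that] ev_act[of k e] ev_act_e[of k] e_V ev_e by auto
    then have "ev (avg e) = card (K \<inter> H)"
      using ev_avg[OF e_V] finK by (simp add: sum.If_cases)
    moreover have "card (K \<inter> H) \<noteq> 0" "card K \<noteq> 0"
      using subgroup.one_closed[OF Ksub] subgroup.one_closed[OF H] finK by auto
    moreover have "c = card K * ev (avg e)"
      unfolding c_def ev_avg[OF avg_V[OF e_V]]
      using e_V avg_V \<phi>_nz by (simp add: act_avg ev_scale)
    ultimately show ?thesis by simp
  qed
  define e' where "e' = scale (1 / c) (avg e)"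
  define ev' where "ev' v = ev (avg v)" for v
  have avg_add: "avg (v + w) = avg v + avg w" if "v \<in> V" "w \<in> V" for v w
    unfolding avg_def using that by (simp add: act_add vs.scale_right_distrib sum.distrib)
  have avg_scale: "avg (scale a v) = scale a (avg v)" if "v \<in> V" for a v
    unfolding avg_def using that by (simp add: act_scale vs.scale_sum_right mult.commute)
  have e'_V: "e' \<in> V" unfolding e'_def using e_V avg_V scale_V by blast
  have ev'_e': "ev' e' = 1"
    unfolding ev'_def e'_def using c e_V avg_V by (simp add: avg_scale ev_scale c_def)
  have ev'_K: "ev' (act k v) = \<phi> k * ev' v" if "k \<in> K" "v \<in> V" for k v
    unfolding ev'_def using that avg_V by (simp add: avg_act ev_scale)
  define \<mu>' where "\<mu>' g = ev' (act g e')" for g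
  have ev'_stab: "ev' (act g v) = \<mu>' g * ev' v" if g: "g \<in> stab" and v: "v \<in> V" for g v
  proof -
    obtain k h where kh: "k \<in> K" "h \<in> H" "h \<in> stab" "g = k \<otimes> h" using stab[OF g] by blast
    have "ev' (act g x) = \<phi> k * \<mu> h * ev' x" if x: "x \<in> V" for x
    proof -
      have "ev' (act g x) = ev' (act k (act h x))"
        using kh x H_carrier by (simp add: act_mult)
      also have "\<dots> = \<phi> k * ev' (act h x)"
        using kh x H_carrier act_closed by (simp add: ev'_K)
      also have "ev' (act h x) = \<mu> h * ev' x"
        unfolding ev'_def using kh x ev_avg_H by simp
      finally show ?thesis by simp
    qed
    then show ?thesis unfolding \<mu>'_def using v e'_V ev'_e' by simp
  qed
  have ev'_off: "ev' (act g e') = 0" if g: "g \<in> carrier G" "g \<notin> stab" for g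
  proof -
    obtain k where k: "k \<in> K" "\<phi> (g \<otimes> k \<otimes> inv g) \<noteq> \<phi> k" using g by (auto simp: stab_def)
    have "act k e' = scale (\<phi> k) e'"
      unfolding e'_def using k(1) e_V avg_V by (simp add: act_scale act_avg mult.commute)
    then have "\<phi> k * ev' (act g e') = ev' (act g (act k e'))"
      unfolding ev'_def using g(1) e'_V avg_V act_closed by (simp add: act_scale avg_scale ev_scale)
    also have "act g (act k e') = act (g \<otimes> k) e'"
      using g(1) k(1) e'_V by (simp add: act_mult)
    also have "g \<otimes> k = (g \<otimes> k \<otimes> inv g) \<otimes> g"
      using g(1) k(1) by (simp add: m_assoc)
    also have "ev' (act ((g \<otimes> k \<otimes> inv g) \<otimes> g) e') = \<phi> (g \<otimes> k \<otimes> inv g) * ev' (act g e')"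
      using g(1) k(1) act_mult[OF _ g(1) e'_V, of "g \<otimes> k \<otimes> inv g"]
        ev'_K[OF Kconj act_closed, OF g(1) k(1) g(1) e'_V] by simp
    finally show ?thesis using k(2) by auto
  qed
  have Uc: "u \<in> carrier G" if "u \<in> U" for u using that U(2) H_carrier by blast
  have finU: "finite U" by (rule finite_subset[OF _ finite_group]) (use Uc in blast)
  have "v = 0" if v: "v \<in> V" and all: "\<And>g. g \<in> carrier G \<Longrightarrow> ev' (act g v) = 0" for v
  proof (rule separating[OF v])
    fix g assume g: "g \<in> carrier G"
    let ?w = "act g v"
    have w: "?w \<in> V" using g v act_closed by blast
    have "0 = (\<Sum>u\<in>U. ev' (act u ?w))"
      using all g v Uc act_mult[symmetric] by simp
    also have "\<dots> = (\<Sum>u\<in>U. \<Sum>k\<in>K. ev (act k (act u ?w)) / \<phi> k)"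
      unfolding ev'_def using act_closed[OF Uc w] by (intro sum.cong refl ev_avg)
    also have "\<dots> = (\<Sum>u\<in>U. \<Sum>k\<in>K. ev (act k ?w) / \<phi> (u \<otimes> k \<otimes> inv u))"
    proof (rule sum.cong[OF refl])
      fix u assume u: "u \<in> U"
      have uG: "u \<in> carrier G" using u Uc by blast
      show "(\<Sum>k\<in>K. ev (act k (act u ?w)) / \<phi> k) = (\<Sum>k\<in>K. ev (act k ?w) / \<phi> (u \<otimes> k \<otimes> inv u))"
      proof (rule sum.reindex_bij_witness[of _ "\<lambda>k. u \<otimes> k \<otimes> inv u" "\<lambda>k. inv u \<otimes> k \<otimes> u"])
        fix k assume k: "k \<in> K"
        have 1: "u \<otimes> (inv u \<otimes> k \<otimes> u) = k \<otimes> u" using k uG by (simp add: m_assoc[symmetric])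
        have "ev (act k (act u ?w)) = ev (act (u \<otimes> (inv u \<otimes> k \<otimes> u)) ?w)"
          unfolding 1 using k uG w by (simp add: act_mult)
        also have "\<dots> = ev (act (inv u \<otimes> k \<otimes> u) ?w)"
          using u U(2,3) k uG w act_closed ev_act by (subst act_mult) auto
        finally show "ev (act (inv u \<otimes> k \<otimes> u) ?w) / \<phi> (u \<otimes> (inv u \<otimes> k \<otimes> u) \<otimes> inv u)
            = ev (act k (act u ?w)) / \<phi> k"
          unfolding 1 using k uG by (simp add: m_assoc)
        show "u \<otimes> (inv u \<otimes> k \<otimes> u) \<otimes> inv u = k" using k uG by (simp add: m_assoc[symmetric]) (simp add: m_assoc)
        show "inv u \<otimes> (u \<otimes> k \<otimes> inv u) \<otimes> u = k" using k uG by (simp add: m_assoc[symmetric]) (simp add: m_assoc)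
      qed (use uG Kconj Kconj' in auto)
    qed
    also have "\<dots> = (\<Sum>k\<in>K. ev (act k ?w) * (\<Sum>u\<in>U. \<phi> (u \<otimes> inv k \<otimes> inv u)))"
    proof (subst sum.swap, intro sum.cong refl)
      fix k assume k: "k \<in> K"
      have "1 / \<phi> (u \<otimes> k \<otimes> inv u) = \<phi> (u \<otimes> inv k \<otimes> inv u)" if "u \<in> U" for u
        using \<phi>_inv[OF Kconj[OF Uc[OF that] k]] k Uc[OF that]
        by (simp add: inv_mult_group m_assoc)
      then show "(\<Sum>u\<in>U. ev (act k ?w) / \<phi> (u \<otimes> k \<otimes> inv u))
          = ev (act k ?w) * (\<Sum>u\<in>U. \<phi> (u \<otimes> inv k \<otimes> inv u))"
        unfolding sum_distrib_left
        by (intro sum.cong refl) (metis (no_types, lifting) mult.right_neutral times_divide_eq_right)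
    qed
    also have "\<dots> = (\<Sum>k\<in>K. if k \<in> H then card U * ev ?w else 0)"
    proof (intro sum.cong refl)
      fix k assume k: "k \<in> K"
      show "ev (act k ?w) * (\<Sum>u\<in>U. \<phi> (u \<otimes> inv k \<otimes> inv u)) = (if k \<in> H then card U * ev ?w else 0)"
      proof (cases "k \<in> H")
        case True
        have "\<phi> (u \<otimes> inv k \<otimes> inv u) = 1 / \<phi> k" if u: "u \<in> U" for u
        proof -
          have uH: "u \<in> H" "inv u \<in> H" "inv k \<in> H" "inv u \<in> U"
            using u U True subgroup.m_inv_closed[OF H] subgroup.m_inv_closed[OF U(1)] by auto
          have "\<phi> (u \<otimes> inv k \<otimes> inv u) = \<mu> (u \<otimes> inv k \<otimes> inv u)"
            using agree[OF Kconj[OF Uc[OF u] Kinv[OF k k]]] subgroup.m_closed[OF H] uH by auto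
          also have "\<dots> = \<mu> (inv k)"
            using uH U(3) u subgroup.m_closed[OF H] by (simp add: char_mult)
          also have "\<dots> = 1 / \<phi> k"
            using agree[of "inv k"] Kinv[OF k k] uH \<phi>_inv[OF k] by simp
          finally show ?thesis .
        qed
        then show ?thesis
          using True k \<phi>_nz[OF k] w by (simp add: ev_act agree)
      next
        case False
        have "inv k \<notin> H" using False k subgroup.m_inv_closed[OF H, of "inv k"] by auto
        then obtain u0 \<zeta> where u0: "u0 \<in> U" "\<zeta> \<noteq> 1"
          "\<forall>u\<in>U. \<phi> ((u \<otimes> u0) \<otimes> inv k \<otimes> inv (u \<otimes> u0)) = \<zeta> * \<phi> (u \<otimes> inv k \<otimes> inv u)"
          using cancel[of "inv k"] Kinv[OF k k] by blast
        let ?\<Sigma> = "\<Sum>u\<in>U. \<phi> (u \<otimes> inv k \<otimes> inv u)"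
        have "?\<Sigma> = (\<Sum>u\<in>U. \<phi> ((u \<otimes> u0) \<otimes> inv k \<otimes> inv (u \<otimes> u0)))"
          by (rule sum.reindex_bij_witness[of _ "\<lambda>u. u \<otimes> u0" "\<lambda>u. u \<otimes> inv u0"])
            (use u0(1) Uc subgroup.m_closed[OF U(1)] subgroup.m_inv_closed[OF U(1)] in \<open>auto simp: m_assoc\<close>)
        also have "\<dots> = \<zeta> * ?\<Sigma>"
          unfolding sum_distrib_left using u0(3) by (intro sum.cong) auto
        finally have "?\<Sigma> = 0" using u0(2) by auto
        then show ?thesis using False by simp
      qed
    qed
    also have "\<dots> = card (K \<inter> H) * (card U * ev ?w)"
      using finK by (simp add: sum.If_cases)
    finally show "ev ?w = 0"
      using subgroup.one_closed[OF Ksub] subgroup.one_closed[OF H] subgroup.one_closed[OF U(1)]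
        finK finU by auto
  qed
  then have "monomial_model G \<pi> stab \<mu>' ev' e'"
    using stab_sub e'_V ev'_e' ev'_stab ev'_off avg_V
    by (intro monomial_model.intro finite_group_rep_axioms monomial_model_axioms.intro)
      (simp_all add: ev'_def avg_add avg_scale ev_add ev_scale)
  moreover have "\<forall>k\<in>K. \<mu>' k = \<phi> k"
    unfolding \<mu>'_def using ev'_K e'_V ev'_e' by simp
  ultimately show ?thesis by blast
qed

text \<open>Mackey theory for the \<open>(N, \<psi>)\<close>-isotypic part of a monomial representation, as a
  representation of a group \<open>M\<close> that normalizes \<open>N\<close> and fixes \<open>\<psi>\<close>. The double cosets
  \<open>H x N\<close> on which \<open>\<mu>\<close> and \<open>\<psi>\<close> are compatible are assumed to be the \<open>H (\<gamma> B) (d g) N\<close>,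
  each \<open>B\<close> giving one orbit of \<open>M\<close> with stabilizer \<open>Z\<close>. The isomorphism sends \<open>v\<close> to the functions
  \<open>g \<mapsto> ev (\<gamma> B * d g * v)\<close>. It is injective because \<open>ev (x * v)\<close> vanishes for \<open>x\<close> outside these double cosets
  and is determined on them by the values at \<open>\<gamma> B * d g\<close>.\<close>

theorem isotypic_part_decomposition:
  fixes M :: "('m, 'd) monoid_scheme" and d :: "'m \<Rightarrow> 'g" and N :: "'g set" and \<psi> :: "'g \<Rightarrow> complex"
    and \<B> :: "'i set" and \<gamma> :: "'i \<Rightarrow> 'g" and Z :: "'m set" and \<theta> :: "'i \<Rightarrow> 'm \<Rightarrow> complex"
  assumes M: "group M" "finite (carrier M)"
    and d: "d \<in> hom M G"
    and N: "subgroup N G"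
    and \<psi>_mult: "\<And>n n'. n \<in> N \<Longrightarrow> n' \<in> N \<Longrightarrow> \<psi> (n \<otimes> n') = \<psi> n * \<psi> n'"
    and \<psi>_nz: "\<And>n. n \<in> N \<Longrightarrow> \<psi> n \<noteq> 0"
    and dN: "\<And>g n. g \<in> carrier M \<Longrightarrow> n \<in> N \<Longrightarrow> d g \<otimes> n \<otimes> inv (d g) \<in> N"
    and d\<psi>: "\<And>g n. g \<in> carrier M \<Longrightarrow> n \<in> N \<Longrightarrow> \<psi> (d g \<otimes> n \<otimes> inv (d g)) = \<psi> n"
    and \<B>: "finite \<B>" and \<gamma>: "\<And>B. B \<in> \<B> \<Longrightarrow> \<gamma> B \<in> carrier G"
    and Z: "Z \<subseteq> carrier M"
    and Z_stab: "\<And>B g. B \<in> \<B> \<Longrightarrow> g \<in> Z \<Longrightarrow> \<gamma> B \<otimes> d g \<otimes> inv (\<gamma> B) \<in> H"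
    and Z_char: "\<And>B g. B \<in> \<B> \<Longrightarrow> g \<in> Z \<Longrightarrow> \<mu> (\<gamma> B \<otimes> d g \<otimes> inv (\<gamma> B)) = \<theta> B g"
    and free: "\<And>B B' g n. B \<in> \<B> \<Longrightarrow> B' \<in> \<B> \<Longrightarrow> g \<in> carrier M \<Longrightarrow> n \<in> N \<Longrightarrow>
      \<gamma> B \<otimes> d g \<otimes> n \<otimes> inv (\<gamma> B') \<in> H \<Longrightarrow>
      B = B' \<and> g \<in> Z \<and> \<mu> (\<gamma> B \<otimes> d g \<otimes> n \<otimes> inv (\<gamma> B')) = \<theta> B g * \<psi> n"
    and cover: "\<And>x. x \<in> carrier G \<Longrightarrow> (\<And>n. n \<in> N \<Longrightarrow> x \<otimes> n \<otimes> inv x \<in> H \<Longrightarrow> \<mu> (x \<otimes> n \<otimes> inv x) = \<psi> n) \<Longrightarrow>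
      \<exists>B\<in>\<B>. \<exists>g\<in>carrier M. \<exists>n\<in>N. \<exists>h\<in>H. x = h \<otimes> \<gamma> B \<otimes> d g \<otimes> n"
  shows "rep_iso M
    \<lparr>rep_scale = scale, rep_space = {v \<in> V. \<forall>n\<in>N. act n v = scale (\<psi> n) v}, rep_act = \<lambda>g. act (d g)\<rparr>
    (direct_sum \<B> (\<lambda>B. induced M Z (char_rep (\<theta> B))))"
proof -
  interpret M: group M by fact
  let ?W = "{v \<in> V. \<forall>n\<in>N. act n v = scale (\<psi> n) v}"
  let ?L = "\<lparr>rep_scale = scale, rep_space = ?W, rep_act = \<lambda>g. act (d g)\<rparr>"
  let ?R = "direct_sum \<B> (\<lambda>B. induced M Z (char_rep (\<theta> B)))"
  have Nc[simp]: "n \<in> carrier G" if "n \<in> N" for n using that subgroup.subset[OF N] by blast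
  have finN: "finite N" using finite_group subgroup.subset[OF N] finite_subset by blast
  have Nm: "n \<otimes> n' \<in> N" "inv n \<in> N" if "n \<in> N" "n' \<in> N" for n n'
    using that subgroup.m_closed[OF N] subgroup.m_inv_closed[OF N] by auto
  have N1: "\<one> \<in> N" using subgroup.one_closed[OF N] .
  have \<psi>1: "\<psi> \<one> = 1" using \<psi>_mult[OF N1 N1] \<psi>_nz[OF N1] by simp
  have dc[simp]: "d g \<in> carrier G" if "g \<in> carrier M" for g using d that by (auto simp: hom_def)
  have dm: "d (g \<otimes>\<^bsub>M\<^esub> h) = d g \<otimes> d h" if "g \<in> carrier M" "h \<in> carrier M" for g h
    using d that by (auto simp: hom_def)
  have dinv: "d (inv\<^bsub>M\<^esub> g) = inv (d g)" if "g \<in> carrier M" for g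
    using group_hom.hom_inv[of M G d g] that d M is_group by (simp add: group_hom_def group_hom_axioms_def)
  have d1: "d \<one>\<^bsub>M\<^esub> = \<one>"
    using group_hom.hom_one[of M G d] d M is_group by (simp add: group_hom_def group_hom_axioms_def)
  have swap: "n \<otimes> d g = d g \<otimes> (inv (d g) \<otimes> n \<otimes> d g)" if "g \<in> carrier M" "n \<in> N" for g n
    using that by (simp add: m_assoc[symmetric])
  have dN': "inv (d g) \<otimes> n \<otimes> d g \<in> N" "\<psi> (inv (d g) \<otimes> n \<otimes> d g) = \<psi> n"
    if "g \<in> carrier M" "n \<in> N" for g n
    using dN[of "inv\<^bsub>M\<^esub> g" n] d\<psi>[of "inv\<^bsub>M\<^esub> g" n] that by (auto simp: dinv)
  have subW: "vs.subspace ?W"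
    using N zero_V add_V scale_V
    by (auto simp: vs.subspace_def act_zero act_add act_scale vs.scale_right_distrib mult.commute)
  have W_act: "act (d g) v \<in> ?W" if g: "g \<in> carrier M" and v: "v \<in> ?W" for g v
  proof -
    have "act n (act (d g) v) = scale (\<psi> n) (act (d g) v)" if n: "n \<in> N" for n
    proof -
      have "act n (act (d g) v) = act (n \<otimes> d g) v"
        using n g v by (simp add: act_mult)
      also have "\<dots> = act (d g) (act (inv (d g) \<otimes> n \<otimes> d g) v)"
        unfolding swap[OF g n] using n g v by (subst act_mult) auto
      also have "act (inv (d g) \<otimes> n \<otimes> d g) v = scale (\<psi> n) v"
        using dN'[OF g n] v by auto
      finally show ?thesis using g v by (simp add: act_scale)
    qed
    then show ?thesis using g v act_closed by auto
  qed
  have "\<exists>S. finite S \<and> ?W = vs.span S"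
  proof -
    obtain S where "finite S" "V = vs.span S" using rep by (auto simp: representation_def)
    then show ?thesis
      using subW by (intro finite_span_subspace[of scale ?W S]) (auto simp: vs.vector_space_axioms)
  qed
  then have repL: "representation M ?L"
    unfolding representation_def
    using vs.vector_space_axioms subW W_act
    by (simp add: act_add act_scale act_one act_mult d1 dm)
  have repR: "representation M ?R"
  proof (rule representation_direct_sum[OF \<B> M(1)])
    show "representation M (induced M Z (char_rep (\<theta> B)))" for B
      using representation_char_rep_induced M Z by blast
    then show "vector_space (rep_scale (induced M Z (char_rep (\<theta> B))))" for B
      by (simp add: representation_def)
  qed
  define T where "T v = (\<lambda>B g. if B \<in> \<B> \<and> g \<in> carrier M then ev (act (\<gamma> B \<otimes> d g) v) else 0)" for v
  have R_space: "t \<in> rep_space ?R \<longleftrightarrow> (\<forall>B. B \<notin> \<B> \<longrightarrow> t B = 0) \<and>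
      (\<forall>B\<in>\<B>. (\<forall>g. g \<notin> carrier M \<longrightarrow> t B g = 0) \<and>
        (\<forall>h\<in>Z. \<forall>g\<in>carrier M. t B (h \<otimes>\<^bsub>M\<^esub> g) = \<theta> B h * t B g))" for t
  proof -
    have "finite {B. t B \<noteq> 0}" if "\<forall>B. B \<notin> \<B> \<longrightarrow> t B = 0"
      by (rule finite_subset[OF _ \<B>]) (use that in auto)
    then show ?thesis by (auto simp: direct_sum_def induced_def char_rep_def)
  qed
  have TR: "T v \<in> rep_space ?R" if v: "v \<in> V" for v
  proof -
    have "ev (act (\<gamma> B \<otimes> d (h \<otimes>\<^bsub>M\<^esub> g)) v) = \<theta> B h * ev (act (\<gamma> B \<otimes> d g) v)"
      if B: "B \<in> \<B>" and h: "h \<in> Z" and g: "g \<in> carrier M" for B h g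
    proof -
      have hc: "h \<in> carrier M" using h Z by blast
      have "\<gamma> B \<otimes> d (h \<otimes>\<^bsub>M\<^esub> g) = (\<gamma> B \<otimes> d h \<otimes> inv (\<gamma> B)) \<otimes> (\<gamma> B \<otimes> d g)"
        using B hc g \<gamma> by (simp add: dm m_assoc) (simp add: m_assoc[symmetric])
      then have "act (\<gamma> B \<otimes> d (h \<otimes>\<^bsub>M\<^esub> g)) v = act (\<gamma> B \<otimes> d h \<otimes> inv (\<gamma> B)) (act (\<gamma> B \<otimes> d g) v)"
        using act_mult[of "\<gamma> B \<otimes> d h \<otimes> inv (\<gamma> B)" "\<gamma> B \<otimes> d g" v] B hc g \<gamma> v by simp
      then show ?thesis
        using ev_act[OF Z_stab[OF B h]] Z_char[OF B h] act_closed[of "\<gamma> B \<otimes> d g" v] B g \<gamma> v by simp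
    qed
    then show ?thesis
      using Z unfolding R_space T_def by (auto simp: fun_eq_iff)
  qed
  have T_add: "T (v + w) = T v + T w" if "v \<in> V" "w \<in> V" for v w
    unfolding T_def using that \<gamma> by (auto simp: fun_eq_iff act_add ev_add act_closed)
  have T_scale: "T (scale c v) = rep_scale ?R c (T v)" if "v \<in> V" for c v
    unfolding T_def using that \<gamma>
    by (auto simp: fun_eq_iff direct_sum_def induced_def char_rep_def act_scale ev_scale act_closed)
  have T_act: "T (act (d g) v) = rep_act ?R g (T v)" if g: "g \<in> carrier M" and v: "v \<in> V" for g v
    unfolding T_def using g v \<gamma>
    by (auto simp: fun_eq_iff direct_sum_def induced_def char_rep_def act_mult dm m_assoc[symmetric] act_closed)
  have inj: "v = 0" if v: "v \<in> ?W" and T0: "T v = 0" for v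
  proof (rule separating)
    show "v \<in> V" using v by simp
    fix x assume x: "x \<in> carrier G"
    show "ev (act x v) = 0"
    proof (cases "\<forall>n\<in>N. x \<otimes> n \<otimes> inv x \<in> H \<longrightarrow> \<mu> (x \<otimes> n \<otimes> inv x) = \<psi> n")
      case True
      then obtain B g n h where B: "B \<in> \<B>" "g \<in> carrier M" "n \<in> N" "h \<in> H" "x = h \<otimes> \<gamma> B \<otimes> d g \<otimes> n"
        using cover[OF x] by blast
      have hc: "h \<in> carrier G" using H_carrier[OF B(4)] .
      have vV: "v \<in> V" using v by simp
      have yc: "\<gamma> B \<otimes> d g \<in> carrier G" using B \<gamma>[OF B(1)] by simp
      have "x = h \<otimes> ((\<gamma> B \<otimes> d g) \<otimes> n)"
        using B \<gamma>[OF B(1)] hc by (simp add: m_assoc)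
      then have "act x v = act h (act ((\<gamma> B \<otimes> d g) \<otimes> n) v)"
        using B(3) hc yc vV by (simp only: act_mult m_closed Nc)
      also have "\<dots> = act h (act (\<gamma> B \<otimes> d g) (act n v))"
        using B(3) yc vV by (simp only: act_mult Nc)
      also have "act n v = scale (\<psi> n) v" using v B(3) by simp
      finally have "ev (act x v) = \<mu> h * (\<psi> n * ev (act (\<gamma> B \<otimes> d g) v))"
        using B v \<gamma>[OF B(1)] by (simp add: ev_act act_scale ev_scale act_closed scale_V)
      moreover have "ev (act (\<gamma> B \<otimes> d g) v) = T v B g" using B by (simp add: T_def)
      ultimately show ?thesis using T0 by simp
    next
      case False
      then obtain n where n: "n \<in> N" "x \<otimes> n \<otimes> inv x \<in> H" "\<mu> (x \<otimes> n \<otimes> inv x) \<noteq> \<psi> n" by blast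
      have "\<psi> n * ev (act x v) = ev (act x (act n v))"
        using v n x by (simp add: act_scale ev_scale act_closed)
      also have "act x (act n v) = act (x \<otimes> n) v"
        using v n x by (intro act_mult[symmetric]) auto
      also have "x \<otimes> n = (x \<otimes> n \<otimes> inv x) \<otimes> x"
        using n x by (simp add: m_assoc)
      also have "act ((x \<otimes> n \<otimes> inv x) \<otimes> x) v = act (x \<otimes> n \<otimes> inv x) (act x v)"
        using v n x by (intro act_mult) auto
      also have "ev \<dots> = \<mu> (x \<otimes> n \<otimes> inv x) * ev (act x v)"
        using v n x by (simp add: ev_act act_closed)
      finally show ?thesis using n(3) by simp
    qed
  qed
  define c where "c B = card {p \<in> carrier M \<times> N. \<gamma> B \<otimes> d (fst p) \<otimes> snd p \<otimes> inv (\<gamma> B) \<in> H}" for B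
  have onto: "\<exists>v\<in>?W. \<forall>B. T v B = (\<lambda>g. of_nat (c B) * t B g)" if t: "t \<in> rep_space ?R" for t
  proof -
    \<comment> \<open>Translates of \<open>e\<close>, summed against \<open>t\<close> and \<open>\<psi>\<close>, give an inverse up to the constants \<open>c B\<close>, which count
      how often a point of the double coset is reached.\<close>
    define u where "u B g n = scale (t B g / \<psi> n) (act (inv (d g) \<otimes> n \<otimes> inv (\<gamma> B)) e)" for B g n
    have u_V: "u B g n \<in> V" if "B \<in> \<B>" "g \<in> carrier M" "n \<in> N" for B g n
      unfolding u_def using that \<gamma> e_V by (intro scale_V act_closed) auto
    define v where "v = (\<Sum>B\<in>\<B>. \<Sum>g\<in>carrier M. \<Sum>n\<in>N. u B g n)"
    have v_V: "v \<in> V" unfolding v_def by (intro sum_V u_V)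
    have v_W: "v \<in> ?W"
    proof -
      have "act n0 v = scale (\<psi> n0) v" if n0: "n0 \<in> N" for n0
      proof -
        have "act n0 v = (\<Sum>B\<in>\<B>. \<Sum>g\<in>carrier M. \<Sum>n\<in>N. act n0 (u B g n))"
          unfolding v_def using n0 u_V by (simp add: act_sum sum_V)
        also have "\<dots> = (\<Sum>B\<in>\<B>. \<Sum>g\<in>carrier M. \<Sum>n\<in>N. scale (\<psi> n0) (u B g n))"
        proof (rule sum.cong[OF refl], rule sum.cong[OF refl])
          fix B g assume B: "B \<in> \<B>" and g: "g \<in> carrier M"
          let ?n = "d g \<otimes> n0 \<otimes> inv (d g)"
          have n: "?n \<in> N" "\<psi> ?n = \<psi> n0" using dN d\<psi> g n0 by auto
          show "(\<Sum>n\<in>N. act n0 (u B g n)) = (\<Sum>n\<in>N. scale (\<psi> n0) (u B g n))"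
          proof (rule sum.reindex_bij_witness[of _ "\<lambda>n. inv ?n \<otimes> n" "\<lambda>n. ?n \<otimes> n"])
            fix n assume nN: "n \<in> N"
            have "inv (d g) \<otimes> (?n \<otimes> n) \<otimes> inv (\<gamma> B) = n0 \<otimes> (inv (d g) \<otimes> n \<otimes> inv (\<gamma> B))"
              using g n0 nN \<gamma>[OF B] by (simp add: m_assoc[symmetric])
            then show "scale (\<psi> n0) (u B g (?n \<otimes> n)) = act n0 (u B g n)"
              unfolding u_def using g n0 nN \<gamma>[OF B] e_V n \<psi>_nz[OF n0]
              by (simp add: act_scale act_mult act_closed \<psi>_mult)
          next
            fix n assume nN: "n \<in> N"
            show "inv ?n \<otimes> (?n \<otimes> n) = n" "?n \<otimes> (inv ?n \<otimes> n) = n"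
              using Nc[OF n(1)] Nc[OF nN] by (simp_all add: m_assoc[symmetric] del: inv_mult_group)
            show "?n \<otimes> n \<in> N" "inv ?n \<otimes> n \<in> N"
              using n nN Nm by blast+
          qed
        qed
        also have "\<dots> = scale (\<psi> n0) v"
          unfolding v_def by (simp add: vs.scale_sum_right)
        finally show ?thesis .
      qed
      then show ?thesis using v_V by simp
    qed
    \<comment> \<open>Every term that contributes to the value at \<open>(B, g)\<close> contributes \<open>t B g\<close>.\<close>
    have Tv: "T v B g = c B * t B g" if B: "B \<in> \<B>" and g: "g \<in> carrier M" for B g
    proof -
      let ?x = "\<lambda>g' n B'. \<gamma> B \<otimes> d (g \<otimes>\<^bsub>M\<^esub> inv\<^bsub>M\<^esub> g') \<otimes> n \<otimes> inv (\<gamma> B')"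
      have summand: "ev (act (\<gamma> B \<otimes> d g) (u B' g' n)) =
          (if B' = B \<and> ?x g' n B \<in> H then t B g else 0)"
        if B': "B' \<in> \<B>" and g': "g' \<in> carrier M" and n: "n \<in> N" for B' g' n
      proof -
        have x: "(\<gamma> B \<otimes> d g) \<otimes> (inv (d g') \<otimes> n \<otimes> inv (\<gamma> B')) = ?x g' n B'"
          using g g' n \<gamma>[OF B] \<gamma>[OF B'] by (simp add: dm dinv m_assoc)
        have xc: "?x g' n B' \<in> carrier G" using g g' n \<gamma>[OF B] \<gamma>[OF B'] by simp
        have "ev (act (\<gamma> B \<otimes> d g) (u B' g' n)) = t B' g' / \<psi> n * ev (act (?x g' n B') e)"
          unfolding u_def x[symmetric] using g g' n \<gamma>[OF B] \<gamma>[OF B'] e_V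
          by (simp add: act_scale act_mult act_closed ev_scale)
        also have "\<dots> = (if B' = B \<and> ?x g' n B \<in> H then t B g else 0)"
        proof (cases "?x g' n B' \<in> H")
          case True
          let ?h = "g \<otimes>\<^bsub>M\<^esub> inv\<^bsub>M\<^esub> g'"
          have f: "B = B'" "?h \<in> Z" "\<mu> (?x g' n B') = \<theta> B ?h * \<psi> n"
            using free[OF B B' _ n True] g g' by auto
          have "t B (?h \<otimes>\<^bsub>M\<^esub> g') = \<theta> B ?h * t B g'"
            using t B f(2) g' unfolding R_space by blast
          moreover have "?h \<otimes>\<^bsub>M\<^esub> g' = g" using g g' by (simp add: M.m_assoc)
          ultimately show ?thesis
            using True f \<psi>_nz[OF n] ev_act[OF True e_V] ev_e by simp
        next
          case False
          then show ?thesis using ev_act_e[OF xc] by auto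
        qed
        finally show ?thesis .
      qed
      have "T v B g = (\<Sum>B'\<in>\<B>. \<Sum>g'\<in>carrier M. \<Sum>n\<in>N. ev (act (\<gamma> B \<otimes> d g) (u B' g' n)))"
        unfolding T_def v_def using B g \<gamma>[OF B] u_V
        by (simp add: act_sum ev_sum sum_V act_closed)
      also have "\<dots> = (\<Sum>B'\<in>\<B>. \<Sum>g'\<in>carrier M. \<Sum>n\<in>N. if B' = B \<and> ?x g' n B \<in> H then t B g else 0)"
        using summand by (intro sum.cong refl) auto
      also have "\<dots> = (\<Sum>B'\<in>\<B>. if B' = B then \<Sum>g'\<in>carrier M. \<Sum>n\<in>N. if ?x g' n B \<in> H then t B g else 0 else 0)"
        by (intro sum.cong refl) auto
      also have "\<dots> = (\<Sum>g'\<in>carrier M. \<Sum>n\<in>N. if ?x g' n B \<in> H then t B g else 0)"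
        using \<B> B by simp
      also have "\<dots> = (\<Sum>h\<in>carrier M. \<Sum>n\<in>N. if \<gamma> B \<otimes> d h \<otimes> n \<otimes> inv (\<gamma> B) \<in> H then t B g else 0)"
      proof (rule sum.reindex_bij_witness[of _ "\<lambda>h. inv\<^bsub>M\<^esub> h \<otimes>\<^bsub>M\<^esub> g" "\<lambda>g'. g \<otimes>\<^bsub>M\<^esub> inv\<^bsub>M\<^esub> g'"])
        fix h assume h: "h \<in> carrier M"
        show "inv\<^bsub>M\<^esub> (g \<otimes>\<^bsub>M\<^esub> inv\<^bsub>M\<^esub> h) \<otimes>\<^bsub>M\<^esub> g = h" "g \<otimes>\<^bsub>M\<^esub> inv\<^bsub>M\<^esub> (inv\<^bsub>M\<^esub> h \<otimes>\<^bsub>M\<^esub> g) = h"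
          using g h by (simp_all add: M.inv_mult_group M.m_assoc) (simp add: M.m_assoc[symmetric])
      qed (use g in simp_all)
      also have "\<dots> = (\<Sum>p\<in>carrier M \<times> N. if \<gamma> B \<otimes> d (fst p) \<otimes> snd p \<otimes> inv (\<gamma> B) \<in> H then t B g else 0)"
        by (simp add: sum.cartesian_product case_prod_unfold)
      also have "\<dots> = c B * t B g"
        unfolding c_def using M(2) finN by (simp add: sum.If_cases Int_def)
      finally show ?thesis .
    qed
    have TvB: "T v B = (\<lambda>g. c B * t B g)" for B
      using Tv[of B] t unfolding R_space by (cases "B \<in> \<B>") (auto simp: T_def fun_eq_iff)
    then show ?thesis using v_W by blast
  qed
  have c0: "c B \<noteq> 0" if B: "B \<in> \<B>" for B
  proof -
    have "(\<one>\<^bsub>M\<^esub>, \<one>) \<in> {p \<in> carrier M \<times> N. \<gamma> B \<otimes> d (fst p) \<otimes> snd p \<otimes> inv (\<gamma> B) \<in> H}"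
      using N1 \<gamma>[OF B] subgroup.one_closed[OF H] by (simp add: d1)
    then show ?thesis
      unfolding c_def using M(2) finN
      by (metis (no_types, lifting) card_0_eq empty_iff finite_SigmaI finite_subset mem_Collect_eq subsetI)
  qed
  have surj: "\<exists>v\<in>?W. T v = t" if t: "t \<in> rep_space ?R" for t
  proof -
    have "(\<lambda>B g. t B g / c B) \<in> rep_space ?R"
      using t unfolding R_space by (auto simp: fun_eq_iff)
    then obtain v where v: "v \<in> ?W" "\<forall>B. T v B = (\<lambda>g. of_nat (c B) * (t B g / c B))"
      using onto by blast
    have "T v = t"
    proof (intro ext)
      show "T v B g = t B g" for B g
        using v(2) c0[of B] t unfolding R_space by (cases "B \<in> \<B>") auto
    qed
    then show ?thesis using v(1) by blast
  qed
  have "bij_betw T ?W (rep_space ?R)"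
    unfolding bij_betw_def
  proof
    show "inj_on T ?W"
    proof (rule inj_onI)
      fix v w assume vw: "v \<in> ?W" "w \<in> ?W" "T v = T w"
      have "v - w \<in> ?W" using subW vw(1,2) vs.subspace_diff by blast
      moreover have "T (v - w) = 0"
        using T_add[of "v - w" w] vw diff_V by simp
      ultimately show "v = w" using inj by fastforce
    qed
    show "T ` ?W = rep_space ?R" using TR surj by blast
  qed
  then show ?thesis
    unfolding rep_iso_def using repL repR T_add T_scale T_act
    by (intro conjI exI[of _ T]) simp_all
qed

lemma transport:
  assumes iso: "rep_iso G \<rho> \<pi>"
  shows "\<exists>ev' e'. monomial_model G \<rho> H \<mu> ev' e'"
proof -
  obtain T where T: "bij_betw T (rep_space \<rho>) V"
    and add: "\<And>v w. v \<in> rep_space \<rho> \<Longrightarrow> w \<in> rep_space \<rho> \<Longrightarrow> T (v + w) = T v + T w"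
    and sc: "\<And>c v. v \<in> rep_space \<rho> \<Longrightarrow> T (rep_scale \<rho> c v) = scale c (T v)"
    and ac: "\<And>g v. g \<in> carrier G \<Longrightarrow> v \<in> rep_space \<rho> \<Longrightarrow> T (rep_act \<rho> g v) = act g (T v)"
    using iso unfolding rep_iso_def by metis
  have "representation G \<rho>" using iso by (simp add: rep_iso_def)
  then interpret \<rho>: finite_group_rep G \<rho>
    by unfold_locales (rule finite_group)
  have TV: "T v \<in> V" if "v \<in> rep_space \<rho>" for v
    using T that by (auto simp: bij_betw_def)
  obtain e' where e': "e' \<in> rep_space \<rho>" "T e' = e"
    using T e_V by (metis bij_betw_imp_surj_on imageE)
  have "v = 0" if v: "v \<in> rep_space \<rho>" and all: "\<And>g. g \<in> carrier G \<Longrightarrow> ev (T (rep_act \<rho> g v)) = 0" for v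
  proof -
    have "T v = 0"
      by (rule separating) (use v all TV ac in auto)
    moreover have "T 0 = 0" using sc[of 0 0] \<rho>.zero_V by simp
    ultimately show "v = 0"
      using T v \<rho>.zero_V by (metis bij_betw_imp_inj_on inj_onD)
  qed
  then have "monomial_model G \<rho> H \<mu> (\<lambda>v. ev (T v)) e'"
    using H e' TV
    by (intro monomial_model.intro \<rho>.finite_group_rep_axioms monomial_model_axioms.intro)
      (simp_all add: ev_e add sc ac ev_add ev_scale ev_act ev_act_e H_carrier)
  then show ?thesis by blast
qed

text \<open>Here \<open>Q\<close> is a subgroup of a larger group \<open>E\<close> that acts on the representation through a
  surjection \<open>p\<close> of \<open>Q\<close>, twisted by a character \<open>c\<close>.\<close>

theorem induction_in_stages:
  fixes E :: "('h, 'd) monoid_scheme" and Q :: "'h set" and p :: "'h \<Rightarrow> 'g" and c :: "'h \<Rightarrow> complex"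
    and \<sigma> :: "('h, 'v) rep"
  assumes E: "group E" "finite (carrier E)" and Q: "subgroup Q E"
    and p: "\<And>q. q \<in> Q \<Longrightarrow> p q \<in> carrier G" "carrier G \<subseteq> p ` Q"
      "\<And>q q'. q \<in> Q \<Longrightarrow> q' \<in> Q \<Longrightarrow> p (q \<otimes>\<^bsub>E\<^esub> q') = p q \<otimes> p q'"
    and c: "\<And>q. q \<in> Q \<Longrightarrow> c q \<noteq> 0"
      "\<And>q q'. q \<in> Q \<Longrightarrow> q' \<in> Q \<Longrightarrow> c (q \<otimes>\<^bsub>E\<^esub> q') = c q * c q'"
    and \<sigma>: "rep_scale \<sigma> = scale" "rep_space \<sigma> = V"
      "\<And>q v. q \<in> Q \<Longrightarrow> v \<in> V \<Longrightarrow> rep_act \<sigma> q v = scale (c q) (act (p q) v)"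
  shows "monomial_model E (induced E Q \<sigma>) {q \<in> Q. p q \<in> H} (\<lambda>q. c q * \<mu> (p q))
    (\<lambda>f. ev (f \<one>\<^bsub>E\<^esub>)) (\<lambda>x. if x \<in> Q then rep_act \<sigma> x e else 0)"
proof -
  interpret E: group E by fact
  let ?I = "induced E Q \<sigma>"
  let ?e = "\<lambda>x. if x \<in> Q then rep_act \<sigma> x e else 0"
  have Qc[simp]: "q \<in> carrier E" if "q \<in> Q" for q
    using that subgroup.subset[OF Q] by blast
  have Qm: "q \<otimes>\<^bsub>E\<^esub> q' \<in> Q" "inv\<^bsub>E\<^esub> q \<in> Q" "\<one>\<^bsub>E\<^esub> \<in> Q" if "q \<in> Q" "q' \<in> Q" for q q'
    using that subgroup.m_closed[OF Q] subgroup.m_inv_closed[OF Q] subgroup.one_closed[OF Q] by auto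
  have Q1: "\<one>\<^bsub>E\<^esub> \<in> Q" using subgroup.one_closed[OF Q] .
  have c1: "c \<one>\<^bsub>E\<^esub> = 1" using c(2)[OF Q1 Q1] c(1)[OF Q1] by simp
  have p1: "p \<one>\<^bsub>E\<^esub> = \<one>"
    using p(3)[OF Q1 Q1] p(1)[OF Q1] by (metis E.r_one Qc Q1 r_cancel_one')
  have pinv: "p (inv\<^bsub>E\<^esub> q) = inv (p q)" if q: "q \<in> Q" for q
    using p(3)[OF Qm(2)[OF q q] q] q p1 p(1) Qm(2)[OF q q] by (metis E.l_inv Qc inv_equality)
  have \<sigma>V: "rep_act \<sigma> q v \<in> V" if "q \<in> Q" "v \<in> V" for q v
    using that p(1) by (simp add: \<sigma>(3) scale_V act_closed)
  have \<sigma>m: "rep_act \<sigma> (q \<otimes>\<^bsub>E\<^esub> q') v = rep_act \<sigma> q (rep_act \<sigma> q' v)" if "q \<in> Q" "q' \<in> Q" "v \<in> V" for q q' v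
    using that p(1) by (simp add: \<sigma> Qm scale_V act_closed p(3) act_mult act_scale c(2))
  have "representation E ?I"
    by (rule representation_induced)
      (use E Q subgroup.subset[OF Q] vs.vector_space_axioms subspace_V rep p(1) in
        \<open>auto simp: \<sigma> add_V scale_V act_add act_scale vs.scale_right_distrib mult.commute representation_def\<close>)
  then interpret I: finite_group_rep E ?I
    by (intro finite_group_rep.intro finite_group_rep_axioms.intro E)
  have space: "f \<in> I.V \<longleftrightarrow> (\<forall>x\<in>carrier E. f x \<in> V) \<and> (\<forall>x. x \<notin> carrier E \<longrightarrow> f x = 0) \<and>
      (\<forall>q\<in>Q. \<forall>x\<in>carrier E. f (q \<otimes>\<^bsub>E\<^esub> x) = rep_act \<sigma> q (f x))" for f
    by (auto simp: induced_def \<sigma>)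
  have Iact: "I.act g f \<one>\<^bsub>E\<^esub> = f g" if "g \<in> carrier E" for g f
    using that by (simp add: induced_def)
  show ?thesis
  proof (intro monomial_model.intro I.finite_group_rep_axioms monomial_model_axioms.intro)
    show "subgroup {q \<in> Q. p q \<in> H} E"
      by (intro E.subgroupI)
        (use Q1 Qm p pinv p1 subgroup.one_closed[OF H] subgroup.m_closed[OF H] subgroup.m_inv_closed[OF H]
          in auto)
    have "(if q \<otimes>\<^bsub>E\<^esub> x \<in> Q then rep_act \<sigma> (q \<otimes>\<^bsub>E\<^esub> x) e else 0) = rep_act \<sigma> q (if x \<in> Q then rep_act \<sigma> x e else 0)"
      if q: "q \<in> Q" and x: "x \<in> carrier E" for q x
    proof (cases "x \<in> Q")
      case True
      then show ?thesis using q e_V by (simp add: Qm \<sigma>m)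
    next
      case False
      have "q \<otimes>\<^bsub>E\<^esub> x \<notin> Q"
      proof
        assume "q \<otimes>\<^bsub>E\<^esub> x \<in> Q"
        then have "inv\<^bsub>E\<^esub> q \<otimes>\<^bsub>E\<^esub> (q \<otimes>\<^bsub>E\<^esub> x) \<in> Q" using Qm q by blast
        then show False using False q x by (simp add: E.m_assoc[symmetric])
      qed
      then show ?thesis using False q zero_V p(1) by (simp add: \<sigma> act_zero)
    qed
    then show "?e \<in> I.V"
      unfolding space using e_V \<sigma>V zero_V by auto
    show "ev (?e \<one>\<^bsub>E\<^esub>) = 1"
      using Q1 e_V by (simp add: \<sigma> c1 p1 act_one ev_e)
    show "ev ((f + f') \<one>\<^bsub>E\<^esub>) = ev (f \<one>\<^bsub>E\<^esub>) + ev (f' \<one>\<^bsub>E\<^esub>)" if "f \<in> I.V" "f' \<in> I.V" for f f'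
      using that by (simp add: space ev_add)
    show "ev (I.scale a f \<one>\<^bsub>E\<^esub>) = a * ev (f \<one>\<^bsub>E\<^esub>)" if "f \<in> I.V" for a f
      using that unfolding space by (simp add: induced_def \<sigma> ev_scale)
    show "ev (I.act h f \<one>\<^bsub>E\<^esub>) = c h * \<mu> (p h) * ev (f \<one>\<^bsub>E\<^esub>)"
      if h: "h \<in> {q \<in> Q. p q \<in> H}" and f: "f \<in> I.V" for h f
    proof -
      have hQ: "h \<in> Q" and fV: "f \<one>\<^bsub>E\<^esub> \<in> V" using h f by (auto simp: space)
      have "f (h \<otimes>\<^bsub>E\<^esub> \<one>\<^bsub>E\<^esub>) = rep_act \<sigma> h (f \<one>\<^bsub>E\<^esub>)"
        using f hQ unfolding space by blast
      then show ?thesis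
        using hQ h fV p(1) by (simp add: Iact \<sigma>(3) ev_scale ev_act act_closed)
    qed
    show "ev (I.act g ?e \<one>\<^bsub>E\<^esub>) = 0" if g: "g \<in> carrier E" "g \<notin> {q \<in> Q. p q \<in> H}" for g
      using g e_V p(1) by (auto simp: Iact \<sigma>(3) ev_scale act_closed ev_act_e ev_zero)
    show "f = 0" if f: "f \<in> I.V" and all: "\<And>g. g \<in> carrier E \<Longrightarrow> ev (I.act g f \<one>\<^bsub>E\<^esub>) = 0" for f
    proof
      fix x
      show "f x = 0 x"
      proof (cases "x \<in> carrier E")
        case True
        have "ev (act g (f x)) = 0" if g: "g \<in> carrier G" for g
        proof -
          obtain q where q: "q \<in> Q" "g = p q" using p(2) g by blast
          have "0 = ev (f (q \<otimes>\<^bsub>E\<^esub> x))"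
            using all[of "q \<otimes>\<^bsub>E\<^esub> x"] q True by (simp add: Iact)
          also have "f (q \<otimes>\<^bsub>E\<^esub> x) = scale (c q) (act g (f x))"
            using f q True unfolding space by (simp add: \<sigma>(3))
          also have "ev \<dots> = c q * ev (act g (f x))"
            using f g True unfolding space by (simp add: ev_scale act_closed)
          finally show ?thesis using c(1)[OF q(1)] by simp
        qed
        then show ?thesis using separating[of "f x"] f True unfolding space by simp
      next
        case False
        then show ?thesis using f unfolding space by simp
      qed
    qed
  qed
qed

end

text \<open>This is the case of induction in stages in which the first stage is the trivial induction
  from \<open>H\<close> to \<open>H\<close>.\<close>

lemma monomial_model_induced_char:
  assumes G: "group G" "finite (carrier G)" and H: "subgroup H G"
    and \<theta>: "is_character G H \<theta>"
  shows "\<exists>ev e. monomial_model G (induced G H (char_rep \<theta>)) H \<theta> ev e"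
proof -
  interpret G: group G by fact
  let ?H = "G\<lparr>carrier := H\<rparr>"
  have \<theta>m: "\<theta> (x \<otimes>\<^bsub>G\<^esub> y) = \<theta> x * \<theta> y" and \<theta>nz: "\<theta> x \<noteq> 0" if "x \<in> H" "y \<in> H" for x y
    using \<theta> that by (auto simp: is_character_def)
  have H1: "\<one>\<^bsub>G\<^esub> \<in> H" using subgroup.one_closed[OF H] .
  have \<theta>1: "\<theta> \<one>\<^bsub>G\<^esub> = 1" using \<theta>m[OF H1 H1] \<theta>nz[OF H1 H1] by simp
  have grp: "group ?H" using subgroup.subgroup_is_group[OF H G(1)] .
  have fin: "finite H" using finite_subset[OF subgroup.subset[OF H] G(2)] .
  interpret c: vector_space "(*) :: complex \<Rightarrow> complex \<Rightarrow> complex"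
    by unfold_locales (auto simp: algebra_simps)
  have "c.span {1} = UNIV"
    using c.span_singleton[of 1] by auto
  then have "representation ?H (char_rep \<theta>)"
    unfolding representation_def
    using c.vector_space_axioms c.subspace_UNIV \<theta>1
    by (auto simp: char_rep_def \<theta>m distrib_left intro!: exI[of _ "{1}"])
  then have "monomial_model ?H (char_rep \<theta>) H \<theta> (\<lambda>v. v) 1"
    using grp fin group.subgroup_self[OF grp]
    by (intro monomial_model.intro finite_group_rep.intro finite_group_rep_axioms.intro
        monomial_model_axioms.intro)
      (use H1 \<theta>1 in \<open>auto simp: char_rep_def dest: meta_spec[of _ "\<one>\<^bsub>G\<^esub>"]\<close>)
  then interpret m: monomial_model ?H "char_rep \<theta>" H \<theta> "\<lambda>v. v" 1 .
  have "monomial_model G (induced G H (char_rep \<theta>)) {q \<in> H. q \<in> H} (\<lambda>q. 1 * \<theta> q)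
      (\<lambda>f. f \<one>\<^bsub>G\<^esub>) (\<lambda>x. if x \<in> H then rep_act (char_rep \<theta>) x 1 else 0)"
    by (rule m.induction_in_stages[OF G H, where p = "\<lambda>q. q" and c = "\<lambda>_. 1"])
      (auto simp: char_rep_def)
  then show ?thesis by auto
qed

section \<open>Matrices over commutative rings\<close>

lemma finite_carrier_mat: "finite (carrier_mat n m :: 'a::finite mat set)"
proof -
  have "carrier_mat n m \<subseteq> (\<lambda>f. mat n m f) ` (({..<n} \<times> {..<m}) \<rightarrow>\<^sub>E (UNIV :: 'a set))"
  proof
    fix A :: "'a mat" assume A: "A \<in> carrier_mat n m"
    show "A \<in> (\<lambda>f. mat n m f) ` (({..<n} \<times> {..<m}) \<rightarrow>\<^sub>E (UNIV :: 'a set))"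
      by (rule image_eqI[of _ _ "restrict (($$) A) ({..<n} \<times> {..<m})"])
        (use A in \<open>auto intro!: eq_matI\<close>)
  qed
  moreover have "finite (({..<n} \<times> {..<m}) \<rightarrow>\<^sub>E (UNIV :: 'a set))"
    by (intro finite_PiE) auto
  ultimately show ?thesis using finite_surj by blast
qed

lemma GL_iff: "g \<in> carrier (GL n) \<longleftrightarrow>
    g \<in> carrier_mat n n \<and> (\<exists>h\<in>carrier_mat n n. h * g = 1\<^sub>m n \<and> g * h = 1\<^sub>m n)"
  by (simp add: GL_def units_of_def Units_def ring_mat_def Bex_def)

lemma GL_I: "g \<in> carrier_mat n n \<Longrightarrow> h \<in> carrier_mat n n \<Longrightarrow> h * g = 1\<^sub>m n \<Longrightarrow> g * h = 1\<^sub>m n \<Longrightarrow>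
    g \<in> carrier (GL n)"
  by (auto simp: GL_iff)

lemma GL_mult: "g \<otimes>\<^bsub>GL n\<^esub> h = g * h"
  and GL_one: "\<one>\<^bsub>GL n\<^esub> = 1\<^sub>m n"
  by (simp_all add: GL_def units_of_def ring_mat_def)

lemma group_GL: "group (GL n :: 'a::comm_ring_1 mat monoid)"
proof -
  interpret ring "ring_mat TYPE('a) n ()" by (rule ring_mat)
  show ?thesis unfolding GL_def by (rule units_group)
qed

interpretation GL: group "GL n :: 'a::comm_ring_1 mat monoid" for n
  by (rule group_GL)

lemma finite_GL: "finite (carrier (GL n :: 'a::{comm_ring_1,finite} mat monoid))"
  by (rule finite_subset[OF _ finite_carrier_mat]) (auto simp: GL_iff)

lemma GL_carrier: "g \<in> carrier (GL n) \<Longrightarrow> g \<in> carrier_mat n n"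
  by (simp add: GL_iff)

lemma GL_m_closed: "g \<in> carrier (GL n) \<Longrightarrow> h \<in> carrier (GL n) \<Longrightarrow> g * h \<in> carrier (GL n)"
  using GL.m_closed[of g n h] by (simp add: GL_mult)

lemma GL_inv: assumes "g \<in> carrier (GL n)"
  shows "inv\<^bsub>GL n\<^esub> g \<in> carrier (GL n)" "inv\<^bsub>GL n\<^esub> g * g = 1\<^sub>m n" "g * inv\<^bsub>GL n\<^esub> g = 1\<^sub>m n"
    "inv\<^bsub>GL n\<^esub> g \<in> carrier_mat n n"
  using assms GL.l_inv[OF assms] GL.r_inv[OF assms] GL_carrier[OF GL.inv_closed[OF assms]]
  by (simp_all add: GL_mult GL_one)

lemma GL_inv_eq:
  assumes g: "g \<in> carrier (GL n)" and h: "h \<in> carrier_mat n n" "h * g = 1\<^sub>m n"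
  shows "inv\<^bsub>GL n\<^esub> g = h"
proof -
  note i = GL_inv[OF g]
  have "h = h * (g * inv\<^bsub>GL n\<^esub> g)" using i(3) h(1) by simp
  also have "\<dots> = (h * g) * inv\<^bsub>GL n\<^esub> g"
    using assoc_mult_mat[OF h(1) GL_carrier[OF g] i(4)] by simp
  finally show ?thesis using h(2) i(4) by simp
qed

lemma one_GL: "1\<^sub>m n \<in> carrier (GL n)"
  using GL.one_closed by (simp add: GL_one)

lemma det_nonzero_GL: "A \<in> carrier_mat n n \<Longrightarrow> det A \<noteq> 0 \<Longrightarrow> A \<in> carrier (GL n)"
  for A :: "'a::field mat"
  using det_non_zero_imp_unit[of A n "()"] by (simp add: GL_def units_of_def)

lemma smult_GL:
  fixes g :: "'a::comm_ring_1 mat"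
  assumes "z dvd 1" and "g \<in> carrier (GL n)"
  shows "z \<cdot>\<^sub>m g \<in> carrier (GL n)"
proof -
  obtain y where y: "z * y = 1" using assms(1) by (auto simp: dvd_def)
  have g: "g \<in> carrier_mat n n" using assms(2) GL_carrier by blast
  note i = GL_inv[OF assms(2)]
  have one: "1 \<cdot>\<^sub>m 1\<^sub>m n = (1\<^sub>m n :: 'a mat)" by (intro eq_matI) auto
  have "(z \<cdot>\<^sub>m g) * (y \<cdot>\<^sub>m inv\<^bsub>GL n\<^esub> g) = (z * y) \<cdot>\<^sub>m (g * inv\<^bsub>GL n\<^esub> g)"
    "(y \<cdot>\<^sub>m inv\<^bsub>GL n\<^esub> g) * (z \<cdot>\<^sub>m g) = (z * y) \<cdot>\<^sub>m (inv\<^bsub>GL n\<^esub> g * g)"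
    using g i(4) by (auto intro!: eq_matI simp: mult_ac)
  then show ?thesis
    using y g i by (intro GL_I[of _ _ "y \<cdot>\<^sub>m inv\<^bsub>GL n\<^esub> g"]) (simp_all add: one)
qed

lemma lessThan_small:
  "(i::nat) < 2 \<longleftrightarrow> i = 0 \<or> i = 1" "(i::nat) < 3 \<longleftrightarrow> i = 0 \<or> i = 1 \<or> i = 2"
  by auto

lemma mult_entry_2: "dim_col A = 2 \<Longrightarrow> dim_row B = 2 \<Longrightarrow> i < dim_row A \<Longrightarrow> j < dim_col B \<Longrightarrow>
    (A * B) $$ (i, j) = A $$ (i, 0) * B $$ (0, j) + A $$ (i, 1) * B $$ (1, j)"
  and mult_entry_3: "dim_col A = 3 \<Longrightarrow> dim_row B = 3 \<Longrightarrow> i < dim_row A \<Longrightarrow> j < dim_col B \<Longrightarrow>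
    (A * B) $$ (i, j) = A $$ (i, 0) * B $$ (0, j) + A $$ (i, 1) * B $$ (1, j) + A $$ (i, 2) * B $$ (2, j)"
  for A B :: "'a::comm_semiring_0 mat"
  by (simp_all add: scalar_prod_def numeral_eq_Suc)

lemma mult_mat_vec_entry_3: "dim_col A = 3 \<Longrightarrow> dim_vec v = 3 \<Longrightarrow> i < dim_row A \<Longrightarrow>
    (A *\<^sub>v v) $ i = A $$ (i, 0) * v $ 0 + A $$ (i, 1) * v $ 1 + A $$ (i, 2) * v $ 2"
  for A :: "'a::comm_semiring_0 mat"
  by (simp add: scalar_prod_def numeral_eq_Suc)

lemma det_2: "A \<in> carrier_mat 2 2 \<Longrightarrow> det A = A $$ (0, 0) * A $$ (1, 1) - A $$ (0, 1) * A $$ (1, 0)"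
  for A :: "'a::comm_ring_1 mat"
  by (subst laplace_expansion_row[of A 2 0])
    (auto simp: numeral_eq_Suc cofactor_def mat_delete_def det_single)

lemma det_3: "A \<in> carrier_mat 3 3 \<Longrightarrow> det A =
    A $$ (0, 0) * (A $$ (1, 1) * A $$ (2, 2) - A $$ (1, 2) * A $$ (2, 1))
  - A $$ (0, 1) * (A $$ (1, 0) * A $$ (2, 2) - A $$ (1, 2) * A $$ (2, 0))
  + A $$ (0, 2) * (A $$ (1, 0) * A $$ (2, 1) - A $$ (1, 1) * A $$ (2, 0))"
  for A :: "'a::comm_ring_1 mat"
proof -
  assume A: "A \<in> carrier_mat 3 3"
  have d: "det (mat (Suc (Suc 0)) (Suc (Suc 0)) f) = f (0, 0) * f (1, 1) - f (0, 1) * f (1, 0)"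
    for f :: "nat \<times> nat \<Rightarrow> 'a"
    using det_2[of "mat 2 2 f"] by (simp add: numeral_2_eq_2)
  show ?thesis
    by (subst laplace_expansion_row[of A 3 0])
      (use A in \<open>auto simp: numeral_3_eq_3 cofactor_def mat_delete_def d numeral_2_eq_2 algebra_simps\<close>)
qed

lemma mat_trace_add: "A \<in> carrier_mat n n \<Longrightarrow> B \<in> carrier_mat n n \<Longrightarrow>
    mat_trace (A + B) = mat_trace A + mat_trace B"
  for A B :: "'a::comm_ring_1 mat"
  by (simp add: mat_trace_def sum.distrib)

lemma mat_trace_smult: "A \<in> carrier_mat n n \<Longrightarrow> mat_trace (c \<cdot>\<^sub>m A) = c * mat_trace A"
  for A :: "'a::comm_ring_1 mat"
  by (simp add: mat_trace_def sum_distrib_left)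

lemma mat_trace_mult_comm:
  fixes A B :: "'a::comm_ring_1 mat"
  assumes "A \<in> carrier_mat n m" and "B \<in> carrier_mat m n"
  shows "mat_trace (A * B) = mat_trace (B * A)"
proof -
  have "mat_trace (A * B) = (\<Sum>i<n. \<Sum>j<m. A $$ (i, j) * B $$ (j, i))"
    using assms by (simp add: mat_trace_def scalar_prod_def atLeast0LessThan)
  also have "\<dots> = (\<Sum>j<m. \<Sum>i<n. B $$ (j, i) * A $$ (i, j))"
    by (subst sum.swap) (simp add: mult.commute)
  also have "\<dots> = mat_trace (B * A)"
    using assms by (simp add: mat_trace_def scalar_prod_def atLeast0LessThan)
  finally show ?thesis .
qed

lemma mat_trace_conj:
  fixes A P :: "'a::comm_ring_1 mat"
  assumes "A \<in> carrier_mat n n" and "P \<in> carrier_mat n n" "Q \<in> carrier_mat n n" and "Q * P = 1\<^sub>m n"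
  shows "mat_trace (P * A * Q) = mat_trace A"
proof -
  have "mat_trace (P * A * Q) = mat_trace (Q * (P * A))"
    by (rule mat_trace_mult_comm) (use assms in auto)
  also have "Q * (P * A) = A"
    using assms by (simp add: assoc_mult_mat[symmetric, of Q n n P n A n])
  finally show ?thesis .
qed

lemma mat_trace_four_block:
  fixes A D :: "'a::comm_ring_1 mat"
  assumes "A \<in> carrier_mat n n" and "D \<in> carrier_mat m m"
  shows "mat_trace (four_block_mat A B C D) = mat_trace A + mat_trace D"
proof -
  have "mat_trace (four_block_mat A B C D)
      = (\<Sum>i\<in>{0..<n+m}. if i < n then A $$ (i, i) else D $$ (i - n, i - n))"
    unfolding mat_trace_def using assms by (intro sum.cong) auto
  also have "\<dots> = (\<Sum>i\<in>{0..<n}. if i < n then A $$ (i, i) else D $$ (i - n, i - n))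
      + (\<Sum>i\<in>{n..<n+m}. if i < n then A $$ (i, i) else D $$ (i - n, i - n))"
    by (rule sum.atLeastLessThan_concat[symmetric]) auto
  also have "(\<Sum>i\<in>{n..<n+m}. if i < n then A $$ (i, i) else D $$ (i - n, i - n)) = (\<Sum>i\<in>{0..<m}. D $$ (i, i))"
    using sum.shift_bounds_nat_ivl[of "\<lambda>i. if i < n then A $$ (i, i) else D $$ (i - n, i - n)" 0 n m]
    by (simp add: add.commute)
  finally show ?thesis using assms by (simp add: mat_trace_def atLeast0LessThan)
qed

lemma mat_trace_block_mult:
  fixes A1 :: "'a::comm_ring_1 mat"
  assumes "A1 \<in> carrier_mat n n" "B1 \<in> carrier_mat n m" "C1 \<in> carrier_mat m n" "D1 \<in> carrier_mat m m"
    "A2 \<in> carrier_mat n n" "B2 \<in> carrier_mat n m" "C2 \<in> carrier_mat m n" "D2 \<in> carrier_mat m m"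
  shows "mat_trace (four_block_mat A1 B1 C1 D1 * four_block_mat A2 B2 C2 D2)
    = mat_trace (A1 * A2) + mat_trace (B1 * C2) + (mat_trace (C1 * B2) + mat_trace (D1 * D2))"
proof -
  have "mat_trace (four_block_mat A1 B1 C1 D1 * four_block_mat A2 B2 C2 D2)
      = mat_trace (A1 * A2 + B1 * C2) + mat_trace (C1 * B2 + D1 * D2)"
    unfolding mult_four_block_mat[OF assms]
    by (rule mat_trace_four_block[of _ n _ m]) (use assms in auto)
  then show ?thesis
    using assms by (simp add: mat_trace_add[of _ n] mat_trace_add[of _ m])
qed

lemma mat_trace_zero: "mat_trace (0\<^sub>m n n :: 'a::comm_ring_1 mat) = 0"
  by (simp add: mat_trace_def)

lemma mat_trace_2: "A \<in> carrier_mat 2 2 \<Longrightarrow> mat_trace A = A $$ (0, 0) + A $$ (1, 1)"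
  and mat_trace_1: "A \<in> carrier_mat 1 1 \<Longrightarrow> mat_trace A = A $$ (0, 0)"
  for A :: "'a::comm_ring_1 mat"
  by (simp_all add: mat_trace_def numeral_2_eq_2)

lemma four_block_mat_eq_iff:
  assumes "A \<in> carrier_mat n m" "B \<in> carrier_mat n m'" "C \<in> carrier_mat n' m" "D \<in> carrier_mat n' m'"
    and "A' \<in> carrier_mat n m" "B' \<in> carrier_mat n m'" "C' \<in> carrier_mat n' m" "D' \<in> carrier_mat n' m'"
  shows "four_block_mat A B C D = four_block_mat A' B' C' D' \<longleftrightarrow> A = A' \<and> B = B' \<and> C = C' \<and> D = D'"
proof
  assume eq: "four_block_mat A B C D = four_block_mat A' B' C' D'"
  have e: "four_block_mat A B C D $$ (i, j) = four_block_mat A' B' C' D' $$ (i, j)" for i j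
    using eq by simp
  show "A = A' \<and> B = B' \<and> C = C' \<and> D = D'"
  proof (intro conjI eq_matI)
    show "A $$ (i, j) = A' $$ (i, j)" if "i < dim_row A'" "j < dim_col A'" for i j
      using e[of i j] that assms by simp
    show "B $$ (i, j) = B' $$ (i, j)" if "i < dim_row B'" "j < dim_col B'" for i j
      using e[of i "j + m"] that assms by simp
    show "C $$ (i, j) = C' $$ (i, j)" if "i < dim_row C'" "j < dim_col C'" for i j
      using e[of "i + n" j] that assms by simp
    show "D $$ (i, j) = D' $$ (i, j)" if "i < dim_row D'" "j < dim_col D'" for i j
      using e[of "i + n" "j + m"] that assms by simp
  qed (use assms in auto)
qed simp

lemma four_block_split:
  assumes "X \<in> carrier_mat (n + n') (m + m')"
  obtains A B C D where "A \<in> carrier_mat n m" "B \<in> carrier_mat n m'" "C \<in> carrier_mat n' m"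
    "D \<in> carrier_mat n' m'" "X = four_block_mat A B C D"
proof -
  obtain A B C D where "split_block X n m = (A, B, C, D)" by (cases "split_block X n m") auto
  from split_block[OF this, of n' m'] show thesis using assms that by auto
qed

section \<open>Regular matrices of size two\<close>

lemma poly_mat_carrier: "A \<in> carrier_mat n n \<Longrightarrow> poly_mat f A \<in> carrier_mat n n"
  by (simp add: poly_mat_def)

lemma poly_mat_0: "A \<in> carrier_mat n n \<Longrightarrow> poly_mat 0 A = 0\<^sub>m n n"
  by (auto simp: poly_mat_def)

lemma poly_mat_pCons:
  fixes A :: "'a::comm_ring_1 mat"
  assumes A: "A \<in> carrier_mat n n"
  shows "poly_mat (pCons a f) A = a \<cdot>\<^sub>m 1\<^sub>m n + poly_mat f A * A"
proof (rule eq_matI)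
  fix i j assume "i < dim_row (a \<cdot>\<^sub>m 1\<^sub>m n + poly_mat f A * A)" "j < dim_col (a \<cdot>\<^sub>m 1\<^sub>m n + poly_mat f A * A)"
  then have ij: "i < n" "j < n" using A poly_mat_carrier[OF A, of f] by auto
  have pc: "A ^\<^sub>m k \<in> carrier_mat n n" for k using A by simp
  have entry: "poly_mat g A $$ (i, l) = (\<Sum>k\<le>N. poly.coeff g k * (A ^\<^sub>m k) $$ (i, l))"
    if "degree g \<le> N" "l < n" for g N l
  proof -
    have "(\<Sum>k\<le>N. poly.coeff g k * (A ^\<^sub>m k) $$ (i, l))
        = (\<Sum>k\<le>degree g. poly.coeff g k * (A ^\<^sub>m k) $$ (i, l))"
      by (rule sum.mono_neutral_right) (use that in \<open>auto simp: coeff_eq_0\<close>)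
    then show ?thesis using A ij that by (simp add: poly_mat_def)
  qed
  have "poly_mat (pCons a f) A $$ (i, j)
      = (\<Sum>k\<le>Suc (degree f). poly.coeff (pCons a f) k * (A ^\<^sub>m k) $$ (i, j))"
    by (rule entry) (use ij in \<open>auto simp: degree_pCons_le\<close>)
  also have "\<dots> = a * (1\<^sub>m n) $$ (i, j) + (\<Sum>k\<le>degree f. poly.coeff f k * (A ^\<^sub>m k * A) $$ (i, j))"
    using A by (simp add: sum.atMost_Suc_shift del: sum.atMost_Suc)
  also have "(\<Sum>k\<le>degree f. poly.coeff f k * (A ^\<^sub>m k * A) $$ (i, j))
      = (\<Sum>k\<le>degree f. \<Sum>l<n. poly.coeff f k * (A ^\<^sub>m k) $$ (i, l) * A $$ (l, j))"
    using A ij pc by (simp add: scalar_prod_def sum_distrib_left atLeast0LessThan mult.assoc)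
  also have "\<dots> = (\<Sum>l<n. poly_mat f A $$ (i, l) * A $$ (l, j))"
    by (subst sum.swap, intro sum.cong refl) (simp add: entry[of f "degree f"] sum_distrib_right)
  also have "\<dots> = (poly_mat f A * A) $$ (i, j)"
    using A ij poly_mat_carrier[OF A, of f] by (simp add: scalar_prod_def atLeast0LessThan)
  finally show "poly_mat (pCons a f) A $$ (i, j) = (a \<cdot>\<^sub>m 1\<^sub>m n + poly_mat f A * A) $$ (i, j)"
    using A ij poly_mat_carrier[OF A, of f] by simp
qed (use A poly_mat_carrier in \<open>auto simp: poly_mat_def\<close>)

lemma min_poly_eqI:
  assumes "lead_coeff f = 1" and "\<And>g. poly_mat g A = 0\<^sub>m (dim_row A) (dim_row A) \<longleftrightarrow> f dvd g"
  shows "min_poly A = f"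
  unfolding min_poly_def
proof (rule the_equality)
  fix f' assume f': "lead_coeff f' = 1 \<and>
    (\<forall>g. poly_mat g A = 0\<^sub>m (dim_row A) (dim_row A) \<longleftrightarrow> f' dvd g)"
  then have "f dvd f'" "f' dvd f" using assms by (metis dvd_refl)+
  then show "f' = f" using assms(1) f' by (metis poly_dvd_antisym)
qed (use assms in blast)

lemma char_poly_2:
  fixes B :: "'a::field mat"
  assumes B: "B \<in> carrier_mat 2 2"
  shows "char_poly B = [:det B, - mat_trace B, 1:]"
  unfolding char_poly_defs
  by (subst det_2) (use B in \<open>auto simp: det_2 mat_trace_2\<close>)

text \<open>Modulo the characteristic polynomial every polynomial in \<open>B\<close> is linear, and \<open>1\<close> and \<open>B\<close> are
  linearly independent unless \<open>B\<close> is scalar.\<close>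

lemma regular_mat_2_iff:
  fixes B :: "'a::field mat"
  assumes B: "B \<in> carrier_mat 2 2"
  shows "regular_mat B \<longleftrightarrow> (\<forall>c. B \<noteq> c \<cdot>\<^sub>m 1\<^sub>m 2)"
proof
  assume reg: "regular_mat B"
  show "\<forall>c. B \<noteq> c \<cdot>\<^sub>m 1\<^sub>m 2"
  proof (intro allI notI)
    fix c assume Bc: "B = c \<cdot>\<^sub>m 1\<^sub>m 2"
    have ev: "poly_mat g B = poly g c \<cdot>\<^sub>m 1\<^sub>m 2" for g
    proof (induction g)
      case 0
      then show ?case using poly_mat_0[OF B] by auto
    next
      case (pCons a g)
      have "(poly g c \<cdot>\<^sub>m 1\<^sub>m 2) * (c \<cdot>\<^sub>m 1\<^sub>m 2) = (c * poly g c) \<cdot>\<^sub>m (1\<^sub>m 2 :: 'a mat)"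
        by (auto intro!: eq_matI simp del: index_mult_mat(1) simp: mult_entry_2 lessThan_small)
      then show ?case
        using pCons poly_mat_pCons[OF B, of a g] unfolding Bc by (auto simp: distrib_right)
    qed
    have "min_poly B = [:- c, 1:]"
    proof (rule min_poly_eqI)
      fix g
      have "poly g c = 0" if "poly g c \<cdot>\<^sub>m 1\<^sub>m 2 = (0\<^sub>m 2 2 :: 'a mat)"
        using arg_cong[OF that, of "\<lambda>M. M $$ (0, 0)"] by simp
      then have "poly g c \<cdot>\<^sub>m 1\<^sub>m 2 = (0\<^sub>m 2 2 :: 'a mat) \<longleftrightarrow> poly g c = 0"
        by (auto intro!: eq_matI)
      then show "poly_mat g B = 0\<^sub>m (dim_row B) (dim_row B) \<longleftrightarrow> [:- c, 1:] dvd g"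
        using B ev[of g] by (simp add: poly_eq_0_iff_dvd)
    qed simp
    then show False using reg unfolding regular_mat_def char_poly_2[OF B] by simp
  qed
next
  assume ns: "\<forall>c. B \<noteq> c \<cdot>\<^sub>m 1\<^sub>m 2"
  let ?f = "[:det B, - mat_trace B, 1:]"
  have sq: "(r \<cdot>\<^sub>m B) * B = (r * mat_trace B) \<cdot>\<^sub>m B + (- r * det B) \<cdot>\<^sub>m 1\<^sub>m 2" for r
    using B by (auto intro!: eq_matI simp del: index_mult_mat(1) simp: mult_entry_2 lessThan_small det_2 mat_trace_2 algebra_simps)
  have rem: "\<exists>q r0 r1. g = q * ?f + [:r0, r1:] \<and> poly_mat g B = r0 \<cdot>\<^sub>m 1\<^sub>m 2 + r1 \<cdot>\<^sub>m B" for g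
  proof (induction g)
    case 0
    have "poly_mat 0 B = 0 \<cdot>\<^sub>m 1\<^sub>m 2 + 0 \<cdot>\<^sub>m B" using B by (auto simp: poly_mat_0)
    then show ?case by (intro exI[of _ 0]) simp
  next
    case (pCons a g)
    then obtain q r0 r1 where g: "g = q * ?f + [:r0, r1:]" "poly_mat g B = r0 \<cdot>\<^sub>m 1\<^sub>m 2 + r1 \<cdot>\<^sub>m B" by blast
    have "pCons a g = (pCons r1 q) * ?f + [:a - r1 * det B, r0 + r1 * mat_trace B:]"
      unfolding g(1) by (simp add: algebra_simps)
    moreover have "poly_mat (pCons a g) B = (a - r1 * det B) \<cdot>\<^sub>m 1\<^sub>m 2 + (r0 + r1 * mat_trace B) \<cdot>\<^sub>m B"
      unfolding poly_mat_pCons[OF B] g(2)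
      using B by (auto intro!: eq_matI simp del: index_mult_mat(1) simp: mult_entry_2 lessThan_small det_2 mat_trace_2 algebra_simps)
    ultimately show ?case by blast
  qed
  have "min_poly B = ?f"
  proof (rule min_poly_eqI)
    fix g
    obtain q r0 r1 where g: "g = q * ?f + [:r0, r1:]" "poly_mat g B = r0 \<cdot>\<^sub>m 1\<^sub>m 2 + r1 \<cdot>\<^sub>m B"
      using rem by blast
    have "?f dvd g \<longleftrightarrow> ?f dvd [:r0, r1:]"
      unfolding g(1) by (metis dvd_add_right_iff dvd_triv_right)
    also have "\<dots> \<longleftrightarrow> r0 = 0 \<and> r1 = 0"
    proof
      assume "?f dvd [:r0, r1:]"
      moreover have "degree [:r0, r1:] < degree ?f" by simp
      ultimately have "[:r0, r1:] = 0" using dvd_imp_degree_le not_less by blast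
      then show "r0 = 0 \<and> r1 = 0" by simp
    qed simp
    also have "\<dots> \<longleftrightarrow> r0 \<cdot>\<^sub>m 1\<^sub>m 2 + r1 \<cdot>\<^sub>m B = 0\<^sub>m 2 2"
    proof
      assume z: "r0 \<cdot>\<^sub>m 1\<^sub>m 2 + r1 \<cdot>\<^sub>m B = 0\<^sub>m 2 2"
      then have e: "(r0 \<cdot>\<^sub>m 1\<^sub>m 2 + r1 \<cdot>\<^sub>m B) $$ (i, j) = (0\<^sub>m 2 2 :: 'a mat) $$ (i, j)" for i j by simp
      have "r1 = 0"
      proof (rule ccontr)
        assume "r1 \<noteq> 0"
        then have "B = (- r0 / r1) \<cdot>\<^sub>m 1\<^sub>m 2"
          using B e[of 0 0] e[of 0 1] e[of 1 0] e[of 1 1]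
          by (auto intro!: eq_matI simp: lessThan_small field_simps eq_neg_iff_add_eq_0)
        then show False using ns by blast
      qed
      then show "r0 = 0 \<and> r1 = 0" using B e[of 0 0] by simp
    qed (use B in auto)
    finally show "poly_mat g B = 0\<^sub>m (dim_row B) (dim_row B) \<longleftrightarrow> ?f dvd g"
      using B g(2) by simp
  qed simp
  then show "regular_mat B" unfolding regular_mat_def char_poly_2[OF B] ..
qed

definition mat22 :: "'a \<Rightarrow> 'a \<Rightarrow> 'a \<Rightarrow> 'a \<Rightarrow> 'a mat" where
  "mat22 a b c d = mat 2 2 (\<lambda>(i, j). if i = 0 then if j = 0 then a else b else if j = 0 then c else d)"

lemma mat22_simps [simp]:
  "mat22 a b c d \<in> carrier_mat 2 2" "dim_row (mat22 a b c d) = 2" "dim_col (mat22 a b c d) = 2"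
  "mat22 a b c d $$ (0, 0) = a" "mat22 a b c d $$ (0, 1) = b"
  "mat22 a b c d $$ (1, 0) = c" "mat22 a b c d $$ (1, 1) = d"
  "mat22 a b c d $$ (0, Suc 0) = b" "mat22 a b c d $$ (Suc 0, 0) = c" "mat22 a b c d $$ (Suc 0, Suc 0) = d"
  by (auto simp: mat22_def)

lemma mat22_eta:
  assumes "B \<in> carrier_mat 2 2"
  obtains a b c d where "B = mat22 a b c d"
proof
  show "B = mat22 (B $$ (0, 0)) (B $$ (0, 1)) (B $$ (1, 0)) (B $$ (1, 1))"
    using assms by (auto intro!: eq_matI simp: lessThan_small)
qed

lemma mat22_mult: "mat22 a b c d * mat22 a' b' c' d'
    = mat22 (a * a' + b * c') (a * b' + b * d') (c * a' + d * c') (c * b' + d * d')"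
  for a :: "'a::comm_ring_1"
  by (auto intro!: eq_matI simp del: index_mult_mat(1) simp: mult_entry_2 lessThan_small)

lemma mat22_eq_iff: "mat22 a b c d = mat22 a' b' c' d' \<longleftrightarrow> a = a' \<and> b = b' \<and> c = c' \<and> d = d'"
  by (metis mat22_simps(4-7))

lemma mat22_det: "det (mat22 a b c d) = a * d - b * c" for a :: "'a::comm_ring_1"
  by (simp add: det_2)

lemma mat22_GL: "a * d - b * c \<noteq> 0 \<Longrightarrow> mat22 a b c d \<in> carrier (GL 2)" for a :: "'a::field"
  by (intro det_nonzero_GL) (simp_all add: mat22_det)

text \<open>A vector \<open>v\<close> that is not an eigenvector gives the basis \<open>v, B v\<close>; if neither of the two unit
  vectors will do, their sum will.\<close>

lemma regular_mat_2_companion: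
  fixes B :: "'a::field mat"
  assumes B: "B \<in> carrier_mat 2 2" and reg: "regular_mat B"
  obtains h where "h \<in> carrier (GL 2)" "B * h = h * mat22 0 (- det B) 1 (mat_trace B)"
proof -
  obtain a b c d where Bm: "B = mat22 a b c d" using B by (rule mat22_eta)
  have tr: "mat_trace B = a + d" and dt: "det B = a * d - b * c"
    unfolding Bm by (simp_all add: mat_trace_2 mat22_det)
  consider "c \<noteq> 0" | "b \<noteq> 0" | "b = 0" "c = 0" by blast
  then show thesis
  proof cases
    case 1
    show thesis
      by (rule that[of "mat22 1 a 0 c"])
        (use 1 in \<open>simp_all add: mat22_GL tr dt\<close>, simp add: Bm mat22_mult mat22_eq_iff algebra_simps)
  next
    case 2
    show thesis
      by (rule that[of "mat22 0 b 1 d"])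
        (use 2 in \<open>simp_all add: mat22_GL tr dt\<close>, simp add: Bm mat22_mult mat22_eq_iff algebra_simps)
  next
    case 3
    have "a \<noteq> d"
    proof
      assume "a = d"
      then have "B = a \<cdot>\<^sub>m 1\<^sub>m 2" unfolding Bm using 3
        by (auto intro!: eq_matI simp: lessThan_small)
      then show False using reg regular_mat_2_iff[OF B] by blast
    qed
    then show thesis
      by (intro that[of "mat22 1 a 1 d"])
        (use 3 in \<open>simp_all add: mat22_GL tr dt\<close>, simp add: Bm mat22_mult mat22_eq_iff algebra_simps)
  qed
qed

text \<open>Matrix identities with conditions on dimensions, the form in which they can serve as rewrite rules.\<close>

lemma mat_assoc_dim: "dim_col A = dim_row B \<Longrightarrow> dim_col B = dim_row C \<Longrightarrow> A * B * C = A * (B * C)"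
  for A B C :: "'a::comm_ring_1 mat"
  by (rule assoc_mult_mat[of _ "dim_row A" "dim_col A" _ "dim_col B" _ "dim_col C"]) auto

lemma mat_distrib_dim_1: "dim_row A = dim_row B \<Longrightarrow> dim_col A = dim_col B \<Longrightarrow> dim_col A = dim_row C \<Longrightarrow> (A + B) * C = A * C + B * C"
  for A B C :: "'a::comm_ring_1 mat"
  by (rule add_mult_distrib_mat[of _ "dim_row A" "dim_col A" _ _ "dim_col C"]) auto

lemma mat_distrib_dim_2: "dim_row A = dim_row B \<Longrightarrow> dim_col A = dim_col B \<Longrightarrow> dim_col A = dim_row C \<Longrightarrow> (A - B) * C = A * C - B * C"
  for A B C :: "'a::comm_ring_1 mat"
  by (rule minus_mult_distrib_mat[of _ "dim_row A" "dim_col A" _ _ "dim_col C"]) auto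

lemma mat_distrib_dim_3: "dim_row A = dim_row B \<Longrightarrow> dim_col A = dim_col B \<Longrightarrow> dim_col C = dim_row A \<Longrightarrow> C * (A + B) = C * A + C * B"
  for A B C :: "'a::comm_ring_1 mat"
  by (rule mult_add_distrib_mat[of _ "dim_row C" "dim_col C" _ "dim_col A"]) auto

lemma mat_distrib_dim_4: "dim_row A = dim_row B \<Longrightarrow> dim_col A = dim_col B \<Longrightarrow> dim_col C = dim_row A \<Longrightarrow> C * (A - B) = C * A - C * B"
  for A B C :: "'a::comm_ring_1 mat"
  by (rule mult_minus_distrib_mat[of _ "dim_row C" "dim_col C" _ "dim_col A"]) auto

lemma mat_distrib_dim_5: "dim_col A = dim_row C \<Longrightarrow> (x \<cdot>\<^sub>m A) * C = x \<cdot>\<^sub>m (A * C)"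
  for A B C :: "'a::comm_ring_1 mat"
  by (rule mult_smult_assoc_mat[of _ "dim_row A" "dim_col A" _ "dim_col C"]) auto

lemma mat_distrib_dim_6: "dim_col C = dim_row A \<Longrightarrow> C * (x \<cdot>\<^sub>m A) = x \<cdot>\<^sub>m (C * A)"
  for A B C :: "'a::comm_ring_1 mat"
  by (rule mult_smult_distrib[of _ "dim_row C" "dim_col C" _ "dim_col A"]) auto

lemmas mat_distrib_dim = mat_distrib_dim_1 mat_distrib_dim_2 mat_distrib_dim_3 mat_distrib_dim_4
  mat_distrib_dim_5 mat_distrib_dim_6

section \<open>Matrices of size four that are similar to a cubic block and a scalar\<close>

locale cubic_block =
  fixes A :: "'k::field mat" and c :: 'k
  assumes A [simp]: "A \<in> carrier_mat 3 3" and irred: "irreducible (char_poly A)"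
begin

definition "t = mat_trace A"
definition "s = A $$ (0, 0) * A $$ (1, 1) - A $$ (0, 1) * A $$ (1, 0)
  + A $$ (0, 0) * A $$ (2, 2) - A $$ (0, 2) * A $$ (2, 0)
  + A $$ (1, 1) * A $$ (2, 2) - A $$ (1, 2) * A $$ (2, 1)"
definition "n = det A"

lemma A_dim [simp]: "dim_row A = 3" "dim_col A = 3"
  by (rule carrier_matD[OF A])+

text \<open>The cubic is the characteristic polynomial of \<open>A\<close>, evaluated at \<open>x\<close>; a root would split off a linear factor.\<close>

lemma no_root: "x ^ 3 - t * x\<^sup>2 + s * x - n \<noteq> 0"
proof
  assume root: "x ^ 3 - t * x\<^sup>2 + s * x - n = 0"
  have tr: "mat_trace A = A $$ (0, 0) + A $$ (1, 1) + A $$ (2, 2)"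
    by (simp add: mat_trace_def numeral_3_eq_3 numeral_2_eq_2)
  have "poly (char_poly A) x = x ^ 3 - t * x\<^sup>2 + s * x - n"
    unfolding char_poly_defs s_def n_def t_def tr
    by (subst (1 2) det_3) (auto simp: algebra_simps power2_eq_square power3_eq_cube)
  then have "[:- x, 1:] dvd char_poly A"
    using root by (simp add: poly_eq_0_iff_dvd)
  then obtain q where q: "char_poly A = [:- x, 1:] * q" by (auto simp: dvd_def)
  then have "is_unit [:- x, 1:] \<or> is_unit q"
    using irreducibleD[OF irred] by blast
  then have "is_unit q" by (auto simp: is_unit_pCons_iff)
  then have "degree q = 0" by (rule is_unit_polyE) simp
  moreover have "q \<noteq> 0" using \<open>is_unit q\<close> by auto
  ultimately have "degree (char_poly A) = 1"
    unfolding q by (subst degree_mult_eq) auto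
  then show False using degree_monic_char_poly[OF A] by simp
qed

definition "krylov v = mat 3 3 (\<lambda>(i, j). (if j = 0 then v else if j = 1 then A *\<^sub>v v else A *\<^sub>v (A *\<^sub>v v)) $ i)"

text \<open>The matrix of \<open>A\<close> in the basis \<open>v, A v, A\<^sup>2 v\<close>, for any nonzero \<open>v\<close>.\<close>

definition "companion = mat 3 3 (\<lambda>(i, j). [[0, 0, n], [1, 0, - s], [0, 1, t]] ! i ! j)"

lemma krylov_carrier [simp]: "krylov v \<in> carrier_mat 3 3" "dim_row (krylov v) = 3" "dim_col (krylov v) = 3"
  by (auto simp: krylov_def)

lemma companion_carrier [simp]: "companion \<in> carrier_mat 3 3" "dim_row companion = 3" "dim_col companion = 3"
  by (auto simp: companion_def)

text \<open>The last column is the theorem of Cayley and Hamilton.\<close>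

lemma krylov_companion:
  assumes v: "v \<in> carrier_vec 3"
  shows "A * krylov v = krylov v * companion"
proof -
  have tr: "mat_trace A = A $$ (0, 0) + A $$ (1, 1) + A $$ (2, 2)"
    by (simp add: mat_trace_def numeral_3_eq_3 numeral_2_eq_2)
  have dv: "dim_vec v = 3" using v by simp
  show ?thesis
  proof (rule eq_matI)
    fix i j assume "i < dim_row (krylov v * companion)" "j < dim_col (krylov v * companion)"
    then have "i < 3" "j < 3" by auto
    then show "(A * krylov v) $$ (i, j) = (krylov v * companion) $$ (i, j)"
      by (auto simp del: index_mult_mat(1) index_mult_mat_vec
          simp: lessThan_small mult_entry_3 krylov_def companion_def mult_mat_vec_entry_3 dv
          s_def t_def tr n_def det_3 algebra_simps)
  qed auto
qed

text \<open>A linear relation between \<open>v\<close>, \<open>A v\<close> and \<open>A\<^sup>2 v\<close> would give an eigenvalue: either \<open>v\<close> is an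
  eigenvector, or it spans an invariant plane and the quotient by this plane has an eigenvalue.\<close>

lemma krylov_GL:
  assumes v: "v \<in> carrier_vec 3" "v \<noteq> 0\<^sub>v 3"
  shows "krylov v \<in> carrier (GL 3)"
proof (rule det_nonzero_GL)
  show "det (krylov v) \<noteq> 0"
  proof
    assume "det (krylov v) = 0"
    then obtain z where z: "z \<in> carrier_vec 3" "z \<noteq> 0\<^sub>v 3" "krylov v *\<^sub>v z = 0\<^sub>v 3"
      using det_0_iff_vec_prod_zero_field[OF krylov_carrier(1)[of v]] by blast
    define p where "p i = krylov v $$ (i, 0)" for i
    define q where "q i = krylov v $$ (i, 1)" for i
    define r where "r i = krylov v $$ (i, 2)" for i
    have "(krylov v *\<^sub>v z) $ i = 0" if "i < 3" for i using z(3) that by simp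
    then have rel: "z $ 0 * p i + z $ 1 * q i + z $ 2 * r i = 0" if "i < 3" for i
      using that z(1) mult_mat_vec_entry_3[of "krylov v" z i]
      by (simp add: p_def q_def r_def mult.commute)
    have AK: "A $$ (i, 0) * krylov v $$ (0, j) + A $$ (i, 1) * krylov v $$ (1, j) + A $$ (i, 2) * krylov v $$ (2, j)
        = krylov v $$ (i, 0) * companion $$ (0, j) + krylov v $$ (i, 1) * companion $$ (1, j) + krylov v $$ (i, 2) * companion $$ (2, j)"
      if "i < 3" "j < 3" for i j
      using mult_entry_3[of A "krylov v" i j] mult_entry_3[of "krylov v" companion i j] krylov_companion[OF v(1)] that
      by simp
    have Ap: "A $$ (i, 0) * p 0 + A $$ (i, 1) * p 1 + A $$ (i, 2) * p 2 = q i"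
      and Aq: "A $$ (i, 0) * q 0 + A $$ (i, 1) * q 1 + A $$ (i, 2) * q 2 = r i"
      and Ar: "A $$ (i, 0) * r 0 + A $$ (i, 1) * r 1 + A $$ (i, 2) * r 2 = n * p i - s * q i + t * r i"
      if "i < 3" for i
      using AK[OF that, of 0] AK[OF that, of 1] AK[OF that, of 2]
      by (simp_all add: p_def q_def r_def companion_def algebra_simps)
    obtain k where k: "k < 3" "p k \<noteq> 0"
    proof -
      obtain k where "k < 3" "v $ k \<noteq> 0" using v by (metis carrier_vecD eq_vecI index_zero_vec)
      then show thesis using that[of k] by (simp add: p_def krylov_def)
    qed
    have eigen: False if e: "\<And>i. i < 3 \<Longrightarrow> q i = x * p i" for x
    proof -
      have lin: "A $$ (i, 0) * (x * f 0) + A $$ (i, 1) * (x * f 1) + A $$ (i, 2) * (x * f 2)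
          = x * (A $$ (i, 0) * f 0 + A $$ (i, 1) * f 1 + A $$ (i, 2) * f 2)" for i and f :: "nat \<Rightarrow> 'k"
        by (simp add: algebra_simps)
      have e3: "q 0 = x * p 0" "q 1 = x * p 1" "q 2 = x * p 2" by (simp_all add: e)
      have r: "r i = x * q i" if "i < 3" for i
        using lin[of i p] by (simp only: Aq[OF that, symmetric] Ap[OF that] e3)
      have r3: "r 0 = x * q 0" "r 1 = x * q 1" "r 2 = x * q 2" by (simp_all add: r)
      have "x * r k = n * p k - s * q k + t * r k"
        using lin[of k q] by (simp only: Ar[OF k(1), symmetric] Aq[OF k(1)] r3)
      then have "(x ^ 3 - t * x\<^sup>2 + s * x - n) * p k = 0"
        using r[OF k(1)] e[OF k(1)] by (simp add: algebra_simps power2_eq_square power3_eq_cube)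
      then show False using k(2) no_root by simp
    qed
    have z2: "z $ 2 = 0"
    proof (rule ccontr)
      assume nz: "z $ 2 \<noteq> 0"
      define x where "x = - z $ 0 / z $ 2"
      define y where "y = - z $ 1 / z $ 2"
      have r: "r i = x * p i + y * q i" if "i < 3" for i
        using rel[OF that] nz unfolding x_def y_def by (simp add: field_simps eq_neg_iff_add_eq_0)
      have r1: "n * p i - s * q i + t * r i = x * q i + y * r i" if i: "i < 3" for i
      proof -
        have "A $$ (i, 0) * r 0 + A $$ (i, 1) * r 1 + A $$ (i, 2) * r 2
            = x * (A $$ (i, 0) * p 0 + A $$ (i, 1) * p 1 + A $$ (i, 2) * p 2)
            + y * (A $$ (i, 0) * q 0 + A $$ (i, 1) * q 1 + A $$ (i, 2) * q 2)"
          using r[of 0] r[of 1] r[of 2] by (simp add: algebra_simps)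
        then show ?thesis by (simp only: Ar[OF i] Ap[OF i] Aq[OF i])
      qed
      have r2: "((y - t) * y + x + s) * q i = (n - (y - t) * x) * p i" if "i < 3" for i
        using r1[OF that] r[OF that] by (simp add: algebra_simps)
      show False
      proof (cases "(y - t) * y + x + s = 0")
        case True
        have n: "n = (y - t) * x" using r2[OF k(1)] True k(2) by simp
        have s: "s = - ((y - t) * y + x)" using True by (simp add: eq_neg_iff_add_eq_0 algebra_simps)
        have "(t - y) ^ 3 - t * (t - y)\<^sup>2 + s * (t - y) - n = 0"
          unfolding n s by (simp add: algebra_simps power2_eq_square power3_eq_cube)
        then show False using no_root by blast
      next
        case False
        then show False
          using eigen[of "(n - (y - t) * x) / ((y - t) * y + x + s)"] r2 by (simp add: field_simps)
      qed
    qed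
    have z1: "z $ 1 = 0"
    proof (rule ccontr)
      assume nz: "z $ 1 \<noteq> 0"
      have "q i = (- z $ 0 / z $ 1) * p i" if "i < 3" for i
        using rel[OF that] nz z2 by (simp add: field_simps eq_neg_iff_add_eq_0)
      then show False using eigen by blast
    qed
    have "z $ 0 = 0" using rel[OF k(1)] z1 z2 k(2) by simp
    then have "z = 0\<^sub>v 3" using z(1) z1 z2 by (auto intro!: eq_vecI simp: lessThan_small)
    then show False using z(2) by blast
  qed
qed simp

end

lemma upper_block_mult:
  fixes A A' :: "'a::comm_ring_1 mat"
  assumes "A \<in> carrier_mat n n" "B \<in> carrier_mat n m" "D \<in> carrier_mat m m"
    and "A' \<in> carrier_mat n n" "B' \<in> carrier_mat n m" "D' \<in> carrier_mat m m"
  shows "four_block_mat A B (0\<^sub>m m n) D * four_block_mat A' B' (0\<^sub>m m n) D'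
    = four_block_mat (A * A') (A * B' + B * D') (0\<^sub>m m n) (D * D')"
proof -
  have "four_block_mat A B (0\<^sub>m m n) D * four_block_mat A' B' (0\<^sub>m m n) D'
    = four_block_mat (A * A' + B * 0\<^sub>m m n) (A * B' + B * D') (0\<^sub>m m n * A' + D * 0\<^sub>m m n) (0\<^sub>m m n * B' + D * D')"
    using assms by (intro mult_four_block_mat) auto
  also have "\<dots> = four_block_mat (A * A') (A * B' + B * D') (0\<^sub>m m n) (D * D')"
    using assms by (intro cong_four_block_mat) auto
  finally show ?thesis .
qed

lemma upper_block_GL:
  fixes g :: "'a::comm_ring_1 mat"
  assumes g: "g \<in> carrier (GL n)" and h: "h \<in> carrier (GL m)" and Y: "Y \<in> carrier_mat n m"
  shows "four_block_mat g Y (0\<^sub>m m n) h \<in> carrier (GL (n + m))"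
proof -
  let ?g = "inv\<^bsub>GL n\<^esub> g" and ?h = "inv\<^bsub>GL m\<^esub> h"
  let ?Y = "- (?g * Y * ?h)"
  note gi = GL_inv[OF g] GL_carrier[OF g] and hi = GL_inv[OF h] GL_carrier[OF h]
  have d: "dim_row g = n" "dim_col g = n" "dim_row ?g = n" "dim_col ?g = n" "dim_row Y = n" "dim_col Y = m"
    "dim_row h = m" "dim_col h = m" "dim_row ?h = m" "dim_col ?h = m"
    using gi hi Y by auto
  have neg: "A * - B = - (A * B)" if "dim_col A = dim_row B" for A B :: "'a mat"
    using that by (intro eq_matI) auto
  have 1: "g * ?Y + Y * ?h = 0\<^sub>m n m"
    using gi by (simp add: neg d mat_assoc_dim) (simp add: d gi(3) flip: mat_assoc_dim, auto simp: d intro!: eq_matI)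
  have 2: "?g * Y + ?Y * h = 0\<^sub>m n m"
  proof -
    have "?g * Y * ?h * h = ?g * Y" using hi(2) by (simp add: d mat_assoc_dim)
    then have "?Y * h = - (?g * Y)"
      by (subst uminus_mult_left_mat) (simp_all add: d)
    then show ?thesis by (auto simp: d intro!: eq_matI)
  qed
  have "four_block_mat ?g ?Y (0\<^sub>m m n) ?h * four_block_mat g Y (0\<^sub>m m n) h
      = four_block_mat (?g * g) (?g * Y + ?Y * h) (0\<^sub>m m n) (?h * h)"
    by (rule upper_block_mult) (use gi hi Y in auto)
  then have l: "four_block_mat ?g ?Y (0\<^sub>m m n) ?h * four_block_mat g Y (0\<^sub>m m n) h = 1\<^sub>m (n + m)"
    by (simp only: 2 gi(2) hi(2) four_block_one_mat)
  have "four_block_mat g Y (0\<^sub>m m n) h * four_block_mat ?g ?Y (0\<^sub>m m n) ?h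
      = four_block_mat (g * ?g) (g * ?Y + Y * ?h) (0\<^sub>m m n) (h * ?h)"
    by (rule upper_block_mult) (use gi hi Y in auto)
  then have r: "four_block_mat g Y (0\<^sub>m m n) h * four_block_mat ?g ?Y (0\<^sub>m m n) ?h = 1\<^sub>m (n + m)"
    by (simp only: 1 gi(3) hi(3) four_block_one_mat)
  show ?thesis
    by (rule GL_I[OF four_block_carrier_mat four_block_carrier_mat l r]) (use gi hi in auto)
qed

lemma block_diag_GL_D:
  fixes a :: "'a::comm_ring_1 mat"
  assumes g: "four_block_mat a (0\<^sub>m n m) (0\<^sub>m m n) f \<in> carrier (GL (n + m))"
    and a: "a \<in> carrier_mat n n" and f: "f \<in> carrier_mat m m"
  shows "a \<in> carrier (GL n)" "f \<in> carrier (GL m)"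
proof -
  let ?g = "four_block_mat a (0\<^sub>m n m) (0\<^sub>m m n) f"
  note i = GL_inv[OF g]
  obtain y1 y2 y3 y4 where y: "y1 \<in> carrier_mat n n" "y2 \<in> carrier_mat n m" "y3 \<in> carrier_mat m n" "y4 \<in> carrier_mat m m"
    and yb: "inv\<^bsub>GL (n + m)\<^esub> ?g = four_block_mat y1 y2 y3 y4"
    using i(4) by (rule four_block_split)
  have "?g * four_block_mat y1 y2 y3 y4 = four_block_mat (a * y1 + 0\<^sub>m n m * y3) (a * y2 + 0\<^sub>m n m * y4)
      (0\<^sub>m m n * y1 + f * y3) (0\<^sub>m m n * y2 + f * y4)"
    using a f y by (intro mult_four_block_mat) auto
  then have "four_block_mat (a * y1 + 0\<^sub>m n m * y3) (a * y2 + 0\<^sub>m n m * y4)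
      (0\<^sub>m m n * y1 + f * y3) (0\<^sub>m m n * y2 + f * y4) = four_block_mat (1\<^sub>m n) (0\<^sub>m n m) (0\<^sub>m m n) (1\<^sub>m m)"
    using i(3) yb by simp
  then have l: "a * y1 + 0\<^sub>m n m * y3 = 1\<^sub>m n" "0\<^sub>m m n * y2 + f * y4 = 1\<^sub>m m"
    using a f y by (subst (asm) four_block_mat_eq_iff[of _ n n _ m _ m]; auto)+
  have "four_block_mat y1 y2 y3 y4 * ?g = four_block_mat (y1 * a + y2 * 0\<^sub>m m n) (y1 * 0\<^sub>m n m + y2 * f)
      (y3 * a + y4 * 0\<^sub>m m n) (y3 * 0\<^sub>m n m + y4 * f)"
    using a f y by (intro mult_four_block_mat) auto
  then have "four_block_mat (y1 * a + y2 * 0\<^sub>m m n) (y1 * 0\<^sub>m n m + y2 * f)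
      (y3 * a + y4 * 0\<^sub>m m n) (y3 * 0\<^sub>m n m + y4 * f) = four_block_mat (1\<^sub>m n) (0\<^sub>m n m) (0\<^sub>m m n) (1\<^sub>m m)"
    using i(2) yb by simp
  then have r: "y1 * a + y2 * 0\<^sub>m m n = 1\<^sub>m n" "y3 * 0\<^sub>m n m + y4 * f = 1\<^sub>m m"
    using a f y by (subst (asm) four_block_mat_eq_iff[of _ n n _ m _ m]; auto)+
  have "a * y1 = 1\<^sub>m n" "y1 * a = 1\<^sub>m n" "f * y4 = 1\<^sub>m m" "y4 * f = 1\<^sub>m m"
    using l r a f y right_add_zero_mat[of "a * y1" n n] right_add_zero_mat[of "y1 * a" n n]
      left_add_zero_mat[of "f * y4" m m] left_add_zero_mat[of "y4 * f" m m] by auto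
  then show "a \<in> carrier (GL n)" "f \<in> carrier (GL m)"
    using a f y by (auto intro: GL_I)
qed

text \<open>The product of \<open>diag (g, g)\<close> and the unipotent matrix with upper right block \<open>X\<close>. Conjugation by these
  products preserves the lower left block \<open>1\<close>, and a suitable unipotent part clears the lower right block.\<close>

definition shear :: "'a::comm_ring_1 mat \<Rightarrow> 'a mat \<Rightarrow> 'a mat" where
  "shear g X = four_block_mat g (g * X) (0\<^sub>m 2 2) g"

lemma shear_carrier [simp]:
  "g \<in> carrier_mat 2 2 \<Longrightarrow> shear g X \<in> carrier_mat 4 4"
  using four_block_carrier_mat[of g 2 2 g 2 2] by (simp add: shear_def)

text \<open>The companion matrix of the matrix polynomial \<open>x\<^sup>2 - B x - b\<close>.\<close>

definition tower :: "'a::comm_ring_1 mat \<Rightarrow> 'a mat \<Rightarrow> 'a mat" where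
  "tower B b = four_block_mat B b (1\<^sub>m 2) (0\<^sub>m 2 2)"

context cubic_block
begin

abbreviation "C0 \<equiv> four_block_mat A (0\<^sub>m 3 1) (0\<^sub>m 1 3) (c \<cdot>\<^sub>m 1\<^sub>m 1)"

text \<open>A matrix with lower blocks \<open>1\<close> and \<open>0\<close> is a quadratic relation: its first two columns \<open>W\<close> satisfy
  \<open>C0 C0 W = C0 W B + W b\<close>, and they determine the other two. Here \<open>W\<close> consists of \<open>P\<close> and \<open>l\<close>.\<close>

lemma C0_tower:
  assumes [simp]: "P \<in> carrier_mat 3 2" "l \<in> carrier_mat 1 2" "B \<in> carrier_mat 2 2" "b \<in> carrier_mat 2 2"
    and P: "A * (A * P) = A * P * B + P * b" and l: "c \<cdot>\<^sub>m (c \<cdot>\<^sub>m l) = c \<cdot>\<^sub>m l * B + l * b"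
  defines "G \<equiv> four_block_mat P (A * P - P * B) l (c \<cdot>\<^sub>m l - l * B)"
  shows "C0 * G = G * tower B b"
proof -
  have d[simp]: "dim_row P = 3" "dim_col P = 2" "dim_row l = 1" "dim_col l = 2" "dim_row B = 2" "dim_col B = 2"
    "dim_row b = 2" "dim_col b = 2"
    using assms(1-4) by (meson carrier_matD)+
  have "C0 * G = four_block_mat (A * P + 0\<^sub>m 3 1 * l) (A * (A * P - P * B) + 0\<^sub>m 3 1 * (c \<cdot>\<^sub>m l - l * B))
      (0\<^sub>m 1 3 * P + (c \<cdot>\<^sub>m 1\<^sub>m 1) * l) (0\<^sub>m 1 3 * (A * P - P * B) + (c \<cdot>\<^sub>m 1\<^sub>m 1) * (c \<cdot>\<^sub>m l - l * B))"
    unfolding G_def by (rule mult_four_block_mat) auto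
  also have "\<dots> = four_block_mat (A * P) (A * P * B + P * b - A * (P * B)) (c \<cdot>\<^sub>m l) (c \<cdot>\<^sub>m l * B + l * b - c \<cdot>\<^sub>m (l * B))"
    unfolding P[symmetric] l[symmetric]
    by (intro cong_four_block_mat) (auto simp: mat_distrib_dim intro!: eq_matI)
  also have "\<dots> = four_block_mat (P * B + (A * P - P * B) * 1\<^sub>m 2) (P * b + (A * P - P * B) * 0\<^sub>m 2 2)
      (l * B + (c \<cdot>\<^sub>m l - l * B) * 1\<^sub>m 2) (l * b + (c \<cdot>\<^sub>m l - l * B) * 0\<^sub>m 2 2)"
    by (intro cong_four_block_mat) (auto simp: mat_distrib_dim mat_assoc_dim intro!: eq_matI)
  also have "\<dots> = G * tower B b"
    unfolding G_def tower_def by (rule mult_four_block_mat[symmetric]) auto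
  finally show ?thesis .
qed

text \<open>The columns of \<open>lead_cols e\<close> are the coordinates of \<open>x - c\<close> and \<open>x\<^sup>2 + e\<close> in \<open>k[x]/(char_poly A)\<close>, and
  \<open>lastrow\<close> extends these vectors by \<open>0\<close> and \<open>1\<close>. The matrices \<open>Be e\<close> and \<open>be e\<close> then express the square of
  multiplication by \<open>x\<close>, and by \<open>c\<close> in the last coordinate, as in \<open>C0_tower\<close>.\<close>

definition "lastrow = (mat 1 2 (\<lambda>(i, j). [0, 1] ! j) :: 'k mat)"
definition "lead_cols e = (mat 3 2 (\<lambda>(i, j). [[- c, e], [1, 0], [0, 1]] ! i ! j) :: 'k mat)"
definition "Be e = mat22 0 (e - s) 1 (c + t)"
definition "be e = mat22 (- e) (n - t * e) (- c) (- t * c)"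

lemma lead_cols_simps [simp]:
  "lead_cols e \<in> carrier_mat 3 2" "dim_row (lead_cols e) = 3" "dim_col (lead_cols e) = 2"
  "lastrow \<in> carrier_mat 1 2" "dim_row lastrow = 1" "dim_col lastrow = 2"
  "Be e \<in> carrier_mat 2 2" "be e \<in> carrier_mat 2 2" "dim_row (Be e) = 2" "dim_col (Be e) = 2"
  "dim_row (be e) = 2" "dim_col (be e) = 2"
  by (auto simp: lead_cols_def lastrow_def Be_def be_def)

lemma lead_cols_relation: "companion * (companion * lead_cols e) = companion * lead_cols e * Be e + lead_cols e * be e"
  by (rule eq_matI)
    (auto simp del: index_mult_mat(1) simp: lessThan_small mult_entry_3 mult_entry_2 lead_cols_def companion_def Be_def be_def
      algebra_simps)

lemma lastrow_relation: "c \<cdot>\<^sub>m (c \<cdot>\<^sub>m lastrow) = c \<cdot>\<^sub>m lastrow * Be e + lastrow * be e"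
  by (rule eq_matI)
    (auto simp del: index_mult_mat(1) simp: lessThan_small mult_entry_2 lastrow_def Be_def be_def algebra_simps)

definition "frame K e = four_block_mat (K * lead_cols e) (A * (K * lead_cols e) - K * lead_cols e * Be e)
    lastrow (c \<cdot>\<^sub>m lastrow - lastrow * Be e)"

lemma frame_tower:
  assumes K: "K \<in> carrier_mat 3 3" and AK: "A * K = K * companion"
  shows "C0 * frame K e = frame K e * tower (Be e) (be e)"
  unfolding frame_def
proof (rule C0_tower)
  have d[simp]: "dim_row K = 3" "dim_col K = 3" using K by auto
  have AKX: "A * (K * X) = K * (companion * X)" if "dim_row X = 3" for X
    using that AK by (simp add: mat_assoc_dim[symmetric])
  have "A * (A * (K * lead_cols e)) = K * (companion * (companion * lead_cols e))"
    by (simp add: AKX)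
  also have "\<dots> = K * (companion * lead_cols e * Be e) + K * (lead_cols e * be e)"
    unfolding lead_cols_relation by (simp add: mat_distrib_dim)
  also have "\<dots> = A * (K * lead_cols e) * Be e + K * lead_cols e * be e"
    by (simp add: mat_assoc_dim AKX)
  finally show "A * (A * (K * lead_cols e)) = A * (K * lead_cols e) * Be e + K * lead_cols e * be e" .
qed (use K lastrow_relation in auto)

text \<open>In the basis given by \<open>K\<close> the frame has determinant \<open>\<plusminus> char_poly A\<close> at \<open>c\<close>, up to the factor \<open>det K\<close>. The last equation
  of the linear system that is solved below, after substituting the other three, has this number as its coefficient.\<close>

lemma frame_GL:
  assumes K: "K \<in> carrier (GL 3)" and AK: "A * K = K * companion"
  shows "frame K e \<in> carrier (GL 4)"
proof -
  have Kc: "K \<in> carrier_mat 3 3" and d[simp]: "dim_row K = 3" "dim_col K = 3"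
    using GL_carrier[OF K] by auto
  define G where "G = four_block_mat (lead_cols e) (companion * lead_cols e - lead_cols e * Be e) lastrow (c \<cdot>\<^sub>m lastrow - lastrow * Be e)"
  have Gc: "G \<in> carrier_mat (3 + 1) (2 + 2)"
    unfolding G_def by (rule four_block_carrier_mat) auto
  then have Gc4: "G \<in> carrier_mat 4 4" by simp
  have G: "G = mat 4 4 (\<lambda>(i, j). [[- c, e, - e, n - c * s - t * e], [1, 0, - c, 0], [0, 1, 0, - c], [0, 1, - 1, - t]] ! i ! j)"
  proof (rule eq_matI)
    fix i j :: nat
    assume "i < dim_row (mat 4 4 (\<lambda>(i, j). [[- c, e, - e, n - c * s - t * e], [1, 0, - c, 0], [0, 1, 0, - c], [0, 1, - 1, - t]] ! i ! j))"
      "j < dim_col (mat 4 4 (\<lambda>(i, j). [[- c, e, - e, n - c * s - t * e], [1, 0, - c, 0], [0, 1, 0, - c], [0, 1, - 1, - t]] ! i ! j))"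
    then have "i \<in> {0, 1, 2, 3}" "j \<in> {0, 1, 2, 3}" by auto
    then show "G $$ (i, j) = mat 4 4 (\<lambda>(i, j). [[- c, e, - e, n - c * s - t * e], [1, 0, - c, 0], [0, 1, 0, - c], [0, 1, - 1, - t]] ! i ! j) $$ (i, j)"
      unfolding G_def
      by (auto simp del: index_mult_mat(1) simp: mult_entry_3 mult_entry_2 lead_cols_def companion_def Be_def lastrow_def
          algebra_simps)
  qed (use Gc4 in auto)
  have "det G \<noteq> 0"
  proof
    assume "det G = 0"
    then obtain z where z: "z \<in> carrier_vec 4" "z \<noteq> 0\<^sub>v 4" "G *\<^sub>v z = 0\<^sub>v 4"
      using det_0_iff_vec_prod_zero_field[OF Gc4] by blast
    have e: "(\<Sum>j\<in>{0..<4}. G $$ (i, j) * z $ j) = 0" if "i < 4" for i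
    proof -
      have "(G *\<^sub>v z) $ i = 0" using z(3) that by simp
      then show ?thesis using Gc4 z(1) that by (simp add: scalar_prod_def)
    qed
    have sum4: "sum f {0..<4} = f 0 + f 1 + f 2 + f 3" for f :: "nat \<Rightarrow> 'k"
      by (simp add: numeral_eq_Suc)
    have e0: "- c * z $ 0 + e * z $ 1 - e * z $ 2 + (n - c * s - t * e) * z $ 3 = 0"
      and e1: "z $ 0 = c * z $ 2" and e2: "z $ 1 = c * z $ 3" and e3: "z $ 2 = (c - t) * z $ 3"
      using e[of 0] e[of 1] e[of 2] e[of 3] unfolding sum4 G by (simp_all add: algebra_simps)
    have "(c ^ 3 - t * c\<^sup>2 + s * c - n) * z $ 3 = 0"
      using e0 unfolding e1 e2 e3 by (simp add: algebra_simps power2_eq_square power3_eq_cube)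
    then have "z $ 3 = 0" using no_root by simp
    then have "z = 0\<^sub>v 4" using z(1) e1 e2 e3 by (auto intro!: eq_vecI simp: less_Suc_eq numeral_eq_Suc)
    then show False using z(2) by blast
  qed
  then have G_GL: "G \<in> carrier (GL 4)" using det_nonzero_GL[OF Gc4] by blast
  let ?K = "four_block_mat K (0\<^sub>m 3 1) (0\<^sub>m 1 3) (1\<^sub>m 1)"
  have K_GL: "?K \<in> carrier (GL 4)"
    using upper_block_GL[OF K one_GL[of 1] zero_carrier_mat] by simp
  have "?K * G = frame K e"
    unfolding G_def frame_def
    by (subst mult_four_block_mat; (rule Kc zero_carrier_mat one_carrier_mat lead_cols_simps)?)
      (auto intro!: cong_four_block_mat simp: mat_distrib_dim mat_assoc_dim AK[symmetric] simp flip: mat_assoc_dim)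
  then show ?thesis using GL_m_closed[OF K_GL G_GL] by simp
qed

end

lemma mult_cancel_GL:
  assumes g: "g \<in> carrier (GL n)" and "X \<in> carrier_mat n m" "Y \<in> carrier_mat n m" and eq: "g * X = g * Y"
  shows "X = Y"
proof -
  have "inv\<^bsub>GL n\<^esub> g * (g * X) = inv\<^bsub>GL n\<^esub> g * (g * Y)" using eq by simp
  then show ?thesis
    using GL_inv[OF g] GL_carrier[OF g] assms(2,3) by (simp del: assoc_mult_mat flip: mat_assoc_dim)
qed

lemma mat_eq_diff: "M = N + R \<Longrightarrow> N \<in> carrier_mat n m \<Longrightarrow> R \<in> carrier_mat n m \<Longrightarrow> R = M - N"
  for M N R :: "'a::comm_ring_1 mat"
  by (auto intro!: eq_matI)

lemma four_block_mult_2: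
  fixes A1 :: "'a::comm_ring_1 mat"
  assumes "A1 \<in> carrier_mat 2 2" "B1 \<in> carrier_mat 2 2" "C1 \<in> carrier_mat 2 2" "D1 \<in> carrier_mat 2 2"
    "A2 \<in> carrier_mat 2 2" "B2 \<in> carrier_mat 2 2" "C2 \<in> carrier_mat 2 2" "D2 \<in> carrier_mat 2 2"
  shows "four_block_mat A1 B1 C1 D1 * four_block_mat A2 B2 C2 D2
    = four_block_mat (A1 * A2 + B1 * C2) (A1 * B2 + B1 * D2) (C1 * A2 + D1 * C2) (C1 * B2 + D1 * D2)"
  by (rule mult_four_block_mat[OF assms])

lemma tower_carrier [simp]: "B \<in> carrier_mat 2 2 \<Longrightarrow> tower B b \<in> carrier_mat 4 4"
  using four_block_carrier_mat[of B 2 2 "0\<^sub>m 2 2" 2 2] by (simp add: tower_def)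

lemma shear_GL: "g \<in> carrier (GL 2) \<Longrightarrow> X \<in> carrier_mat 2 2 \<Longrightarrow> shear g X \<in> carrier (GL 4)"
  using upper_block_GL[of g 2 g 2 "g * X"] GL_carrier[of g 2] by (simp add: shear_def)

lemma shear_mult_diag:
  assumes h: "h \<in> carrier_mat 2 2" and k: "k \<in> carrier (GL 2)" and X: "X \<in> carrier_mat 2 2"
  shows "shear h X * shear k (0\<^sub>m 2 2) = shear (h * k) (inv\<^bsub>GL 2\<^esub> k * X * k)"
proof -
  note kc = GL_carrier[OF k] GL_inv[OF k]
  have "shear h X * shear k (0\<^sub>m 2 2) = four_block_mat (h * k) (h * 0\<^sub>m 2 2 + h * X * k) (0\<^sub>m 2 2) (h * k)"
    unfolding shear_def using h kc X by (subst upper_block_mult) auto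
  also have "h * 0\<^sub>m 2 2 + h * X * k = h * k * (inv\<^bsub>GL 2\<^esub> k * X * k)"
  proof -
    have "k * (inv\<^bsub>GL 2\<^esub> k * (X * k)) = X * k"
      using kc X by (simp del: assoc_mult_mat flip: mat_assoc_dim)
    then show ?thesis using h kc X by (auto simp: mat_assoc_dim intro!: eq_matI)
  qed
  finally show ?thesis by (simp add: shear_def)
qed

lemma tower_shear_iff:
  assumes g: "g \<in> carrier (GL 2)"
    and c: "B \<in> carrier_mat 2 2" "b \<in> carrier_mat 2 2" "B' \<in> carrier_mat 2 2" "b' \<in> carrier_mat 2 2" "X \<in> carrier_mat 2 2"
  shows "tower B b * shear g X = shear g X * tower B' b' \<longleftrightarrow> X = 0\<^sub>m 2 2 \<and> B * g = g * B' \<and> b * g = g * b'"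
proof -
  note gc = GL_carrier[OF g]
  have L: "tower B b * shear g X = four_block_mat (B * g + b * 0\<^sub>m 2 2) (B * (g * X) + b * g)
      (1\<^sub>m 2 * g + 0\<^sub>m 2 2 * 0\<^sub>m 2 2) (1\<^sub>m 2 * (g * X) + 0\<^sub>m 2 2 * g)"
    unfolding tower_def shear_def using c gc by (intro four_block_mult_2) auto
  have R: "shear g X * tower B' b' = four_block_mat (g * B' + g * X * 1\<^sub>m 2) (g * b' + g * X * 0\<^sub>m 2 2)
      (0\<^sub>m 2 2 * B' + g * 1\<^sub>m 2) (0\<^sub>m 2 2 * b' + g * 0\<^sub>m 2 2)"
    unfolding tower_def shear_def using c gc by (intro four_block_mult_2) auto
  have X0: "g * X = 0\<^sub>m 2 2 \<longleftrightarrow> X = 0\<^sub>m 2 2"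
    using mult_cancel_GL[OF g c(5), of "0\<^sub>m 2 2"] gc by auto
  have "tower B b * shear g X = shear g X * tower B' b' \<longleftrightarrow>
      B * g = g * B' + g * X \<and> B * (g * X) + b * g = g * b' \<and> g * X = 0\<^sub>m 2 2"
    unfolding L R using c gc by (subst four_block_mat_eq_iff[of _ 2 2 _ 2 _ 2]) auto
  also have "\<dots> \<longleftrightarrow> X = 0\<^sub>m 2 2 \<and> B * g = g * B' \<and> b * g = g * b'"
    using c gc X0 by auto
  finally show ?thesis .
qed

context cubic_block
begin

lemma A_minus_GL: "A - c \<cdot>\<^sub>m 1\<^sub>m 3 \<in> carrier (GL 3)"
proof (rule det_nonzero_GL)
  show M: "A - c \<cdot>\<^sub>m 1\<^sub>m 3 \<in> carrier_mat 3 3" by (intro carrier_matI) auto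
  have tr: "mat_trace A = A $$ (0, 0) + A $$ (1, 1) + A $$ (2, 2)"
    by (simp add: mat_trace_def numeral_3_eq_3 numeral_2_eq_2)
  have "det (A - c \<cdot>\<^sub>m 1\<^sub>m 3) = - (c ^ 3 - t * c\<^sup>2 + s * c - n)"
    unfolding det_3[OF M] n_def t_def tr s_def det_3[OF A]
    by (simp add: algebra_simps power2_eq_square power3_eq_cube)
  then show "det (A - c \<cdot>\<^sub>m 1\<^sub>m 3) \<noteq> 0" using no_root[of c] by (metis neg_equal_0_iff_equal)
qed

lemma A_minus_mult:
  assumes "Y \<in> carrier_mat 3 m"
  shows "(A - c \<cdot>\<^sub>m 1\<^sub>m 3) * Y = A * Y - c \<cdot>\<^sub>m Y"
  using assms by (simp add: mat_distrib_dim)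

text \<open>An intertwiner between \<open>A\<close> and the scalar \<open>c\<close> vanishes, because \<open>c\<close> is not an eigenvalue of \<open>A\<close>.\<close>

lemma C0_commute:
  assumes a: "a \<in> carrier_mat 3 3" and b: "b \<in> carrier_mat 3 1" and d: "d \<in> carrier_mat 1 3" and f: "f \<in> carrier_mat 1 1"
    and eq: "C0 * four_block_mat a b d f = four_block_mat a b d f * C0"
  shows "A * a = a * A" "b = 0\<^sub>m 3 1" "d = 0\<^sub>m 1 3"
proof -
  let ?M = "A - c \<cdot>\<^sub>m 1\<^sub>m 3"
  note Mi = GL_inv[OF A_minus_GL] GL_carrier[OF A_minus_GL]
  have dims: "dim_row a = 3" "dim_col a = 3" "dim_row b = 3" "dim_col b = 1" "dim_row d = 1" "dim_col d = 3"
    "dim_row f = 1" "dim_col f = 1" using a b d f by auto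
  have "C0 * four_block_mat a b d f = four_block_mat (A * a + 0\<^sub>m 3 1 * d) (A * b + 0\<^sub>m 3 1 * f)
      (0\<^sub>m 1 3 * a + (c \<cdot>\<^sub>m 1\<^sub>m 1) * d) (0\<^sub>m 1 3 * b + (c \<cdot>\<^sub>m 1\<^sub>m 1) * f)"
    using a b d f by (intro mult_four_block_mat) auto
  moreover have "four_block_mat a b d f * C0 = four_block_mat (a * A + b * 0\<^sub>m 1 3) (a * 0\<^sub>m 3 1 + b * (c \<cdot>\<^sub>m 1\<^sub>m 1))
      (d * A + f * 0\<^sub>m 1 3) (d * 0\<^sub>m 3 1 + f * (c \<cdot>\<^sub>m 1\<^sub>m 1))"
    using a b d f by (intro mult_four_block_mat) auto
  ultimately have "four_block_mat (A * a + 0\<^sub>m 3 1 * d) (A * b + 0\<^sub>m 3 1 * f)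
      (0\<^sub>m 1 3 * a + (c \<cdot>\<^sub>m 1\<^sub>m 1) * d) (0\<^sub>m 1 3 * b + (c \<cdot>\<^sub>m 1\<^sub>m 1) * f)
    = four_block_mat (a * A + b * 0\<^sub>m 1 3) (a * 0\<^sub>m 3 1 + b * (c \<cdot>\<^sub>m 1\<^sub>m 1))
      (d * A + f * 0\<^sub>m 1 3) (d * 0\<^sub>m 3 1 + f * (c \<cdot>\<^sub>m 1\<^sub>m 1))"
    using eq by (simp only:)
  then have "A * a + 0\<^sub>m 3 1 * d = a * A + b * 0\<^sub>m 1 3" "A * b + 0\<^sub>m 3 1 * f = a * 0\<^sub>m 3 1 + b * (c \<cdot>\<^sub>m 1\<^sub>m 1)"
    "0\<^sub>m 1 3 * a + (c \<cdot>\<^sub>m 1\<^sub>m 1) * d = d * A + f * 0\<^sub>m 1 3"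
    using a b d f by (subst (asm) four_block_mat_eq_iff[of _ 3 3 _ 1 _ 1]; auto)+
  then have 1: "A * a = a * A" and 2: "A * b = c \<cdot>\<^sub>m b" and 3: "c \<cdot>\<^sub>m d = d * A"
    using a b d f dims right_add_zero_mat[OF mult_carrier_mat[OF A a]] right_add_zero_mat[OF mult_carrier_mat[OF a A]]
      right_add_zero_mat[OF mult_carrier_mat[OF A b]] right_add_zero_mat[OF mult_carrier_mat[OF d A]]
    by (simp_all add: mat_distrib_dim)
  show "A * a = a * A" by (rule 1)
  have "?M * b = ?M * 0\<^sub>m 3 1"
    unfolding A_minus_mult[OF b] 2 using b Mi(5) by auto
  then show "b = 0\<^sub>m 3 1" using mult_cancel_GL[OF A_minus_GL b] by simp
  have "d * ?M = d * A - c \<cdot>\<^sub>m d" using dims by (simp add: mat_distrib_dim)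
  also have "\<dots> = 0\<^sub>m 1 3" unfolding 3[symmetric] using d by auto
  finally have dM: "d * ?M = 0\<^sub>m 1 3" .
  have "d = d * (?M * inv\<^bsub>GL 3\<^esub> ?M)" using Mi(3) d by simp
  also have "\<dots> = (d * ?M) * inv\<^bsub>GL 3\<^esub> ?M" by (rule assoc_mult_mat[OF d Mi(5,4), symmetric])
  also have "\<dots> = 0\<^sub>m 1 3" unfolding dM using Mi(4) by simp
  finally show "d = 0\<^sub>m 1 3" .
qed

text \<open>A matrix that commutes with the companion matrix \<open>Be e\<close> has the form \<open>k0 + k2 * Be e\<close>. If it commutes with \<open>be e\<close> as well and \<open>k2\<close> is
  not zero, then \<open>e = - c\<^sup>2\<close>, and \<open>c\<close> is a root of the characteristic polynomial of \<open>A\<close>.\<close>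

lemma commutant_scalar:
  assumes k: "k \<in> carrier_mat 2 2" and B: "Be e * k = k * Be e" and b: "be e * k = k * be e"
  shows "\<exists>z. k = z \<cdot>\<^sub>m 1\<^sub>m 2"
proof -
  obtain k0 k1 k2 k3 where km: "k = mat22 k0 k1 k2 k3" using k by (rule mat22_eta)
  have k13: "k1 = (e - s) * k2" "k3 = k0 + (c + t) * k2"
    using B[unfolded km Be_def mat22_mult mat22_eq_iff, THEN conjunct1]
      B[unfolded km Be_def mat22_mult mat22_eq_iff, THEN conjunct2, THEN conjunct2, THEN conjunct1]
    by simp_all
  have eqs: "(n - t * e) * k2 = - (k1 * c)" "- (c * k0) - t * c * k2 = - (k2 * e) - k3 * c"
    using b[unfolded km be_def mat22_mult mat22_eq_iff, THEN conjunct1]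
      b[unfolded km be_def mat22_mult mat22_eq_iff, THEN conjunct2, THEN conjunct2, THEN conjunct1]
    by (simp_all add: algebra_simps)
  have 1: "(n - t * e + (e - s) * c) * k2 = 0"
    using eqs(1) unfolding k13 by (simp add: algebra_simps)
  have 2: "(e + c\<^sup>2) * k2 = 0"
    using eqs(2) unfolding k13 by (simp add: algebra_simps power2_eq_square)
  have "k2 = 0"
  proof (rule ccontr)
    assume nz: "k2 \<noteq> 0"
    have e: "e = - c\<^sup>2" using 2 nz by (simp add: eq_neg_iff_add_eq_0)
    have "n - t * e + (e - s) * c = 0" using 1 nz by simp
    then have "c ^ 3 - t * c\<^sup>2 + s * c - n = 0"
      unfolding e by (simp add: algebra_simps power2_eq_square power3_eq_cube)
    then show False using no_root by blast
  qed
  then have "k = k0 \<cdot>\<^sub>m 1\<^sub>m 2"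
    unfolding km k13 by (auto intro!: eq_matI simp: lessThan_small)
  then show ?thesis by blast
qed

text \<open>The first two columns of \<open>x\<close> span a plane \<open>W\<close> in \<open>L \<times> k\<close>, where \<open>L = k[x]/(char_poly A)\<close>, and the equation for \<open>x\<close> says that \<open>W\<close> and \<open>C0 W\<close>
  span everything. So \<open>W\<close> is not contained in \<open>L\<close> and meets \<open>L\<close> in a line, spanned by some \<open>p\<close>. Multiplication by a unit of \<open>L\<close>, which
  is the choice of \<open>K\<close>, makes \<open>p = x - c\<close>. A second basis vector \<open>(y0 + y1 x + y2 x\<^sup>2, 1)\<close> of \<open>W\<close> must have \<open>y2 \<noteq> 0\<close>, and after rescaling and
  subtracting a multiple of \<open>p\<close> it becomes \<open>(x\<^sup>2 + e, 1)\<close>.\<close>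

lemma normal_form:
  assumes x: "x \<in> carrier (GL 4)"
    and a: "a \<in> carrier_mat 2 2" and b: "b \<in> carrier_mat 2 2" and d: "d \<in> carrier_mat 2 2"
    and eq: "C0 * x = x * four_block_mat a b (1\<^sub>m 2) d"
  shows "\<exists>e. \<exists>h\<in>carrier (GL 2). \<exists>X\<in>carrier_mat 2 2.
    four_block_mat a b (1\<^sub>m 2) d * shear h X = shear h X * tower (Be e) (be e)"
proof -
  let ?C = "four_block_mat a b (1\<^sub>m 2) d"
  have Cc: "?C \<in> carrier_mat 4 4" using four_block_carrier_mat[OF a d] by simp
  have xc: "x \<in> carrier_mat 4 4" using GL_carrier[OF x] .
  obtain P R l r where c: "P \<in> carrier_mat 3 2" "R \<in> carrier_mat 3 2" "l \<in> carrier_mat 1 2" "r \<in> carrier_mat 1 2"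
    and xb: "x = four_block_mat P R l r"
    by (rule four_block_split[of x 3 1 2 2]) (use xc in auto)
  have dim: "dim_row P = 3" "dim_col P = 2" "dim_row R = 3" "dim_col R = 2" "dim_row l = 1" "dim_col l = 2"
    "dim_row r = 1" "dim_col r = 2" "dim_row a = 2" "dim_col a = 2" "dim_row b = 2" "dim_col b = 2"
    "dim_row d = 2" "dim_col d = 2"
    using c a b d by auto
  have "C0 * x = four_block_mat (A * P + 0\<^sub>m 3 1 * l) (A * R + 0\<^sub>m 3 1 * r)
      (0\<^sub>m 1 3 * P + (c \<cdot>\<^sub>m 1\<^sub>m 1) * l) (0\<^sub>m 1 3 * R + (c \<cdot>\<^sub>m 1\<^sub>m 1) * r)"
    unfolding xb using c by (intro mult_four_block_mat) auto
  moreover have "x * ?C = four_block_mat (P * a + R * 1\<^sub>m 2) (P * b + R * d) (l * a + r * 1\<^sub>m 2) (l * b + r * d)"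
    unfolding xb using c a b d by (intro mult_four_block_mat) auto
  ultimately have "four_block_mat (A * P + 0\<^sub>m 3 1 * l) (A * R + 0\<^sub>m 3 1 * r)
      (0\<^sub>m 1 3 * P + (c \<cdot>\<^sub>m 1\<^sub>m 1) * l) (0\<^sub>m 1 3 * R + (c \<cdot>\<^sub>m 1\<^sub>m 1) * r)
    = four_block_mat (P * a + R * 1\<^sub>m 2) (P * b + R * d) (l * a + r * 1\<^sub>m 2) (l * b + r * d)"
    using eq by (simp only:)
  then have "A * P + 0\<^sub>m 3 1 * l = P * a + R * 1\<^sub>m 2" "0\<^sub>m 1 3 * P + (c \<cdot>\<^sub>m 1\<^sub>m 1) * l = l * a + r * 1\<^sub>m 2"
    using c a b d by (subst (asm) four_block_mat_eq_iff[of _ 3 2 _ 2 _ 1]; auto)+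
  then have e1: "A * P = P * a + R" and e2: "c \<cdot>\<^sub>m l = l * a + r"
    using c dim right_add_zero_mat[OF mult_carrier_mat[OF A c(1)]] by (simp_all add: mat_distrib_dim)
  have R: "R = A * P - P * a" and r: "r = c \<cdot>\<^sub>m l - l * a"
    by (rule mat_eq_diff[OF e1 mult_carrier_mat[OF c(1) a] c(2)])
      (rule mat_eq_diff[OF e2 mult_carrier_mat[OF c(3) a] c(4)])
  have inj: "U = 0\<^sub>m 2 2 \<and> W = 0\<^sub>m 2 2"
    if U: "U \<in> carrier_mat 2 2" and W: "W \<in> carrier_mat 2 2" and "P * U + R * W = 0\<^sub>m 3 2" "l * U + r * W = 0\<^sub>m 1 2" for U W
  proof -
    let ?M = "four_block_mat U (0\<^sub>m 2 2) W (0\<^sub>m 2 2)"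
    have Mc: "?M \<in> carrier_mat 4 4" using four_block_carrier_mat[OF U, of "0\<^sub>m 2 2" 2 2] by simp
    have "x * ?M = four_block_mat (P * U + R * W) (P * 0\<^sub>m 2 2 + R * 0\<^sub>m 2 2) (l * U + r * W) (l * 0\<^sub>m 2 2 + r * 0\<^sub>m 2 2)"
      unfolding xb using c U W by (intro mult_four_block_mat) auto
    also have "\<dots> = four_block_mat (0\<^sub>m 3 2) (0\<^sub>m 3 2) (0\<^sub>m 1 2) (0\<^sub>m 1 2)"
      using that(3,4) c by (intro cong_four_block_mat) auto
    also have "\<dots> = x * 0\<^sub>m 4 4"
      using xc four_block_zero_mat[of 3 2 2 1] by simp
    finally have "?M = 0\<^sub>m 4 4"
      using mult_cancel_GL[OF x Mc] by simp
    then have "?M = four_block_mat (0\<^sub>m 2 2) (0\<^sub>m 2 2) (0\<^sub>m 2 2) (0\<^sub>m 2 2)"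
      using four_block_zero_mat[of 2 2 2 2] by simp
    then show ?thesis
      by (subst (asm) four_block_mat_eq_iff[of _ 2 2 _ 2 _ 2]) (use U W in auto)
  qed
  define l0 where "l0 = l $$ (0, 0)"
  define l1 where "l1 = l $$ (0, 1)"
  \<comment> \<open>Otherwise the last row of \<open>x\<close> vanishes.\<close>
  have "l0 \<noteq> 0 \<or> l1 \<noteq> 0"
  proof (rule ccontr)
    assume "\<not> (l0 \<noteq> 0 \<or> l1 \<noteq> 0)"
    then have l0: "l = 0\<^sub>m 1 2" using c(3) by (auto intro!: eq_matI simp: lessThan_small l0_def l1_def)
    then have "r = 0\<^sub>m 1 2" unfolding r using a by (auto intro!: eq_matI)
    then have "row x 3 = 0\<^sub>v 4"
      unfolding xb l0 using c by (auto intro!: eq_vecI)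
    then have "(x * inv\<^bsub>GL 4\<^esub> x) $$ (3, 3) = 0"
      using xc GL_inv(4)[OF x] by (simp add: scalar_prod_def)
    then show False using GL_inv(3)[OF x] by simp
  qed
  then obtain q0 q1 where q: "l0 * q0 + l1 * q1 = 1"
  proof
    assume "l0 \<noteq> 0" then show thesis using that[of "1 / l0" 0] by simp
  next
    assume "l1 \<noteq> 0" then show thesis using that[of 0 "1 / l1"] by simp
  qed
  \<comment> \<open>The change of basis that turns the last row of the first two columns into \<open>(0, 1)\<close>.\<close>
  define h0 where "h0 = mat22 l1 q0 (- l0) q1"
  have h0: "h0 \<in> carrier (GL 2)"
    unfolding h0_def using q by (intro mat22_GL) (simp add: algebra_simps)
  have h0c: "h0 \<in> carrier_mat 2 2" "dim_row h0 = 2" "dim_col h0 = 2" using GL_carrier[OF h0] by auto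
  have lh0: "l * h0 = lastrow"
    by (rule eq_matI)
      (use q in \<open>auto simp del: index_mult_mat(1) simp: lessThan_small mult_entry_2 dim h0_def lastrow_def
        algebra_simps l0_def[symmetric] l1_def[symmetric, unfolded One_nat_def]\<close>)
  define P1 where "P1 = P * h0"
  have P1: "P1 \<in> carrier_mat 3 2" "dim_row P1 = 3" "dim_col P1 = 2" unfolding P1_def using c h0c by auto
  define p where "p = col P1 0"
  have p: "p \<in> carrier_vec 3" "dim_vec p = 3" by (auto intro!: carrier_vecI simp: p_def P1(2))
  have "p \<noteq> 0\<^sub>v 3"
  proof
    assume p0: "p = 0\<^sub>v 3"
    have P10: "P1 $$ (i, 0) = 0" if "i < 3" for i
    proof -
      have "P1 $$ (i, 0) = vec_index p i" using that P1 by (simp add: p_def)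
      then show ?thesis using p0 that by simp
    qed
    let ?E = "mat22 1 0 0 0 :: 'k mat"
    have "P * (h0 * ?E) = P1 * ?E"
      using dim h0c by (simp add: P1_def mat_assoc_dim)
    also have "\<dots> = 0\<^sub>m 3 2"
      by (rule eq_matI) (auto simp del: index_mult_mat(1) simp: lessThan_small mult_entry_2 P1 P10)
    finally have 1: "P * (h0 * ?E) + R * 0\<^sub>m 2 2 = 0\<^sub>m 3 2" using c by simp
    have "l * (h0 * ?E) = lastrow * ?E"
      using dim h0c by (simp add: lh0[symmetric] mat_assoc_dim)
    also have "\<dots> = 0\<^sub>m 1 2"
      by (rule eq_matI) (auto simp del: index_mult_mat(1) simp: lessThan_small mult_entry_2 lastrow_def)
    finally have 2: "l * (h0 * ?E) + r * 0\<^sub>m 2 2 = 0\<^sub>m 1 2" using c by simp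
    have "h0 * ?E = h0 * 0\<^sub>m 2 2"
      using inj[OF _ _ 1 2] h0c by simp
    then have "?E = 0\<^sub>m 2 2" using mult_cancel_GL[OF h0, of ?E 2 "0\<^sub>m 2 2"] by simp
    then have "?E $$ (0, 0) = 0\<^sub>m 2 2 $$ (0, 0)" by (rule arg_cong)
    then show False by simp
  qed
  \<comment> \<open>The cyclic vector \<open>v\<close> that gives \<open>p\<close> the coordinates of \<open>x - c\<close>.\<close>
  define M where "M = A - c \<cdot>\<^sub>m 1\<^sub>m 3"
  have Mc: "M \<in> carrier_mat 3 3" "dim_row M = 3" "dim_col M = 3" unfolding M_def by auto
  have M: "M \<in> carrier (GL 3)" unfolding M_def by (rule A_minus_GL)
  define v where "v = inv\<^bsub>GL 3\<^esub> M *\<^sub>v p"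
  have v: "v \<in> carrier_vec 3" "dim_vec v = 3" unfolding v_def using GL_inv(4)[OF M] p by auto
  have Mv: "M *\<^sub>v v = p"
    unfolding v_def using assoc_mult_mat_vec[OF Mc(1) GL_inv(4)[OF M] p(1)] GL_inv(3)[OF M] p(1) by simp
  have "v \<noteq> 0\<^sub>v 3" using Mv \<open>p \<noteq> 0\<^sub>v 3\<close> Mc by auto
  define K where "K = krylov v"
  have K: "K \<in> carrier (GL 3)" unfolding K_def using krylov_GL[OF v(1)] \<open>v \<noteq> 0\<^sub>v 3\<close> by blast
  have AK: "A * K = K * companion" unfolding K_def by (rule krylov_companion[OF v(1)])
  have Kc: "K \<in> carrier_mat 3 3" "dim_row K = 3" "dim_col K = 3" unfolding K_def by auto
  have AKX: "A * (K * X) = K * (companion * X)" if "dim_row X = 3" for X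
    using that AK Kc by (simp del: assoc_mult_mat flip: mat_assoc_dim)
  define Y0 where "Y0 = inv\<^bsub>GL 3\<^esub> K * P1"
  have Y0: "dim_row Y0 = 3" "dim_col Y0 = 2" unfolding Y0_def using GL_inv(4)[OF K] P1 by auto
  have KY0: "K * Y0 = P1"
    unfolding Y0_def using GL_inv[OF K] P1 Kc by (simp del: assoc_mult_mat flip: mat_assoc_dim)
  define y0 where "y0 = Y0 $$ (0, 1)"
  define y1 where "y1 = Y0 $$ (1, 1)"
  define y2 where "y2 = Y0 $$ (2, 1)"
  define Y where "Y = mat 3 2 (\<lambda>(i, j). [[- c, y0], [1, y1], [0, y2]] ! i ! j)"
  have Y: "Y \<in> carrier_mat 3 2" "dim_row Y = 3" "dim_col Y = 2" unfolding Y_def by auto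
  have KY: "K * Y = P1"
  proof (rule eq_matI)
    fix i j assume "i < dim_row P1" "j < dim_col P1"
    then have i: "i < 3" and j: "j = 0 \<or> j = 1" using P1 by auto
    from j show "(K * Y) $$ (i, j) = P1 $$ (i, j)"
    proof
      assume j: "j = 0"
      have "P1 $$ (i, 0) = (M *\<^sub>v v) $ i" unfolding Mv p_def using i P1 by simp
      also have "\<dots> = (A *\<^sub>v v) $ i - c * v $ i"
        using i v Mc by (auto simp del: index_mult_mat_vec simp: mult_mat_vec_entry_3 lessThan_small M_def algebra_simps)
      also have "\<dots> = (K * Y) $$ (i, 0)"
        using i v by (simp del: index_mult_mat(1) index_mult_mat_vec add: mult_entry_3 K_def krylov_def Y_def)
      finally show ?thesis using j by simp
    next
      assume j: "j = 1"
      have "P1 $$ (i, 1) = (K * Y0) $$ (i, 1)" using KY0 by simp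
      also have "\<dots> = (K * Y) $$ (i, 1)"
        using i Kc Y0 by (simp del: index_mult_mat(1) add: mult_entry_3 Y_def y0_def y1_def y2_def)
      finally show ?thesis using j by simp
    qed
  qed (use Kc Y P1 in auto)
  \<comment> \<open>If \<open>y2 = 0\<close>, then the span of the first two columns of \<open>x\<close> contains a vector whose image
    under \<open>C0\<close> lies in that span again.\<close>
  have y2: "y2 \<noteq> 0"
  proof
    assume y2: "y2 = 0"
    let ?V = "mat22 (- y1) 0 1 0 :: 'k mat" and ?V1 = "mat22 y0 0 c 0 :: 'k mat"
    have YV: "companion * (Y * ?V) = Y * ?V1"
      by (rule eq_matI) (auto simp del: index_mult_mat(1)
          simp: lessThan_small mult_entry_2 mult_entry_3 Y_def companion_def y2 algebra_simps)
    have lV: "c \<cdot>\<^sub>m (lastrow * ?V) = lastrow * ?V1"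
      by (rule eq_matI) (auto simp del: index_mult_mat(1) simp: lessThan_small mult_entry_2 lastrow_def)
    define W where "W = h0 * ?V"
    define U where "U = a * W - h0 * ?V1"
    have Wc: "W \<in> carrier_mat 2 2" "dim_row W = 2" "dim_col W = 2"
      and Uc: "U \<in> carrier_mat 2 2" unfolding W_def U_def using h0c a by auto
    have "A * (P * W) = A * (K * (Y * ?V))"
      using dim h0c Kc Y by (simp add: W_def KY[unfolded P1_def] del: assoc_mult_mat flip: mat_assoc_dim)
    also have "\<dots> = K * (Y * ?V1)" using Y by (simp add: AKX YV)
    also have "\<dots> = P * (h0 * ?V1)"
      using dim h0c Kc Y by (simp add: KY[unfolded P1_def] del: assoc_mult_mat flip: mat_assoc_dim)
    finally have APW: "A * (P * W) = P * (h0 * ?V1)" .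
    have "c \<cdot>\<^sub>m (l * W) = c \<cdot>\<^sub>m (lastrow * ?V)"
      using dim h0c by (simp add: W_def lh0 del: assoc_mult_mat flip: mat_assoc_dim)
    also have "\<dots> = l * (h0 * ?V1)"
      unfolding lV using dim h0c by (simp add: lh0 del: assoc_mult_mat flip: mat_assoc_dim)
    finally have clW: "c \<cdot>\<^sub>m (l * W) = l * (h0 * ?V1)" .
    have 1: "P * U + R * W = 0\<^sub>m 3 2"
      unfolding U_def R using dim h0c Wc by (simp add: mat_distrib_dim mat_assoc_dim APW) (auto intro!: eq_matI)
    have 2: "l * U + r * W = 0\<^sub>m 1 2"
      unfolding U_def r using dim h0c Wc by (simp add: mat_distrib_dim mat_assoc_dim clW) (auto intro!: eq_matI)
    have "h0 * ?V = h0 * 0\<^sub>m 2 2" using inj[OF Uc Wc(1) 1 2] h0c by (simp add: W_def)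
    then have "?V = 0\<^sub>m 2 2" using mult_cancel_GL[OF h0, of ?V 2 "0\<^sub>m 2 2"] by simp
    then have "?V $$ (1, 0) = 0\<^sub>m 2 2 $$ (1, 0)" by (rule arg_cong)
    then show False by simp
  qed
  \<comment> \<open>Rescaling \<open>K\<close> by \<open>y2\<close> makes the first basis vector \<open>(x - c) / y2\<close>; then the columns of \<open>h1\<close> restore \<open>x - c\<close> and
    subtract \<open>y1 (x - c) / y2\<close> from the second vector.\<close>
  define e where "e = (y0 + c * y1) / y2"
  define h1 where "h1 = mat22 y2 (- y1) 0 1"
  have h1: "h1 \<in> carrier (GL 2)" unfolding h1_def using y2 by (intro mat22_GL) simp
  define h where "h = h0 * h1"
  have h: "h \<in> carrier (GL 2)" unfolding h_def using GL_m_closed[OF h0 h1] .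
  have hc: "h \<in> carrier_mat 2 2" "dim_row h = 2" "dim_col h = 2" "dim_row h1 = 2" "dim_col h1 = 2"
    using GL_carrier[OF h] GL_carrier[OF h1] by auto
  define K' where "K' = y2 \<cdot>\<^sub>m K"
  have K': "K' \<in> carrier (GL 3)"
    unfolding K'_def using y2 K by (intro smult_GL) (auto simp: dvd_field_iff)
  have K'c: "K' \<in> carrier_mat 3 3" "dim_row K' = 3" "dim_col K' = 3" using GL_carrier[OF K'] by auto
  have AK': "A * K' = K' * companion"
    unfolding K'_def using AK Kc by (simp add: mat_distrib_dim)
  have Yh1: "Y * h1 = y2 \<cdot>\<^sub>m lead_cols e"
    by (rule eq_matI) (use y2 in \<open>auto simp del: index_mult_mat(1)
        simp: lessThan_small mult_entry_2 Y_def h1_def lead_cols_def e_def field_simps\<close>)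
  have Ph: "P * h = K' * lead_cols e"
  proof -
    have "P * h = K * (Y * h1)"
      using dim h0c hc Kc Y by (simp add: h_def KY[unfolded P1_def] del: assoc_mult_mat flip: mat_assoc_dim)
    then show ?thesis using Kc by (simp add: Yh1 K'_def mat_distrib_dim)
  qed
  have lh: "l * h = lastrow"
  proof -
    have "l * h = lastrow * h1"
      using dim h0c hc by (simp add: h_def lh0 del: assoc_mult_mat flip: mat_assoc_dim)
    also have "\<dots> = lastrow"
      by (rule eq_matI) (auto simp del: index_mult_mat(1) simp: lessThan_small mult_entry_2 lastrow_def h1_def)
    finally show ?thesis .
  qed
  \<comment> \<open>The \<open>X\<close> for which the last two columns of \<open>x * shear h X\<close> are those of the frame.\<close>
  define X where "X = inv\<^bsub>GL 2\<^esub> h * a * h - Be e"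
  note hi = GL_inv[OF h]
  have Xc: "X \<in> carrier_mat 2 2" unfolding X_def by (intro carrier_matI) simp_all
  have hX: "h * X = a * h - h * Be e"
  proof -
    have "h * (inv\<^bsub>GL 2\<^esub> h * (a * h)) = a * h"
      using hi hc a by (simp del: assoc_mult_mat flip: mat_assoc_dim)
    then show ?thesis unfolding X_def using hi hc dim by (simp add: mat_distrib_dim mat_assoc_dim)
  qed
  have "x * shear h X = four_block_mat (P * h + R * 0\<^sub>m 2 2) (P * (h * X) + R * h) (l * h + r * 0\<^sub>m 2 2) (l * (h * X) + r * h)"
    unfolding xb shear_def using c hc Xc by (intro mult_four_block_mat) auto
  also have "\<dots> = frame K' e"
  proof -
    have "P * (h * X) + R * h = A * (P * h) - P * h * Be e"
      unfolding hX R using dim hc by (simp add: mat_distrib_dim mat_assoc_dim) (auto intro!: eq_matI)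
    moreover have "l * (h * X) + r * h = c \<cdot>\<^sub>m (l * h) - l * h * Be e"
      unfolding hX r using dim hc by (simp add: mat_distrib_dim mat_assoc_dim) (auto intro!: eq_matI)
    ultimately show ?thesis
      unfolding frame_def using c right_add_zero_mat[OF mult_carrier_mat[OF K'c(1) lead_cols_simps(1)]]
        right_add_zero_mat[OF lead_cols_simps(4)] by (simp add: Ph lh)
  qed
  finally have xs: "x * shear h X = frame K' e" .
  have sc: "shear h X \<in> carrier_mat 4 4" using hc by simp
  have tc: "tower (Be e) (be e) \<in> carrier_mat 4 4" by simp
  have C0c: "C0 \<in> carrier_mat 4 4"
    using four_block_carrier_mat[of A 3 3 "c \<cdot>\<^sub>m 1\<^sub>m 1" 1 1] by simp
  have "x * (?C * shear h X) = C0 * (x * shear h X)"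
    using assoc_mult_mat[OF xc Cc sc] assoc_mult_mat[OF C0c xc sc] eq by simp
  also have "\<dots> = x * (shear h X * tower (Be e) (be e))"
    unfolding xs frame_tower[OF K'c(1) AK'] using assoc_mult_mat[OF xc sc tc] xs by simp
  finally have "?C * shear h X = shear h X * tower (Be e) (be e)"
    using mult_cancel_GL[OF x mult_carrier_mat[OF Cc sc] mult_carrier_mat[OF sc tc]] by simp
  then show ?thesis using h Xc by blast
qed

text \<open>The regular matrices \<open>B\<close> of trace \<open>t + c\<close> are up to conjugacy the \<open>Be e\<close>, and for each of them there is
  just one \<open>b\<close>, up to the centralizer of \<open>B\<close>, for which \<open>tower B b\<close> is similar to \<open>C0\<close>. The parameter is \<open>e = s - det B\<close>, as \<open>det (Be e) = s - e\<close>.\<close>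

theorem tower_classification:
  assumes reps: "class_representatives {B \<in> carrier_mat 2 2. regular_mat B \<and> mat_trace B = t + c} \<B>"
  obtains b \<Gamma> where
    "\<And>B. B \<in> \<B> \<Longrightarrow> b B \<in> carrier_mat 2 2"
    "\<And>B. B \<in> \<B> \<Longrightarrow> \<Gamma> B \<in> carrier (GL 4)"
    "\<And>B. B \<in> \<B> \<Longrightarrow> C0 * \<Gamma> B = \<Gamma> B * tower B (b B)"
    "\<And>x a b' d. x \<in> carrier (GL 4) \<Longrightarrow> a \<in> carrier_mat 2 2 \<Longrightarrow> b' \<in> carrier_mat 2 2 \<Longrightarrow> d \<in> carrier_mat 2 2 \<Longrightarrow>
      C0 * x = x * four_block_mat a b' (1\<^sub>m 2) d \<Longrightarrow>
      \<exists>B\<in>\<B>. \<exists>g\<in>carrier (GL 2). \<exists>X\<in>carrier_mat 2 2.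
        four_block_mat a b' (1\<^sub>m 2) d * shear g X = shear g X * tower B (b B)"
    "\<And>B B' g X. B \<in> \<B> \<Longrightarrow> B' \<in> \<B> \<Longrightarrow> g \<in> carrier (GL 2) \<Longrightarrow> X \<in> carrier_mat 2 2 \<Longrightarrow>
      tower B (b B) * shear g X = shear g X * tower B' (b B') \<Longrightarrow>
      B = B' \<and> X = 0\<^sub>m 2 2 \<and> (\<exists>z. g = z \<cdot>\<^sub>m 1\<^sub>m 2)"
proof -
  define E where "E B = s - det B" for B :: "'k mat"
  have B: "B \<in> carrier_mat 2 2" "regular_mat B" "mat_trace B = t + c" if "B \<in> \<B>" for B
    using reps that by (auto simp: class_representatives_def)
  have Be: "Be (E B) = mat22 0 (- det B) 1 (mat_trace B)" if "B \<in> \<B>" for B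
    using B[OF that] by (simp add: Be_def E_def add.commute)
  have "\<forall>B\<in>\<B>. \<exists>h. h \<in> carrier (GL 2) \<and> B * h = h * Be (E B)"
    using regular_mat_2_companion B Be by metis
  then obtain h where h: "\<And>B. B \<in> \<B> \<Longrightarrow> h B \<in> carrier (GL 2)" "\<And>B. B \<in> \<B> \<Longrightarrow> B * h B = h B * Be (E B)"
    by metis
  define k where "k B = inv\<^bsub>GL 2\<^esub> (h B)" for B
  have hc: "h B \<in> carrier_mat 2 2" and kc: "k B \<in> carrier_mat 2 2" and k: "k B \<in> carrier (GL 2)"
    and kh: "k B * h B = 1\<^sub>m 2" and hk: "h B * k B = 1\<^sub>m 2" if "B \<in> \<B>" for B
    using h(1)[OF that] GL_carrier GL_inv[OF h(1)[OF that]] by (auto simp: k_def)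
  define b where "b B = h B * be (E B) * k B" for B
  have bc: "b B \<in> carrier_mat 2 2" if "B \<in> \<B>" for B
    unfolding b_def using hc[OF that] kc[OF that] by auto
  have Bek: "Be (E B) * k B = k B * B" and bek: "be (E B) * k B = k B * b B" if "B \<in> \<B>" for B
  proof -
    note c = hc[OF that] kc[OF that] B(1)[OF that]
    have "k B * B = k B * (B * (h B * k B))"
      using c hk[OF that] by simp
    also have "\<dots> = k B * ((B * h B) * k B)" using c by simp
    also have "\<dots> = (k B * h B) * (Be (E B) * k B)"
      unfolding h(2)[OF that] using c by (simp add: mat_assoc_dim)
    finally show "Be (E B) * k B = k B * B" using c kh[OF that] by simp
    have "k B * b B = (k B * h B) * (be (E B) * k B)"
      unfolding b_def using c by (simp add: mat_assoc_dim)
    then show "be (E B) * k B = k B * b B" using c kh[OF that] by simp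
  qed
  have tw: "tower (Be (E B)) (be (E B)) * shear (k B) (0\<^sub>m 2 2) = shear (k B) (0\<^sub>m 2 2) * tower B (b B)" if "B \<in> \<B>" for B
    using tower_shear_iff[OF k[OF that]] Bek[OF that] bek[OF that] B(1)[OF that] bc[OF that] by simp
  have C0c: "C0 \<in> carrier_mat 4 4"
    using four_block_carrier_mat[of A 3 3 "c \<cdot>\<^sub>m 1\<^sub>m 1" 1 1] by simp
  define v where "v = (unit_vec 3 0 :: 'k vec)"
  have v: "v \<in> carrier_vec 3" "v \<noteq> 0\<^sub>v 3" by (auto simp: v_def)
  define K where "K = krylov v"
  have K: "K \<in> carrier (GL 3)" "A * K = K * companion" "K \<in> carrier_mat 3 3"
    unfolding K_def using krylov_GL krylov_companion v by auto
  define \<Gamma> where "\<Gamma> B = frame K (E B) * shear (k B) (0\<^sub>m 2 2)" for B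
  have F: "frame K e \<in> carrier (GL 4)" "frame K e \<in> carrier_mat 4 4" for e
    using frame_GL[OF K(1,2)] GL_carrier by blast+
  show thesis
  proof (rule that[of b \<Gamma>])
    fix B assume BB: "B \<in> \<B>"
    have sh: "shear (k B) (0\<^sub>m 2 2) \<in> carrier (GL 4)" "shear (k B) (0\<^sub>m 2 2) \<in> carrier_mat 4 4"
      using shear_GL[OF k[OF BB], of "0\<^sub>m 2 2"] GL_carrier by auto
    show "b B \<in> carrier_mat 2 2" by (rule bc[OF BB])
    show "\<Gamma> B \<in> carrier (GL 4)" unfolding \<Gamma>_def using F(1) sh(1) by (rule GL_m_closed)
    let ?T = "tower (Be (E B)) (be (E B))"
    have T: "?T \<in> carrier_mat 4 4" "tower B (b B) \<in> carrier_mat 4 4" using B(1)[OF BB] by auto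
    have "C0 * \<Gamma> B = (C0 * frame K (E B)) * shear (k B) (0\<^sub>m 2 2)"
      unfolding \<Gamma>_def by (rule assoc_mult_mat[OF C0c F(2) sh(2), symmetric])
    also have "\<dots> = frame K (E B) * (?T * shear (k B) (0\<^sub>m 2 2))"
      unfolding frame_tower[OF K(3,2)] by (rule assoc_mult_mat[OF F(2) T(1) sh(2)])
    also have "\<dots> = \<Gamma> B * tower B (b B)"
      unfolding tw[OF BB] \<Gamma>_def by (rule assoc_mult_mat[OF F(2) sh(2) T(2), symmetric])
    finally show "C0 * \<Gamma> B = \<Gamma> B * tower B (b B)" .
  next
    fix x a b' d :: "'k mat"
    let ?C = "four_block_mat a b' (1\<^sub>m 2) d"
    assume x: "x \<in> carrier (GL 4)" and abd: "a \<in> carrier_mat 2 2" "b' \<in> carrier_mat 2 2" "d \<in> carrier_mat 2 2"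
      and eq: "C0 * x = x * ?C"
    obtain e g X where g: "g \<in> carrier (GL 2)" "X \<in> carrier_mat 2 2"
        and C: "?C * shear g X = shear g X * tower (Be e) (be e)"
      using normal_form[OF x abd eq] by blast
    have Bee: "Be e \<in> carrier_mat 2 2" "mat_trace (Be e) = t + c" "det (Be e) = s - e"
      by (simp_all add: mat_trace_2 Be_def mat22_det add.commute)
    have "regular_mat (Be e)"
      unfolding regular_mat_2_iff[OF Bee(1)]
    proof (intro allI notI)
      fix z assume "Be e = z \<cdot>\<^sub>m 1\<^sub>m 2"
      then have "Be e $$ (1, 0) = (z \<cdot>\<^sub>m 1\<^sub>m 2) $$ (1, 0)" by simp
      then show False by (simp add: Be_def)
    qed
    then obtain B where BB: "B \<in> \<B>" and sim: "similar_mat (Be e) B"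
      using reps Bee unfolding class_representatives_def by blast
    have "det (Be e) = det B"
      using char_poly_similar[OF sim] char_poly_2[OF Bee(1)] char_poly_2[OF B(1)[OF BB]] by simp
    then have e: "e = E B" using Bee(3) by (simp add: E_def algebra_simps)
    have Cc: "?C \<in> carrier_mat 4 4" using four_block_carrier_mat[OF abd(1,3)] by simp
    have gc: "g \<in> carrier_mat 2 2" using GL_carrier[OF g(1)] .
    let ?k = "shear (k B) (0\<^sub>m 2 2)" and ?T = "tower (Be e) (be e)"
    have sc: "shear g X \<in> carrier_mat 4 4" "?k \<in> carrier_mat 4 4" using gc kc[OF BB] by auto
    have T: "?T \<in> carrier_mat 4 4" "tower B (b B) \<in> carrier_mat 4 4" using B(1)[OF BB] by auto
    have "?C * (shear g X * ?k) = shear g X * ?T * ?k"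
      unfolding C[symmetric] by (rule assoc_mult_mat[OF Cc sc, symmetric])
    also have "\<dots> = shear g X * (?T * ?k)" by (rule assoc_mult_mat[OF sc(1) T(1) sc(2)])
    also have "\<dots> = shear g X * ?k * tower B (b B)"
      unfolding e tw[OF BB] by (rule assoc_mult_mat[OF sc T(2), symmetric])
    finally have "?C * (shear g X * ?k) = (shear g X * ?k) * tower B (b B)" .
    then have "?C * shear (g * k B) (inv\<^bsub>GL 2\<^esub> (k B) * X * k B)
        = shear (g * k B) (inv\<^bsub>GL 2\<^esub> (k B) * X * k B) * tower B (b B)"
      unfolding shear_mult_diag[OF gc k[OF BB] g(2)] .
    moreover have "inv\<^bsub>GL 2\<^esub> (k B) * X * k B \<in> carrier_mat 2 2"
      using GL_inv(4)[OF k[OF BB]] g(2) kc[OF BB] by auto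
    ultimately show "\<exists>B\<in>\<B>. \<exists>g\<in>carrier (GL 2). \<exists>X\<in>carrier_mat 2 2. ?C * shear g X = shear g X * tower B (b B)"
      using BB GL_m_closed[OF g(1) k[OF BB]] by blast
  next
    fix B B' g X :: "'k mat"
    assume BB: "B \<in> \<B>" "B' \<in> \<B>" and g: "g \<in> carrier (GL 2)" and X: "X \<in> carrier_mat 2 2"
      and eq: "tower B (b B) * shear g X = shear g X * tower B' (b B')"
    have e: "X = 0\<^sub>m 2 2" "B * g = g * B'" "b B * g = g * b B'"
      using eq tower_shear_iff[OF g B(1)[OF BB(1)] bc[OF BB(1)] B(1)[OF BB(2)] bc[OF BB(2)] X] by auto
    note gi = GL_inv[OF g] GL_carrier[OF g] and Bc = B(1)[OF BB(1)] B(1)[OF BB(2)]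
    have "g * B' * inv\<^bsub>GL 2\<^esub> g = B * (g * inv\<^bsub>GL 2\<^esub> g)"
      unfolding e(2)[symmetric] using gi Bc by (simp add: mat_assoc_dim)
    then have "B = g * B' * inv\<^bsub>GL 2\<^esub> g" using gi(3) Bc by simp
    then have "similar_mat B B'"
      using gi Bc by (intro similar_matI[of B B' g "inv\<^bsub>GL 2\<^esub> g" 2]) auto
    moreover have "similar_mat B B" using Bc(1) similar_mat_refl by blast
    ultimately have BB': "B = B'"
      using reps BB unfolding class_representatives_def by blast
    define u where "u = k B * g * h B"
    have uc: "u \<in> carrier_mat 2 2" unfolding u_def using kc[OF BB(1)] hc[OF BB(1)] gi(5) by auto
    note dims = carrier_matD[OF kc[OF BB(1)]] carrier_matD[OF hc[OF BB(1)]] carrier_matD[OF gi(5)]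
      carrier_matD[OF Bc(1)] carrier_matD[OF bc[OF BB(1)]]
    have conj: "x * u = u * x" if x: "x \<in> carrier_mat 2 2" and y: "y \<in> carrier_mat 2 2"
      and xy: "x * k B = k B * y" and yg: "y * g = g * y" for x y
    proof -
      have yh: "y * h B = h B * x"
      proof -
        have "h B * x = h B * (x * (k B * h B))" using x kh[OF BB(1)] hc[OF BB(1)] by simp
        also have "\<dots> = h B * ((x * k B) * h B)"
          using carrier_matD[OF x] dims by (simp add: mat_assoc_dim)
        also have "\<dots> = (h B * k B) * (y * h B)"
          unfolding xy using carrier_matD[OF y] dims by (simp add: mat_assoc_dim)
        finally show ?thesis using y hc[OF BB(1)] hk[OF BB(1)] by simp
      qed
      have "x * u = (x * k B) * (g * h B)"
        unfolding u_def using carrier_matD[OF x] dims by (simp add: mat_assoc_dim)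
      also have "\<dots> = k B * (y * g) * h B"
        unfolding xy using carrier_matD[OF y] dims by (simp add: mat_assoc_dim)
      also have "\<dots> = k B * g * (y * h B)"
        unfolding yg using x y dims by (simp add: mat_assoc_dim)
      also have "\<dots> = u * x"
        unfolding yh u_def using x y dims by (simp add: mat_assoc_dim)
      finally show ?thesis .
    qed
    have "Be (E B) * u = u * Be (E B)" "be (E B) * u = u * be (E B)"
      using conj[OF _ Bc(1) Bek[OF BB(1)]] conj[OF _ bc[OF BB(1)] bek[OF BB(1)]] e BB' by simp_all
    then obtain z where z: "u = z \<cdot>\<^sub>m 1\<^sub>m 2" using commutant_scalar[OF uc] by blast
    have "g = h B * u * k B"
    proof -
      have "h B * u * k B = (h B * k B) * g * (h B * k B)"
        unfolding u_def using dims by (simp add: mat_assoc_dim)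
      then show ?thesis using hk[OF BB(1)] gi(5) by simp
    qed
    also have "\<dots> = z \<cdot>\<^sub>m (h B * k B)"
      unfolding z using dims by (simp add: mat_distrib_dim)
    finally show "B = B' \<and> X = 0\<^sub>m 2 2 \<and> (\<exists>z. g = z \<cdot>\<^sub>m 1\<^sub>m 2)"
      using BB' e(1) hk[OF BB(1)] by auto
  qed
qed

end

section \<open>Congruence subgroups over a ring of length two\<close>

text \<open>A ring whose maximal ideal \<open>w R\<close> is isomorphic to the residue field: the annihilator condition makes \<open>x \<mapsto> w x\<close> an isomorphism of the
  residue field with \<open>w R\<close>, through which \<open>\<psi>0\<close> restricts to a nontrivial character \<open>psi\<close> of the residue field.\<close>

locale length_two =
  fixes w :: "'r::{comm_ring_1,finite}" and res :: "'r \<Rightarrow> 'k::{field,finite}" and \<psi>0 :: "'r \<Rightarrow> complex"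
  assumes res_1: "res 1 = 1" and res_plus: "res (x + y) = res x + res y" and res_times: "res (x * y) = res x * res y"
    and res_surj: "\<exists>y. res y = z"
    and annihilator: "w * x = 0 \<longleftrightarrow> res x = 0" and kernel: "res x = 0 \<longleftrightarrow> (\<exists>y. x = w * y)"
    and \<psi>0: "additive_character \<psi>0" and \<psi>0_nontrivial: "\<exists>x. \<psi>0 (w * x) \<noteq> 1"
begin

sublocale res: comm_ring_hom res
proof
  show "res 0 = 0" using annihilator[of 0] by simp
qed (rule res_1 res_plus res_times)+

abbreviation "red \<equiv> map_mat res"
abbreviation "psi \<equiv> psi_res \<psi>0 w res"

lemma res_w: "res w = 0" using kernel[of w] by (metis mult.right_neutral)

lemma res_eq_iff: "res x = res y \<longleftrightarrow> w * x = w * y"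
  using annihilator[of "x - y"] by (auto simp: res.hom_minus algebra_simps)

lemma psi_of_res: "psi (res y) = \<psi>0 (w * y)"
proof -
  have "res (SOME z. res z = res y) = res y" by (rule someI[of _ y]) simp
  then show ?thesis unfolding psi_res_def using res_eq_iff by auto
qed

lemma psi_add: "psi (x + y) = psi x * psi y"
proof -
  obtain x' y' where "x = res x'" "y = res y'" using res_surj by metis
  then show ?thesis
    using \<psi>0 psi_of_res[of "x' + y'"] psi_of_res[of x'] psi_of_res[of y']
    by (simp add: res_plus distrib_left additive_character_def)
qed

lemma psi_nz: "psi x \<noteq> 0"
proof -
  obtain y where "x = res y" using res_surj by metis
  then show ?thesis using \<psi>0 psi_of_res[of y] by (simp add: additive_character_def)
qed

lemma psi_0: "psi 0 = 1"
  using psi_add[of 0 0] psi_nz[of 0] by simp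

lemma psi_eq_1_iff: "(\<forall>x. psi (a * x) = 1) \<longleftrightarrow> a = 0"
proof
  assume *: "\<forall>x. psi (a * x) = 1"
  obtain y where y: "\<psi>0 (w * y) \<noteq> 1" using \<psi>0_nontrivial by blast
  show "a = 0"
  proof (rule ccontr)
    assume "a \<noteq> 0"
    then have "psi (res y) = 1" using *[rule_format, of "res y / a"] by simp
    then show False using y psi_of_res[of y] by simp
  qed
qed (simp add: psi_0)

lemma psi_eqD: "(\<And>x. psi (a * x) = psi (b * x)) \<Longrightarrow> a = b"
proof -
  assume *: "\<And>x. psi (a * x) = psi (b * x)"
  have "psi ((a - b) * x) = 1" for x
    using psi_add[of "(a - b) * x" "b * x"] * psi_nz[of "b * x"] by (simp add: algebra_simps)
  then show "a = b" using psi_eq_1_iff[of "a - b"] by simp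
qed

text \<open>The pairing \<open>(B, X) \<mapsto> psi (tr (B X))\<close> is perfect, as one sees on matrices \<open>X\<close> with one nonzero entry.\<close>

lemma psi_trace_eqD:
  assumes B: "B \<in> carrier_mat n m" and C: "C \<in> carrier_mat n m"
    and eq: "\<And>X. X \<in> carrier_mat m n \<Longrightarrow> psi (mat_trace (B * X)) = psi (mat_trace (C * X))"
  shows "B = C"
proof (rule eq_matI)
  fix i j assume "i < dim_row C" "j < dim_col C"
  then have ij: "i < n" "j < m" using C by auto
  show "B $$ (i, j) = C $$ (i, j)"
  proof (rule psi_eqD)
    fix x :: 'k
    let ?X = "mat m n (\<lambda>(k, l). if k = j \<and> l = i then x else 0)"
    have "mat_trace (D * ?X) = D $$ (i, j) * x" if D: "D \<in> carrier_mat n m" for D :: "'k mat"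
    proof -
      have "mat_trace (D * ?X) = (\<Sum>k<n. \<Sum>l<m. D $$ (k, l) * (if l = j \<and> k = i then x else 0))"
        using D by (simp add: mat_trace_def scalar_prod_def atLeast0LessThan)
      also have "\<dots> = (\<Sum>k<n. if k = i then D $$ (i, j) * x else 0)"
      proof (intro sum.cong refl)
        fix k
        have "(\<Sum>l<m. D $$ (k, l) * (if l = j \<and> k = i then x else 0))
            = (\<Sum>l<m. if l = j then D $$ (k, l) * (if k = i then x else 0) else 0)"
          by (intro sum.cong refl) simp
        then show "(\<Sum>l<m. D $$ (k, l) * (if l = j \<and> k = i then x else 0)) = (if k = i then D $$ (i, j) * x else 0)"
          using ij by simp
      qed
      also have "\<dots> = D $$ (i, j) * x" using ij by simp
      finally show ?thesis .
    qed
    then show "psi (B $$ (i, j) * x) = psi (C $$ (i, j) * x)"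
      using eq[of ?X] B C by simp
  qed
qed (use B C in auto)

lemma red_carrier: "red A \<in> carrier_mat n m \<longleftrightarrow> A \<in> carrier_mat n m"
  by auto

lemma lift_mat:
  assumes "B \<in> carrier_mat n m"
  obtains A where "A \<in> carrier_mat n m" "red A = B"
proof
  let ?A = "map_mat (\<lambda>x. SOME y. res y = x) B"
  show "?A \<in> carrier_mat n m" using assms by simp
  have "res (SOME y. res y = x) = x" for x using res_surj[of x] by (rule someI_ex)
  then show "red ?A = B" by (auto intro!: eq_matI)
qed

lemma J1_iff: "g \<in> J1 w n \<longleftrightarrow> g \<in> carrier_mat n n \<and> red g = 1\<^sub>m n"
proof
  assume "g \<in> J1 w n"
  then obtain X where X: "X \<in> carrier_mat n n" "g = 1\<^sub>m n + w \<cdot>\<^sub>m X" by (auto simp: J1_def)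
  then show "g \<in> carrier_mat n n \<and> red g = 1\<^sub>m n"
    by (auto intro!: eq_matI simp: res_plus res_times res_w res_1 res.hom_zero)
next
  assume g: "g \<in> carrier_mat n n \<and> red g = 1\<^sub>m n"
  have "\<exists>y. g $$ (i, j) = (1\<^sub>m n) $$ (i, j) + w * y" if "i < n" "j < n" for i j
  proof -
    have "res (g $$ (i, j)) = (1\<^sub>m n) $$ (i, j)" using g that by (metis carrier_matD index_map_mat(1))
    then have "res (g $$ (i, j) - (1\<^sub>m n) $$ (i, j)) = 0"
      using that by (simp add: res.hom_minus res_1 res.hom_zero)
    then obtain y where "g $$ (i, j) - (1\<^sub>m n) $$ (i, j) = w * y" using kernel by blast
    then show ?thesis by (metis diff_eq_eq add.commute)
  qed
  then obtain y where y: "\<And>i j. i < n \<Longrightarrow> j < n \<Longrightarrow> g $$ (i, j) = (1\<^sub>m n) $$ (i, j) + w * y i j" by metis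
  have "g = 1\<^sub>m n + w \<cdot>\<^sub>m mat n n (\<lambda>(i, j). y i j)"
    using g y by (auto intro!: eq_matI)
  then show "g \<in> J1 w n" unfolding J1_def by (auto intro!: exI[of _ "mat n n (\<lambda>(i, j). y i j)"])
qed

lemma J1_E:
  assumes "g \<in> J1 w n"
  obtains X where "X \<in> carrier_mat n n" "g = 1\<^sub>m n + w \<cdot>\<^sub>m X"
  using assms by (auto simp: J1_def)

lemma J1_I: "X \<in> carrier_mat n n \<Longrightarrow> 1\<^sub>m n + w \<cdot>\<^sub>m X \<in> J1 w n"
  by (auto simp: J1_def)

lemma J1_mult: "X \<in> carrier_mat n n \<Longrightarrow> Y \<in> carrier_mat n n \<Longrightarrow>
    (1\<^sub>m n + w \<cdot>\<^sub>m X) * (1\<^sub>m n + w \<cdot>\<^sub>m Y) = 1\<^sub>m n + w \<cdot>\<^sub>m (X + Y)"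
proof -
  assume X: "X \<in> carrier_mat n n" and Y: "Y \<in> carrier_mat n n"
  have w2: "w * w = 0" using annihilator res_w by blast
  have "(w \<cdot>\<^sub>m X) * (w \<cdot>\<^sub>m Y) = (w * w) \<cdot>\<^sub>m (X * Y)" using X Y by (auto intro!: eq_matI simp: mult_ac)
  also have "\<dots> = 0\<^sub>m n n" using X Y by (auto intro!: eq_matI simp: w2)
  finally have ww: "(w \<cdot>\<^sub>m X) * (w \<cdot>\<^sub>m Y) = 0\<^sub>m n n" .
  have "(1\<^sub>m n + w \<cdot>\<^sub>m X) * (1\<^sub>m n + w \<cdot>\<^sub>m Y)
      = (1\<^sub>m n + w \<cdot>\<^sub>m X) * 1\<^sub>m n + (1\<^sub>m n * (w \<cdot>\<^sub>m Y) + (w \<cdot>\<^sub>m X) * (w \<cdot>\<^sub>m Y))"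
    using X Y carrier_matD[OF X] carrier_matD[OF Y] by (subst mat_distrib_dim(3)) (auto simp: mat_distrib_dim(1))
  also have "\<dots> = 1\<^sub>m n + w \<cdot>\<^sub>m (X + Y)"
    unfolding ww using X Y by (auto intro!: eq_matI simp: algebra_simps)
  finally show ?thesis .
qed

lemma J1_subset_GL: "J1 w n \<subseteq> carrier (GL n)"
proof
  fix g assume "g \<in> J1 w n"
  then obtain X where X: "X \<in> carrier_mat n n" "g = 1\<^sub>m n + w \<cdot>\<^sub>m X" by (rule J1_E)
  have "X + - X = 0\<^sub>m n n" "- X + X = 0\<^sub>m n n" using X by auto
  then show "g \<in> carrier (GL n)"
    unfolding X(2) using X J1_mult[of X n "- X"] J1_mult[of "- X" n X]
    by (intro GL_I[of _ _ "1\<^sub>m n + w \<cdot>\<^sub>m - X"]) auto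
qed

lemma red_mult: "A \<in> carrier_mat n m \<Longrightarrow> B \<in> carrier_mat m l \<Longrightarrow> red (A * B) = red A * red B"
  by (rule res.mat_hom_mult)

lemma red_GL: "g \<in> carrier (GL n) \<Longrightarrow> red g \<in> carrier (GL n)"
  using GL_inv[of g n] GL_carrier[of g n] red_mult[of g n n "inv\<^bsub>GL n\<^esub> g" n] red_mult[of "inv\<^bsub>GL n\<^esub> g" n n g n]
  by (intro GL_I[of _ _ "red (inv\<^bsub>GL n\<^esub> g)"]) (auto simp: res.mat_hom_one)

lemma red_inv: "g \<in> carrier (GL n) \<Longrightarrow> red (inv\<^bsub>GL n\<^esub> g) = inv\<^bsub>GL n\<^esub> (red g)"
  using GL_inv[of g n] GL_carrier[of g n] red_mult[of "inv\<^bsub>GL n\<^esub> g" n n g n]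
  by (intro GL_inv_eq[symmetric] red_GL) (auto simp: res.mat_hom_one)

text \<open>Units lift, because an element that reduces to \<open>1\<close> is invertible.\<close>

lemma GL_of_red:
  assumes g: "g \<in> carrier_mat n n" and r: "red g \<in> carrier (GL n)"
  shows "g \<in> carrier (GL n)"
proof -
  obtain h where h: "h \<in> carrier_mat n n" "red h = inv\<^bsub>GL n\<^esub> (red g)"
    using lift_mat GL_inv(4)[OF r] by blast
  have "g * h \<in> J1 w n" "h * g \<in> J1 w n"
    using g h red_mult[OF g h(1)] red_mult[OF h(1) g] GL_inv[OF r] by (auto simp: J1_iff)
  then have u: "g * h \<in> carrier (GL n)" "h * g \<in> carrier (GL n)" using J1_subset_GL by blast+
  let ?u = "inv\<^bsub>GL n\<^esub> (g * h)" and ?v = "inv\<^bsub>GL n\<^esub> (h * g)"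
  have c: "?u \<in> carrier_mat n n" "?v \<in> carrier_mat n n" using GL_inv(4) u by blast+
  have R: "g * (h * ?u) = 1\<^sub>m n" using GL_inv(3)[OF u(1)] g h c by (simp add: assoc_mult_mat[of g n n h n ?u n, symmetric] del: assoc_mult_mat)
  have L: "(?v * h) * g = 1\<^sub>m n" using GL_inv(2)[OF u(2)] g h c by simp
  have hu: "h * ?u \<in> carrier_mat n n" and vh: "?v * h \<in> carrier_mat n n" using h c by auto
  have "?v * h = (?v * h) * (g * (h * ?u))" unfolding R using h by simp
  also have "\<dots> = ((?v * h) * g) * (h * ?u)" by (rule assoc_mult_mat[OF vh g hu, symmetric])
  also have "\<dots> = h * ?u" unfolding L using h by simp
  finally have "?v * h = h * ?u" .
  then show ?thesis using L R g hu by (intro GL_I[of g n "h * ?u"]) auto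
qed

lemma lift_GL:
  assumes "g \<in> carrier (GL n)"
  obtains h where "h \<in> carrier (GL n)" "red h = g"
  using lift_mat[OF GL_carrier[OF assms]] GL_of_red assms by metis

lemma J1_normal: "J1 w n \<lhd> GL n"
proof -
  have "subgroup (J1 w n) (GL n)"
  proof (rule GL.subgroupI)
    show "J1 w n \<noteq> {}" using J1_iff[of "1\<^sub>m n" n] by (auto simp: res.mat_hom_one)
    show "inv\<^bsub>GL n\<^esub> g \<in> J1 w n" if g: "g \<in> J1 w n" for g
    proof -
      have gG: "g \<in> carrier (GL n)" using g J1_subset_GL by blast
      have "red (inv\<^bsub>GL n\<^esub> g) = inv\<^bsub>GL n\<^esub> (1\<^sub>m n)" using red_inv[OF gG] g J1_iff by auto
      also have "\<dots> = 1\<^sub>m n" by (rule GL_inv_eq[OF one_GL]) auto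
      finally show ?thesis using GL_inv(4)[OF gG] by (simp add: J1_iff)
    qed
    show "g \<otimes>\<^bsub>GL n\<^esub> h \<in> J1 w n" if "g \<in> J1 w n" "h \<in> J1 w n" for g h
      using that by (auto simp: J1_iff GL_mult red_mult)
  qed (rule J1_subset_GL)
  moreover have "g \<otimes>\<^bsub>GL n\<^esub> j \<otimes>\<^bsub>GL n\<^esub> inv\<^bsub>GL n\<^esub> g \<in> J1 w n"
    if g: "g \<in> carrier (GL n)" and j: "j \<in> J1 w n" for g j
  proof -
    have c: "g \<in> carrier_mat n n" "j \<in> carrier_mat n n" "inv\<^bsub>GL n\<^esub> g \<in> carrier_mat n n" "red j = 1\<^sub>m n"
      using GL_carrier[OF g] GL_inv(4)[OF g] j by (auto simp: J1_iff)
    have "red (g * j * inv\<^bsub>GL n\<^esub> g) = red (g * inv\<^bsub>GL n\<^esub> g)"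
      using c red_mult[OF mult_carrier_mat[OF c(1,2)] c(3)] red_mult[OF c(1,2)] red_mult[OF c(1,3)] by simp
    then show ?thesis using c GL_inv(3)[OF g] by (simp add: GL_mult J1_iff res.mat_hom_one)
  qed
  ultimately show ?thesis by (simp add: GL.normal_inv_iff)
qed

lemma phi_eq:
  assumes X: "X \<in> carrier_mat n n"
  shows "phi \<psi>0 w res n B (1\<^sub>m n + w \<cdot>\<^sub>m X) = psi (mat_trace (B * red X))"
proof -
  let ?Y = "SOME Y. Y \<in> carrier_mat n n \<and> 1\<^sub>m n + w \<cdot>\<^sub>m X = 1\<^sub>m n + w \<cdot>\<^sub>m Y"
  have "?Y \<in> carrier_mat n n \<and> 1\<^sub>m n + w \<cdot>\<^sub>m X = 1\<^sub>m n + w \<cdot>\<^sub>m ?Y"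
    by (rule someI[of _ X]) (use X in simp)
  then have Y: "?Y \<in> carrier_mat n n" and eq: "1\<^sub>m n + w \<cdot>\<^sub>m X = 1\<^sub>m n + w \<cdot>\<^sub>m ?Y" by auto
  have "red X = red ?Y"
  proof (rule eq_matI)
    fix i j assume "i < dim_row (red ?Y)" "j < dim_col (red ?Y)"
    then have ij: "i < n" "j < n" using Y by auto
    have "(1\<^sub>m n + w \<cdot>\<^sub>m X) $$ (i, j) = (1\<^sub>m n + w \<cdot>\<^sub>m ?Y) $$ (i, j)" using eq by simp
    then have "w * X $$ (i, j) = w * ?Y $$ (i, j)" using ij X Y by simp
    then show "red X $$ (i, j) = red ?Y $$ (i, j)" using ij X Y res_eq_iff by simp
  qed (use X Y in auto)
  then show ?thesis unfolding phi_def by simp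
qed

lemma phi_mult:
  assumes B: "B \<in> carrier_mat n n" and "g \<in> J1 w n" "h \<in> J1 w n"
  shows "phi \<psi>0 w res n B (g * h) = phi \<psi>0 w res n B g * phi \<psi>0 w res n B h"
proof -
  obtain X Y where X: "X \<in> carrier_mat n n" "g = 1\<^sub>m n + w \<cdot>\<^sub>m X" and Y: "Y \<in> carrier_mat n n" "h = 1\<^sub>m n + w \<cdot>\<^sub>m Y"
    using assms(2,3) J1_E by metis
  have "red (X + Y) = red X + red Y" using X Y by (auto intro!: eq_matI simp: res_plus)
  then show ?thesis
    unfolding X(2) Y(2) J1_mult[OF X(1) Y(1)] using X(1) Y(1) B
    by (simp add: phi_eq mult_add_distrib_mat[of _ n n _ n] mat_trace_add[of _ n] psi_add)
qed

lemma phi_nz: "j \<in> J1 w n \<Longrightarrow> phi \<psi>0 w res n B j \<noteq> 0"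
  unfolding phi_def by (rule psi_nz)

lemma J1_conj:
  assumes g: "g \<in> carrier (GL n)" and X: "X \<in> carrier_mat n n"
  shows "g * (1\<^sub>m n + w \<cdot>\<^sub>m X) * inv\<^bsub>GL n\<^esub> g = 1\<^sub>m n + w \<cdot>\<^sub>m (g * X * inv\<^bsub>GL n\<^esub> g)"
proof -
  note i = GL_inv[OF g] GL_carrier[OF g]
  have "g * (1\<^sub>m n + w \<cdot>\<^sub>m X) = g + w \<cdot>\<^sub>m (g * X)"
    using i X by (simp add: mult_add_distrib_mat[of _ n n _ n] mult_smult_distrib[of _ n n _ n])
  then show ?thesis
    using i X by (simp add: add_mult_distrib_mat[of _ n n _ _ n] mult_smult_assoc_mat[of _ n n _ n])
qed

text \<open>Conjugation carries \<open>\<phi>\<close> at \<open>B\<close> to \<open>\<phi>\<close> at a conjugate of \<open>B\<close>; stating this with an equation \<open>B g = g C\<close> avoids the inverse of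
  the reduction of \<open>g\<close>.\<close>

lemma phi_conj:
  assumes B: "B \<in> carrier_mat n n" and g: "g \<in> carrier (GL n)" and X: "X \<in> carrier_mat n n"
    and C: "C \<in> carrier_mat n n" and BC: "B * red g = red g * C"
  shows "phi \<psi>0 w res n B (g * (1\<^sub>m n + w \<cdot>\<^sub>m X) * inv\<^bsub>GL n\<^esub> g) = psi (mat_trace (C * red X))"
proof -
  note i = GL_inv[OF g] GL_carrier[OF g]
  let ?g = "red g" and ?h = "red (inv\<^bsub>GL n\<^esub> g)" and ?X = "red X"
  have c: "?g \<in> carrier_mat n n" "?h \<in> carrier_mat n n" "?X \<in> carrier_mat n n" using i X by auto
  have hg: "?h * ?g = 1\<^sub>m n" using red_mult[OF i(4,5)] i(2) by (simp add: res.mat_hom_one)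
  have "red (g * X * inv\<^bsub>GL n\<^esub> g) = ?g * ?X * ?h"
    using red_mult[OF mult_carrier_mat[OF i(5) X] i(4)] red_mult[OF i(5) X] by simp
  then have "phi \<psi>0 w res n B (g * (1\<^sub>m n + w \<cdot>\<^sub>m X) * inv\<^bsub>GL n\<^esub> g) = psi (mat_trace (B * (?g * ?X * ?h)))"
    unfolding J1_conj[OF g X] using i X by (subst phi_eq) auto
  also have "B * (?g * ?X * ?h) = (B * ?g) * ?X * ?h"
    using carrier_matD[OF B] c by (simp add: mat_assoc_dim carrier_matD)
  also have "\<dots> = ?g * (C * ?X) * ?h"
    unfolding BC using carrier_matD[OF C] c by (simp add: mat_assoc_dim carrier_matD)
  also have "mat_trace \<dots> = mat_trace (C * ?X)"
    by (rule mat_trace_conj[OF _ c(1,2) hg]) (use C c in auto)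
  finally show ?thesis .
qed

text \<open>As the trace form is nondegenerate, the stabilizer is the preimage of the centralizer of \<open>B\<close>.\<close>

lemma stabilizer_iff:
  assumes B: "B \<in> carrier_mat n n"
  shows "g \<in> stabilizer \<psi>0 w res n B \<longleftrightarrow> g \<in> carrier (GL n) \<and> B * red g = red g * B"
proof -
  have "(\<forall>j\<in>J1 w n. phi \<psi>0 w res n B (g * j * inv\<^bsub>GL n\<^esub> g) = phi \<psi>0 w res n B j) \<longleftrightarrow> B * red g = red g * B"
    if g: "g \<in> carrier (GL n)"
  proof
    assume *: "\<forall>j\<in>J1 w n. phi \<psi>0 w res n B (g * j * inv\<^bsub>GL n\<^esub> g) = phi \<psi>0 w res n B j"
    note r = red_GL[OF g]
    note i = GL_inv[OF r] GL_carrier[OF r]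
    let ?C = "inv\<^bsub>GL n\<^esub> (red g) * B * red g"
    have C: "?C \<in> carrier_mat n n" using i B by auto
    have BC: "B * red g = red g * ?C"
    proof -
      have "red g * ?C = (red g * inv\<^bsub>GL n\<^esub> (red g)) * (B * red g)"
        using carrier_matD[OF B] carrier_matD[OF i(4)] carrier_matD[OF i(5)] by (simp add: mat_assoc_dim)
      then show ?thesis using i B by simp
    qed
    have "?C = B"
    proof (rule psi_trace_eqD[OF C B])
      fix Y :: "'k mat" assume "Y \<in> carrier_mat n n"
      then obtain X where X: "X \<in> carrier_mat n n" "red X = Y" by (rule lift_mat)
      show "psi (mat_trace (?C * Y)) = psi (mat_trace (B * Y))"
        using phi_conj[OF B g X(1) C BC] phi_eq[OF X(1), of B] *[rule_format, OF J1_I[OF X(1)]] X(2) by simp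
    qed
    then show "B * red g = red g * B" using BC by simp
  next
    assume "B * red g = red g * B"
    then show "\<forall>j\<in>J1 w n. phi \<psi>0 w res n B (g * j * inv\<^bsub>GL n\<^esub> g) = phi \<psi>0 w res n B j"
      using phi_conj[OF B g _ B] phi_eq by (auto elim!: J1_E)
  qed
  then show ?thesis by (auto simp: stabilizer_def GL_mult)
qed

lemma stabilizer_subgroup:
  assumes B: "B \<in> carrier_mat n n"
  shows "subgroup (stabilizer \<psi>0 w res n B) (GL n)"
proof (rule GL.subgroupI)
  show "stabilizer \<psi>0 w res n B \<subseteq> carrier (GL n)" by (auto simp: stabilizer_def)
  have "1\<^sub>m n \<in> stabilizer \<psi>0 w res n B" using B one_GL by (simp add: stabilizer_iff res.mat_hom_one)
  then show "stabilizer \<psi>0 w res n B \<noteq> {}" by blast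
  show "g \<otimes>\<^bsub>GL n\<^esub> h \<in> stabilizer \<psi>0 w res n B"
    if "g \<in> stabilizer \<psi>0 w res n B" "h \<in> stabilizer \<psi>0 w res n B" for g h
  proof -
    have gh: "g \<in> carrier (GL n)" "h \<in> carrier (GL n)" "B * red g = red g * B" "B * red h = red h * B"
      using that B by (auto simp: stabilizer_iff)
    note d = carrier_matD[OF B] carrier_matD[OF GL_carrier[OF gh(1)]] carrier_matD[OF GL_carrier[OF gh(2)]]
    have "B * (red g * red h) = (B * red g) * red h" using d by (simp add: mat_assoc_dim)
    also have "\<dots> = red g * (B * red h)" unfolding gh(3) using d by (simp add: mat_assoc_dim)
    also have "\<dots> = red g * red h * B" unfolding gh(4) using d by (simp add: mat_assoc_dim)
    finally show ?thesis
      using gh B GL_m_closed[OF gh(1,2)] red_mult[OF GL_carrier[OF gh(1)] GL_carrier[OF gh(2)]]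
      by (simp add: stabilizer_iff GL_mult)
  qed
  show "inv\<^bsub>GL n\<^esub> g \<in> stabilizer \<psi>0 w res n B" if "g \<in> stabilizer \<psi>0 w res n B" for g
  proof -
    have g: "g \<in> carrier (GL n)" "B * red g = red g * B" using that B by (auto simp: stabilizer_iff)
    note r = red_GL[OF g(1)]
    note i = GL_inv[OF r] GL_carrier[OF r]
    let ?h = "inv\<^bsub>GL n\<^esub> (red g)"
    note d = carrier_matD[OF B] carrier_matD[OF i(4)] carrier_matD[OF i(5)]
    have "?h * B = ?h * (B * (red g * ?h))" using i B by simp
    also have "\<dots> = ?h * ((B * red g) * ?h)" using d by (simp add: mat_assoc_dim)
    also have "\<dots> = (?h * red g) * (B * ?h)" unfolding g(2) using d by (simp add: mat_assoc_dim)
    finally have "B * ?h = ?h * B" using i B by simp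
    then show ?thesis using g B red_inv[OF g(1)] by (simp add: stabilizer_iff)
  qed
qed

lemma smult_w_eq_0: "X \<in> carrier_mat n m \<Longrightarrow> w \<cdot>\<^sub>m X = 0\<^sub>m n m \<longleftrightarrow> red X = 0\<^sub>m n m"
proof -
  assume X: "X \<in> carrier_mat n m"
  have "w \<cdot>\<^sub>m X = 0\<^sub>m n m \<longleftrightarrow> (\<forall>i<n. \<forall>j<m. w * X $$ (i, j) = 0)"
    "red X = 0\<^sub>m n m \<longleftrightarrow> (\<forall>i<n. \<forall>j<m. res (X $$ (i, j)) = 0)"
    using X by (auto simp: mat_eq_iff)
  then show ?thesis using annihilator by simp
qed

lemma red_zero: "red (0\<^sub>m n m) = 0\<^sub>m n m"
  by (auto intro!: eq_matI simp: res.hom_zero)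

lemma unit_res: "res z \<noteq> 0 \<Longrightarrow> z dvd 1"
proof -
  assume nz: "res z \<noteq> 0"
  obtain y where y: "res y = 1 / res z" using res_surj by blast
  have "res (z * y - 1) = 0" using y nz by (simp add: res.hom_minus res_times res_1)
  then obtain a where a: "z * y = 1 + w * a" using kernel[of "z * y - 1"] by (auto simp: algebra_simps)
  have ww: "w * w = 0" using annihilator res_w by blast
  have "z * (y * (1 - w * a)) = (1 + w * a) * (1 - w * a)" using a by (simp add: mult.assoc[symmetric])
  also have "\<dots> = 1 - (w * w) * (a * a)" by (simp add: algebra_simps)
  finally show ?thesis unfolding ww by (metis dvdI diff_zero mult_zero_left)
qed

lemma unit_1_w: "1 + w * y dvd 1"
  by (rule unit_res) (simp add: res_plus res_times res_w res_1)

end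

section \<open>The induced representation as a monomial representation\<close>

lemma split_block_four_block_mat:
  assumes "A \<in> carrier_mat n m" "B \<in> carrier_mat n m'" "C \<in> carrier_mat n' m" "D \<in> carrier_mat n' m'"
  shows "split_block (four_block_mat A B C D) n m = (A, B, C, D)"
  unfolding split_block_def Let_def using assms by (auto intro!: eq_matI)

lemma GL_1_unit: "h \<in> carrier (GL 1) \<Longrightarrow> h $$ (0, 0) dvd 1" for h :: "'a::comm_ring_1 mat"
proof -
  assume h: "h \<in> carrier (GL 1)"
  have "(h * inv\<^bsub>GL 1\<^esub> h) $$ (0, 0) = 1" using GL_inv(3)[OF h] by simp
  then have "h $$ (0, 0) * (inv\<^bsub>GL 1\<^esub> h) $$ (0, 0) = 1"
    using GL_carrier[OF h] GL_inv(4)[OF h] by (simp add: scalar_prod_def)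
  then show ?thesis by (metis dvdI)
qed

definition levi_3 :: "'r::comm_ring_1 mat \<Rightarrow> 'r mat" where
  "levi_3 q = (case split_block q 3 3 of (h1, Y, L, h2) \<Rightarrow> h1)"

definition levi_1 :: "'r::comm_ring_1 mat \<Rightarrow> 'r" where
  "levi_1 q = (case split_block q 3 3 of (h1, Y, L, h2) \<Rightarrow> h2 $$ (0, 0))"

abbreviation q_mat :: "'r::comm_ring_1 mat \<Rightarrow> 'r mat \<Rightarrow> 'r mat \<Rightarrow> 'r mat" where
  "q_mat h1 Y h2 \<equiv> four_block_mat h1 Y (0\<^sub>m 1 3) h2"

lemma levi_q_mat:
  assumes "h1 \<in> carrier_mat 3 3" "Y \<in> carrier_mat 3 1" "h2 \<in> carrier_mat 1 1"
  shows "levi_3 (q_mat h1 Y h2) = h1" "levi_1 (q_mat h1 Y h2) = h2 $$ (0, 0)"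
  using split_block_four_block_mat[of h1 3 3 Y 1 "0\<^sub>m 1 3" 1 h2] assms
  by (simp_all add: levi_3_def levi_1_def)

lemma Q31_E:
  assumes "q \<in> Q31"
  obtains h1 Y h2 where "h1 \<in> carrier (GL 3)" "Y \<in> carrier_mat 3 1" "h2 \<in> carrier (GL 1)"
    "h1 \<in> carrier_mat 3 3" "h2 \<in> carrier_mat 1 1" "q = q_mat h1 Y h2"
proof -
  obtain h1 Y h2 where "h1 \<in> carrier (GL 3)" "Y \<in> carrier_mat 3 1" "h2 \<in> carrier (GL 1)" "q = q_mat h1 Y h2"
    using assms unfolding Q31_def by blast
  then show thesis using that GL_carrier by blast
qed

lemma levi_Q31:
  assumes "q \<in> Q31"
  shows "levi_3 q \<in> carrier (GL 3)" "levi_1 q dvd 1"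
proof -
  obtain h1 Y h2 where q: "h1 \<in> carrier (GL 3)" "Y \<in> carrier_mat 3 1" "h2 \<in> carrier (GL 1)"
    "h1 \<in> carrier_mat 3 3" "h2 \<in> carrier_mat 1 1" "q = q_mat h1 Y h2" using assms by (rule Q31_E)
  show "levi_3 q \<in> carrier (GL 3)" "levi_1 q dvd 1"
    unfolding q(6) levi_q_mat[OF q(4,2,5)] using q(1) GL_1_unit[OF q(3)] by auto
qed

lemma Q31_I: "h1 \<in> carrier (GL 3) \<Longrightarrow> Y \<in> carrier_mat 3 1 \<Longrightarrow> h2 \<in> carrier (GL 1) \<Longrightarrow> q_mat h1 Y h2 \<in> Q31"
  by (auto simp: Q31_def)

lemma Q31_GL: "q \<in> Q31 \<Longrightarrow> q \<in> carrier (GL 4)"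
  using upper_block_GL[of _ 3 _ 1] by (auto simp: Q31_def)

lemma Q31_mult:
  assumes "h1 \<in> carrier_mat 3 3" "Y \<in> carrier_mat 3 1" "h2 \<in> carrier_mat 1 1"
    "k1 \<in> carrier_mat 3 3" "X \<in> carrier_mat 3 1" "k2 \<in> carrier_mat 1 1"
  shows "q_mat h1 Y h2 * q_mat k1 X k2 = q_mat (h1 * k1) (h1 * X + Y * k2) (h2 * k2)"
  by (rule upper_block_mult[OF assms])

lemma Q31_subgroup: "subgroup Q31 (GL 4)"
proof (rule GL.subgroupI)
  show "Q31 \<subseteq> carrier (GL 4)" using Q31_GL by blast
  show "Q31 \<noteq> {}" using Q31_I[OF one_GL zero_carrier_mat one_GL] by blast
  show "q \<otimes>\<^bsub>GL 4\<^esub> q' \<in> Q31" if qq: "q \<in> Q31" "q' \<in> Q31" for q q'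
  proof -
    obtain h1 Y h2 where q: "h1 \<in> carrier (GL 3)" "Y \<in> carrier_mat 3 1" "h2 \<in> carrier (GL 1)"
      "h1 \<in> carrier_mat 3 3" "h2 \<in> carrier_mat 1 1" "q = q_mat h1 Y h2" using qq(1) by (rule Q31_E)
    obtain k1 X k2 where q': "k1 \<in> carrier (GL 3)" "X \<in> carrier_mat 3 1" "k2 \<in> carrier (GL 1)"
      "k1 \<in> carrier_mat 3 3" "k2 \<in> carrier_mat 1 1" "q' = q_mat k1 X k2" using qq(2) by (rule Q31_E)
    have "h1 * X + Y * k2 \<in> carrier_mat 3 1" using q q' by auto
    then show ?thesis
      unfolding GL_mult q(6) q'(6) Q31_mult[OF q(4,2,5) q'(4,2,5)]
      using GL_m_closed q q' by (intro Q31_I) auto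
  qed
  show "inv\<^bsub>GL 4\<^esub> q \<in> Q31" if qq: "q \<in> Q31" for q
  proof -
    obtain h1 Y h2 where q: "h1 \<in> carrier (GL 3)" "Y \<in> carrier_mat 3 1" "h2 \<in> carrier (GL 1)"
      "h1 \<in> carrier_mat 3 3" "h2 \<in> carrier_mat 1 1" "q = q_mat h1 Y h2" using qq by (rule Q31_E)
    let ?h = "inv\<^bsub>GL 3\<^esub> h1" and ?k = "inv\<^bsub>GL 1\<^esub> h2"
    note hi = GL_inv[OF q(1)] and ki = GL_inv[OF q(3)]
    let ?X = "- (?h * Y * ?k)"
    have Xc: "?X \<in> carrier_mat 3 1" using hi ki q by auto
    have dims: "dim_row ?h = 3" "dim_col ?h = 3" "dim_row ?k = 1" "dim_col ?k = 1" "dim_row Y = 3" "dim_col Y = 1"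
      "dim_row h2 = 1" "dim_col h2 = 1" using hi ki q by auto
    have "?h * Y + ?X * h2 = 0\<^sub>m 3 1"
    proof -
      have "?h * Y * ?k * h2 = ?h * Y" using ki(2) dims by (simp add: mat_assoc_dim)
      then have "?X * h2 = - (?h * Y)" using dims by (subst uminus_mult_left_mat) simp_all
      then show ?thesis using dims by (auto intro!: eq_matI)
    qed
    then have "q_mat ?h ?X ?k * q = 1\<^sub>m 4"
      unfolding q(6) Q31_mult[OF hi(4) Xc ki(4) q(4,2,5)] using hi(2) ki(2) four_block_one_mat[of 3 1] by simp
    moreover have "q_mat ?h ?X ?k \<in> Q31" using hi ki Xc by (intro Q31_I) auto
    ultimately show ?thesis
      using GL_inv_eq[OF Q31_GL[OF qq] GL_carrier[OF Q31_GL]] by metis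
  qed
qed

text \<open>The parabolic induction of a strongly cuspidal representation. The character of the centre
  determines \<open>\<chi>\<close> on \<open>1 + w R\<close>, which brings in the fourth eigenvalue \<open>c\<close> of \<open>C0\<close>.\<close>

locale cuspidal_induction = length_two w res \<psi>0 + cubic_block A "2 * m0 - mat_trace A"
  for w :: "'r::{comm_ring_1,finite}" and res :: "'r \<Rightarrow> 'k::{field,finite}" and \<psi>0 :: "'r \<Rightarrow> complex"
    and A :: "'k mat" and m0 :: 'k +
  fixes \<rho> :: "('r mat, 'v::ab_group_add) rep" and \<theta> :: "'r mat \<Rightarrow> complex" and \<chi> \<omega> :: "'r \<Rightarrow> complex"
  assumes \<theta>: "is_character (GL 3) (stabilizer \<psi>0 w res 3 A) \<theta>"
    and \<theta>_phi: "j \<in> J1 w 3 \<Longrightarrow> \<theta> j = phi \<psi>0 w res 3 A j"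
    and \<rho>: "rep_iso (GL 3) \<rho> (induced (GL 3) (stabilizer \<psi>0 w res 3 A) (char_rep \<theta>))"
    and \<chi>: "unit_character \<chi>"
    and \<omega>: "central_character 4 (parabolic_induction \<rho> \<chi>) \<omega>"
    and m0: "psi (2 * m0 * res y) = \<omega> (1 + w * y)"
begin

abbreviation "c \<equiv> 2 * m0 - mat_trace A"
abbreviation "stab3 \<equiv> stabilizer \<psi>0 w res 3 A"
abbreviation "\<pi> \<equiv> parabolic_induction \<rho> \<chi>"

definition "H1 = {q \<in> Q31. levi_3 q \<in> stab3}"

lemma chi_mult: "x dvd 1 \<Longrightarrow> y dvd 1 \<Longrightarrow> \<chi> (x * y) = \<chi> x * \<chi> y" and chi_nz: "x dvd 1 \<Longrightarrow> \<chi> x \<noteq> 0"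
  using \<chi> by (auto simp: unit_character_def)

text \<open>Induction in stages, from the stabilizer to \<open>GL 3\<close> and, after inflation along \<open>levi_3\<close>, from \<open>Q31\<close> to \<open>GL 4\<close>.\<close>

lemma model_Q31: "\<exists>ev e. monomial_model (GL 4) \<pi> H1 (\<lambda>q. \<chi> (levi_1 q) * \<theta> (levi_3 q)) ev e"
proof -
  obtain ev0 e0 where "monomial_model (GL 3) (induced (GL 3) stab3 (char_rep \<theta>)) stab3 \<theta> ev0 e0"
    using monomial_model_induced_char[OF group_GL finite_GL stabilizer_subgroup[OF A] \<theta>] by blast
  then obtain ev e where "monomial_model (GL 3) \<rho> stab3 \<theta> ev e"
    using monomial_model.transport[OF _ \<rho>] by blast
  then interpret m: monomial_model "GL 3" \<rho> stab3 \<theta> ev e .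
  have "monomial_model (GL 4) (induced (GL 4) Q31 (inflate_tensor \<rho> \<chi>)) {q \<in> Q31. levi_3 q \<in> stab3}
      (\<lambda>q. \<chi> (levi_1 q) * \<theta> (levi_3 q)) (\<lambda>f. ev (f \<one>\<^bsub>GL 4\<^esub>))
      (\<lambda>x. if x \<in> Q31 then rep_act (inflate_tensor \<rho> \<chi>) x e else 0)"
  proof (rule m.induction_in_stages[OF group_GL finite_GL Q31_subgroup])
    show "levi_3 q \<in> carrier (GL 3)" if "q \<in> Q31" for q :: "'r mat"
      using that by (rule levi_Q31)
    show "carrier (GL 3) \<subseteq> levi_3 ` (Q31 :: 'r mat set)"
    proof
      fix g :: "'r mat" assume g: "g \<in> carrier (GL 3)"
      then have "q_mat g (0\<^sub>m 3 1) (1\<^sub>m 1) \<in> Q31" by (intro Q31_I one_GL) auto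
      moreover have "levi_3 (q_mat g (0\<^sub>m 3 1) (1\<^sub>m 1)) = g"
        by (rule levi_q_mat) (use GL_carrier[OF g] in auto)
      ultimately show "g \<in> levi_3 ` Q31" by force
    qed
    fix q q' :: "'r mat" assume qq: "q \<in> Q31" "q' \<in> Q31"
    obtain h1 Y h2 where q: "h1 \<in> carrier (GL 3)" "Y \<in> carrier_mat 3 1" "h2 \<in> carrier (GL 1)"
      "h1 \<in> carrier_mat 3 3" "h2 \<in> carrier_mat 1 1" "q = q_mat h1 Y h2" using qq(1) by (rule Q31_E)
    obtain k1 X k2 where q': "k1 \<in> carrier (GL 3)" "X \<in> carrier_mat 3 1" "k2 \<in> carrier (GL 1)"
      "k1 \<in> carrier_mat 3 3" "k2 \<in> carrier_mat 1 1" "q' = q_mat k1 X k2" using qq(2) by (rule Q31_E)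
    have XY: "h1 * X + Y * k2 \<in> carrier_mat 3 1" using q q' by auto
    show "levi_3 (q \<otimes>\<^bsub>GL 4\<^esub> q') = levi_3 q \<otimes>\<^bsub>GL 3\<^esub> levi_3 q'"
      unfolding GL_mult q(6) q'(6) Q31_mult[OF q(4,2,5) q'(4,2,5)]
      levi_q_mat[OF q(4,2,5)] levi_q_mat[OF q'(4,2,5)] levi_q_mat[OF mult_carrier_mat[OF q(4) q'(4)] XY mult_carrier_mat[OF q(5) q'(5)]] ..
    have "(h2 * k2) $$ (0, 0) = h2 $$ (0, 0) * k2 $$ (0, 0)"
      using q q' by (simp add: scalar_prod_def)
    then show "\<chi> (levi_1 (q \<otimes>\<^bsub>GL 4\<^esub> q')) = \<chi> (levi_1 q) * \<chi> (levi_1 q')"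
      unfolding GL_mult q(6) q'(6) Q31_mult[OF q(4,2,5) q'(4,2,5)]
        levi_q_mat[OF q(4,2,5)] levi_q_mat[OF q'(4,2,5)] levi_q_mat[OF mult_carrier_mat[OF q(4) q'(4)] XY mult_carrier_mat[OF q(5) q'(5)]]
      using chi_mult[OF GL_1_unit[OF q(3)] GL_1_unit[OF q'(3)]] by simp
  next
    show "\<chi> (levi_1 q) \<noteq> 0" if "q \<in> Q31" for q
      using chi_nz[OF levi_Q31(2)[OF that]] .
    show "rep_act (inflate_tensor \<rho> \<chi>) q v = rep_scale \<rho> (\<chi> (levi_1 q)) (rep_act \<rho> (levi_3 q) v)" for q v
      by (simp add: inflate_tensor_def levi_1_def levi_3_def split: prod.split)
  qed (simp_all add: inflate_tensor_def)
  then show ?thesis unfolding parabolic_induction_def H1_def by blast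
qed

lemma stab3_J1: "j \<in> J1 w 3 \<Longrightarrow> j \<in> stab3"
  using J1_subset_GL[of 3] A by (auto simp: stabilizer_iff J1_iff[symmetric]) (auto simp: J1_iff)

lemma theta_one: "\<theta> (1\<^sub>m 3) = 1"
proof -
  have "1\<^sub>m 3 \<in> stab3" using stab3_J1 by (simp add: J1_iff res.mat_hom_one)
  then have "\<theta> (1\<^sub>m 3 * 1\<^sub>m 3) = \<theta> (1\<^sub>m 3) * \<theta> (1\<^sub>m 3)" "\<theta> (1\<^sub>m 3) \<noteq> 0"
    using \<theta> unfolding is_character_def GL_mult by blast+
  then show ?thesis by simp
qed

lemma chi_one: "\<chi> 1 = 1"
  using chi_mult[of 1 1] chi_nz[of 1] by simp

text \<open>A scalar \<open>1 + w y\<close> acts on \<open>\<pi>\<close> by \<open>\<chi> (1 + w y)\<close> times the value of \<open>\<theta>\<close> at the scalar matrix of size three, which is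
  \<open>psi (tr A * y)\<close>; comparing with \<open>\<omega>\<close> gives the eigenvalue \<open>c\<close>.\<close>

lemma chi_1_w: "\<chi> (1 + w * y) = psi (c * res y)"
proof -
  obtain ev e where "monomial_model (GL 4) \<pi> H1 (\<lambda>q. \<chi> (levi_1 q) * \<theta> (levi_3 q)) ev e"
    using model_Q31 by blast
  then interpret m: monomial_model "GL 4" \<pi> H1 "\<lambda>q. \<chi> (levi_1 q) * \<theta> (levi_3 q)" ev e .
  let ?z = "1 + w * y"
  have z3: "?z \<cdot>\<^sub>m 1\<^sub>m 3 = 1\<^sub>m 3 + w \<cdot>\<^sub>m (y \<cdot>\<^sub>m 1\<^sub>m 3)"
    by (auto intro!: eq_matI simp: algebra_simps)
  have z4: "?z \<cdot>\<^sub>m 1\<^sub>m 4 = q_mat (?z \<cdot>\<^sub>m 1\<^sub>m 3) (0\<^sub>m 3 1) (?z \<cdot>\<^sub>m 1\<^sub>m 1)"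
    using smult_four_block_mat[of "1\<^sub>m 3" 3 3 "0\<^sub>m 3 1" 1 "0\<^sub>m 1 3" 1 "1\<^sub>m 1" ?z] four_block_one_mat[of 3 1] by simp
  have zQ: "?z \<cdot>\<^sub>m 1\<^sub>m 4 \<in> Q31"
    unfolding z4 using unit_1_w by (intro Q31_I smult_GL one_GL) auto
  have zJ: "?z \<cdot>\<^sub>m 1\<^sub>m 3 \<in> J1 w 3" unfolding z3 by (rule J1_I) simp
  have lev: "levi_3 (?z \<cdot>\<^sub>m 1\<^sub>m 4) = ?z \<cdot>\<^sub>m 1\<^sub>m 3" "levi_1 (?z \<cdot>\<^sub>m 1\<^sub>m 4) = ?z"
    unfolding z4 by (subst levi_q_mat; simp)+
  have zH: "?z \<cdot>\<^sub>m 1\<^sub>m 4 \<in> H1" unfolding H1_def using zQ lev stab3_J1[OF zJ] by simp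
  have "rep_act \<pi> (?z \<cdot>\<^sub>m 1\<^sub>m 4) e = rep_scale \<pi> (\<omega> ?z) e"
    using \<omega> m.e_V unit_1_w by (simp add: central_character_def)
  then have "\<omega> ?z = \<chi> ?z * \<theta> (?z \<cdot>\<^sub>m 1\<^sub>m 3)"
    using m.char_eq[OF zH] m.ev_scale[OF m.e_V] m.ev_e lev by simp
  also have "\<theta> (?z \<cdot>\<^sub>m 1\<^sub>m 3) = psi (mat_trace A * res y)"
  proof -
    have "A * red (y \<cdot>\<^sub>m 1\<^sub>m 3) = res y \<cdot>\<^sub>m A"
      by (rule eq_matI) (auto simp: mult_entry_3 lessThan_small res_times res_1 res.hom_zero simp del: index_mult_mat(1))
    then show ?thesis
      using \<theta>_phi[OF zJ] unfolding z3 by (simp add: phi_eq mat_trace_smult[OF A] mult.commute)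
  qed
  finally have "\<chi> ?z * psi (mat_trace A * res y) = psi (2 * m0 * res y)" using m0[of y] by simp
  also have "\<dots> = psi (c * res y) * psi (mat_trace A * res y)"
    by (simp add: psi_add[symmetric] algebra_simps)
  finally show ?thesis using psi_nz by simp
qed

lemma C0_carrier: "C0 \<in> carrier_mat 4 4"
  using four_block_carrier_mat[of A 3 3 "c \<cdot>\<^sub>m 1\<^sub>m 1" 1 1] by simp

abbreviation "stab4 \<equiv> stabilizer \<psi>0 w res 4 C0"
abbreviation "phi4 \<equiv> phi \<psi>0 w res 4 C0"

lemma J1_blocks:
  assumes "k \<in> J1 w 4"
  obtains X1 X2 X3 X4 where "X1 \<in> carrier_mat 3 3" "X2 \<in> carrier_mat 3 1" "X3 \<in> carrier_mat 1 3" "X4 \<in> carrier_mat 1 1"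
    "k = 1\<^sub>m 4 + w \<cdot>\<^sub>m four_block_mat X1 X2 X3 X4"
    "k = four_block_mat (1\<^sub>m 3 + w \<cdot>\<^sub>m X1) (w \<cdot>\<^sub>m X2) (w \<cdot>\<^sub>m X3) (1\<^sub>m 1 + w \<cdot>\<^sub>m X4)"
proof -
  obtain X where X: "X \<in> carrier_mat 4 4" "k = 1\<^sub>m 4 + w \<cdot>\<^sub>m X" using assms by (rule J1_E)
  obtain X1 X2 X3 X4 where b: "X1 \<in> carrier_mat 3 3" "X2 \<in> carrier_mat 3 1" "X3 \<in> carrier_mat 1 3" "X4 \<in> carrier_mat 1 1"
    "X = four_block_mat X1 X2 X3 X4"
    by (rule four_block_split[of X 3 1 3 1]) (use X(1) in auto)
  have "w \<cdot>\<^sub>m X = four_block_mat (w \<cdot>\<^sub>m X1) (w \<cdot>\<^sub>m X2) (w \<cdot>\<^sub>m X3) (w \<cdot>\<^sub>m X4)"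
    unfolding b(5) by (rule smult_four_block_mat[OF b(1-4)])
  moreover have "1\<^sub>m 4 = four_block_mat (1\<^sub>m 3) (0\<^sub>m 3 1) (0\<^sub>m 1 3) (1\<^sub>m 1 :: 'r mat)"
    using four_block_one_mat[of 3 1] by simp
  ultimately have "k = four_block_mat (1\<^sub>m 3) (0\<^sub>m 3 1) (0\<^sub>m 1 3) (1\<^sub>m 1)
      + four_block_mat (w \<cdot>\<^sub>m X1) (w \<cdot>\<^sub>m X2) (w \<cdot>\<^sub>m X3) (w \<cdot>\<^sub>m X4)"
    using X(2) by simp
  also have "\<dots> = four_block_mat (1\<^sub>m 3 + w \<cdot>\<^sub>m X1) (0\<^sub>m 3 1 + w \<cdot>\<^sub>m X2) (0\<^sub>m 1 3 + w \<cdot>\<^sub>m X3) (1\<^sub>m 1 + w \<cdot>\<^sub>m X4)"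
    by (rule add_four_block_mat[of _ 3 3 _ 1 _ 1]) (use b in auto)
  also have "\<dots> = four_block_mat (1\<^sub>m 3 + w \<cdot>\<^sub>m X1) (w \<cdot>\<^sub>m X2) (w \<cdot>\<^sub>m X3) (1\<^sub>m 1 + w \<cdot>\<^sub>m X4)"
    using b(2,3) by simp
  finally have "k = four_block_mat (1\<^sub>m 3 + w \<cdot>\<^sub>m X1) (w \<cdot>\<^sub>m X2) (w \<cdot>\<^sub>m X3) (1\<^sub>m 1 + w \<cdot>\<^sub>m X4)" .
  then show thesis using that b X(2) by blast
qed

text \<open>An element of \<open>J1 w 4\<close> lies in \<open>H1\<close> exactly if its lower left block vanishes, as \<open>1 + w X1\<close> always stabilizes the character of \<open>A\<close>.\<close>

lemma J1_H1_iff: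
  assumes X: "X1 \<in> carrier_mat 3 3" "X2 \<in> carrier_mat 3 1" "X3 \<in> carrier_mat 1 3" "X4 \<in> carrier_mat 1 1"
    and k: "k = four_block_mat (1\<^sub>m 3 + w \<cdot>\<^sub>m X1) (w \<cdot>\<^sub>m X2) (w \<cdot>\<^sub>m X3) (1\<^sub>m 1 + w \<cdot>\<^sub>m X4)"
  shows "k \<in> H1 \<longleftrightarrow> red X3 = 0\<^sub>m 1 3"
    and "k \<in> H1 \<Longrightarrow> levi_3 k = 1\<^sub>m 3 + w \<cdot>\<^sub>m X1 \<and> levi_1 k = 1 + w * X4 $$ (0, 0)"
proof -
  have c: "1\<^sub>m 3 + w \<cdot>\<^sub>m X1 \<in> carrier_mat 3 3" "w \<cdot>\<^sub>m X2 \<in> carrier_mat 3 1" "w \<cdot>\<^sub>m X3 \<in> carrier_mat 1 3"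
    "1\<^sub>m 1 + w \<cdot>\<^sub>m X4 \<in> carrier_mat 1 1" using X by auto
  have j: "1\<^sub>m 3 + w \<cdot>\<^sub>m X1 \<in> J1 w 3" "1\<^sub>m 1 + w \<cdot>\<^sub>m X4 \<in> J1 w 1" using X by (auto intro: J1_I)
  have lev: "levi_3 k = 1\<^sub>m 3 + w \<cdot>\<^sub>m X1 \<and> levi_1 k = 1 + w * X4 $$ (0, 0)" if "w \<cdot>\<^sub>m X3 = 0\<^sub>m 1 3"
    unfolding k that levi_q_mat[OF c(1,2,4)] using X(4) by simp
  have 1: "w \<cdot>\<^sub>m X3 = 0\<^sub>m 1 3" if "k \<in> H1"
  proof -
    have "k \<in> Q31" using that by (simp add: H1_def)
    then obtain h1 Y h2 where q: "h1 \<in> carrier (GL 3)" "Y \<in> carrier_mat 3 1" "h2 \<in> carrier (GL 1)"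
      "h1 \<in> carrier_mat 3 3" "h2 \<in> carrier_mat 1 1" "k = q_mat h1 Y h2" by (rule Q31_E)
    show ?thesis
      using k[unfolded q(6)] four_block_mat_eq_iff[OF q(4,2) zero_carrier_mat q(5) c] by simp
  qed
  have 2: "k \<in> H1" if "w \<cdot>\<^sub>m X3 = 0\<^sub>m 1 3"
  proof -
    have "k \<in> Q31"
      unfolding k that using j J1_subset_GL c by (intro Q31_I) blast+
    then show ?thesis using lev[OF that] stab3_J1[OF j(1)] by (simp add: H1_def)
  qed
  show "k \<in> H1 \<longleftrightarrow> red X3 = 0\<^sub>m 1 3" using 1 2 smult_w_eq_0[OF X(3)] by blast
  show "k \<in> H1 \<Longrightarrow> levi_3 k = 1\<^sub>m 3 + w \<cdot>\<^sub>m X1 \<and> levi_1 k = 1 + w * X4 $$ (0, 0)" using 1 lev by blast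
qed

text \<open>Conjugating \<open>C0\<close> by \<open>u\<close> puts \<open>(A - c) Y\<close> into the upper right block. As \<open>A - c\<close> is invertible, the first factor is a nontrivial
  character of \<open>Y\<close> unless \<open>X3\<close> reduces to zero; this is the cancellation needed for changing the polarization.\<close>

lemma phi4_conj_U:
  assumes X: "X1 \<in> carrier_mat 3 3" "X2 \<in> carrier_mat 3 1" "X3 \<in> carrier_mat 1 3" "X4 \<in> carrier_mat 1 1"
    and k: "k = 1\<^sub>m 4 + w \<cdot>\<^sub>m four_block_mat X1 X2 X3 X4" and Y: "Y \<in> carrier_mat 3 1"
  defines "u \<equiv> q_mat (1\<^sub>m 3) Y (1\<^sub>m 1)"
  shows "phi4 (u * k * inv\<^bsub>GL 4\<^esub> u) = psi (mat_trace (red X3 * (A - c \<cdot>\<^sub>m 1\<^sub>m 3) * red Y)) *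
    (psi (mat_trace (A * red X1)) * psi (c * res (X4 $$ (0, 0))))"
proof -
  let ?M = "A - c \<cdot>\<^sub>m 1\<^sub>m 3"
  have M: "?M \<in> carrier_mat 3 3" using GL_carrier[OF A_minus_GL] .
  let ?C = "four_block_mat A (?M * red Y) (0\<^sub>m 1 3) (c \<cdot>\<^sub>m 1\<^sub>m 1)"
  have u: "u \<in> carrier (GL 4)" unfolding u_def using upper_block_GL[OF one_GL one_GL Y] by simp
  have Xc: "four_block_mat X1 X2 X3 X4 \<in> carrier_mat 4 4" using four_block_carrier_mat[OF X(1,4)] by simp
  have rc: "red X1 \<in> carrier_mat 3 3" "red X2 \<in> carrier_mat 3 1" "red X3 \<in> carrier_mat 1 3" "red X4 \<in> carrier_mat 1 1"
    "red Y \<in> carrier_mat 3 1" using X Y by auto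
  have MY: "?M * red Y \<in> carrier_mat 3 1" using M rc by auto
  have Cc: "?C \<in> carrier_mat 4 4" using four_block_carrier_mat[OF A, of "c \<cdot>\<^sub>m 1\<^sub>m 1" 1 1] by simp
  have ru: "red u = q_mat (1\<^sub>m 3) (red Y) (1\<^sub>m 1)"
    unfolding u_def by (subst map_four_block_mat[of _ 3 3 _ 1 _ 1])
      (use Y in \<open>auto simp: res.mat_hom_one intro!: cong_four_block_mat eq_matI simp: res.hom_zero\<close>)
  have l: "C0 * red u = q_mat (A * 1\<^sub>m 3) (A * red Y + 0\<^sub>m 3 1 * 1\<^sub>m 1) ((c \<cdot>\<^sub>m 1\<^sub>m 1) * 1\<^sub>m 1)"
    unfolding ru by (rule upper_block_mult) (use rc in auto)
  have r: "red u * ?C = q_mat (1\<^sub>m 3 * A) (1\<^sub>m 3 * (?M * red Y) + red Y * (c \<cdot>\<^sub>m 1\<^sub>m 1)) (1\<^sub>m 1 * (c \<cdot>\<^sub>m 1\<^sub>m 1))"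
    unfolding ru by (rule upper_block_mult) (use rc MY in auto)
  have "C0 * red u = red u * ?C"
    unfolding l r using rc M by (intro cong_four_block_mat)
      (auto simp: A_minus_mult[OF rc(5)] mat_distrib_dim intro!: eq_matI)
  then have "phi4 (u * k * inv\<^bsub>GL 4\<^esub> u) = psi (mat_trace (?C * red (four_block_mat X1 X2 X3 X4)))"
    unfolding k by (rule phi_conj[OF C0_carrier u Xc Cc])
  also have "red (four_block_mat X1 X2 X3 X4) = four_block_mat (red X1) (red X2) (red X3) (red X4)"
    by (rule map_four_block_mat[OF X])
  also have "mat_trace (?C * \<dots>) = mat_trace (A * red X1) + mat_trace (?M * red Y * red X3)
      + (mat_trace (0\<^sub>m 1 3 * red X2) + mat_trace ((c \<cdot>\<^sub>m 1\<^sub>m 1) * red X4))"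
    by (rule mat_trace_block_mult) (use rc MY in auto)
  also have "mat_trace (?M * red Y * red X3) = mat_trace (red X3 * (?M * red Y))"
    by (rule mat_trace_mult_comm[OF MY rc(3)])
  also have "red X3 * (?M * red Y) = red X3 * ?M * red Y"
    by (rule assoc_mult_mat[OF rc(3) M rc(5), symmetric])
  also have "0\<^sub>m 1 3 * red X2 = 0\<^sub>m 1 1" using rc by simp
  also have "mat_trace ((c \<cdot>\<^sub>m 1\<^sub>m 1) * red X4) = c * res (X4 $$ (0, 0))"
    by (subst mat_trace_1) (use rc X(4) in \<open>auto simp: mat_distrib_dim\<close>)
  finally show ?thesis by (simp add: psi_add mat_trace_zero mult_ac)
qed

text \<open>The two characters agree on \<open>J1 w 4 \<inter> H1\<close> by \<open>chi_1_w\<close>, and the stabilizer of the character of \<open>C0\<close> is generated by \<open>J1 w 4\<close> and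
  a subgroup of \<open>H1\<close>, because a matrix that commutes with \<open>C0\<close> is block diagonal.\<close>

theorem model_C0: "\<exists>\<mu> ev e. monomial_model (GL 4) \<pi> stab4 \<mu> ev e \<and> (\<forall>k\<in>J1 w 4. \<mu> k = phi4 k)"
proof -
  obtain ev e where "monomial_model (GL 4) \<pi> H1 (\<lambda>q. \<chi> (levi_1 q) * \<theta> (levi_3 q)) ev e"
    using model_Q31 by blast
  then interpret m: monomial_model "GL 4" \<pi> H1 "\<lambda>q. \<chi> (levi_1 q) * \<theta> (levi_3 q)" ev e .
  let ?u = "\<lambda>Y. q_mat (1\<^sub>m 3) Y (1\<^sub>m 1) :: 'r mat"
  let ?M = "A - c \<cdot>\<^sub>m 1\<^sub>m 3"
  define U where "U = ?u ` carrier_mat 3 1"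
  note normal = J1_normal[of 4]
  have st: "{g \<in> carrier (GL 4). \<forall>k\<in>J1 w 4. phi4 (g * k * inv\<^bsub>GL 4\<^esub> g) = phi4 k} = stab4"
    by (simp add: stabilizer_def GL_mult)
  have u_GL: "?u Y \<in> carrier (GL 4)" if "Y \<in> carrier_mat 3 1" for Y
    using upper_block_GL[OF one_GL one_GL that] by simp
  have u_mult: "?u Y * ?u Z = ?u (Y + Z)" if "Y \<in> carrier_mat 3 1" "Z \<in> carrier_mat 3 1" for Y Z
    by (subst upper_block_mult) (use that in \<open>auto simp: comm_add_mat[of Y 3 1 Z]\<close>)
  have u0: "?u (0\<^sub>m 3 1) = 1\<^sub>m 4" using four_block_one_mat[of 3 1] by simp
  have U_sub: "subgroup U (GL 4)"
  proof (rule GL.subgroupI)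
    show "U \<subseteq> carrier (GL 4)" "U \<noteq> {}" unfolding U_def using u_GL zero_carrier_mat by auto
    show "inv\<^bsub>GL 4\<^esub> u \<in> U" if u: "u \<in> U" for u
    proof -
      obtain Y where Y: "Y \<in> carrier_mat 3 1" "u = ?u Y" using u by (auto simp: U_def)
      have "?u (- Y) * ?u Y = 1\<^sub>m 4"
        unfolding u0[symmetric] using Y(1) by (subst u_mult) auto
      then have "inv\<^bsub>GL 4\<^esub> u = ?u (- Y)"
        unfolding Y(2) using u_GL Y(1) GL_carrier[OF u_GL[of "- Y"]] by (intro GL_inv_eq) auto
      then show ?thesis using Y(1) by (auto simp: U_def)
    qed
    show "u \<otimes>\<^bsub>GL 4\<^esub> v \<in> U" if "u \<in> U" "v \<in> U" for u v
      using that u_mult by (auto simp: U_def GL_mult)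
  qed
  have lev_u: "levi_3 (?u Y) = 1\<^sub>m 3" "levi_1 (?u Y) = 1" if "Y \<in> carrier_mat 3 1" for Y
    using levi_q_mat[OF one_carrier_mat that one_carrier_mat] by simp_all
  have U_H1: "u \<in> H1" and U_char: "\<chi> (levi_1 u) * \<theta> (levi_3 u) = 1" if "u \<in> U" for u
  proof -
    obtain Y where Y: "Y \<in> carrier_mat 3 1" "u = ?u Y" using \<open>u \<in> U\<close> by (auto simp: U_def)
    have "1\<^sub>m 3 \<in> stab3" using stab3_J1 by (simp add: J1_iff res.mat_hom_one)
    then show "u \<in> H1" unfolding H1_def Y(2) using Q31_I[OF one_GL Y(1) one_GL] lev_u[OF Y(1)] by simp
    show "\<chi> (levi_1 u) * \<theta> (levi_3 u) = 1"
      unfolding Y(2) lev_u[OF Y(1)] chi_one theta_one by simp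
  qed
  have agree: "\<chi> (levi_1 k) * \<theta> (levi_3 k) = phi4 k" if k: "k \<in> J1 w 4" "k \<in> H1" for k
  proof -
    obtain X1 X2 X3 X4 where X: "X1 \<in> carrier_mat 3 3" "X2 \<in> carrier_mat 3 1" "X3 \<in> carrier_mat 1 3" "X4 \<in> carrier_mat 1 1"
      "k = 1\<^sub>m 4 + w \<cdot>\<^sub>m four_block_mat X1 X2 X3 X4"
      "k = four_block_mat (1\<^sub>m 3 + w \<cdot>\<^sub>m X1) (w \<cdot>\<^sub>m X2) (w \<cdot>\<^sub>m X3) (1\<^sub>m 1 + w \<cdot>\<^sub>m X4)"
      using k(1) by (rule J1_blocks)
    have kc: "k \<in> carrier_mat 4 4" using k(1) J1_iff by blast
    have r3: "red X3 = 0\<^sub>m 1 3" using J1_H1_iff(1)[OF X(1-4,6)] k(2) by blast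
    have "phi4 k = phi4 (?u (0\<^sub>m 3 1) * k * inv\<^bsub>GL 4\<^esub> ?u (0\<^sub>m 3 1))"
      unfolding u0 GL_inv_eq[OF one_GL one_carrier_mat left_mult_one_mat[OF one_carrier_mat]] using kc by simp
    also have "\<dots> = psi (mat_trace (red X3 * ?M * red (0\<^sub>m 3 1))) *
        (psi (mat_trace (A * red X1)) * psi (c * res (X4 $$ (0, 0))))"
      by (rule phi4_conj_U[OF X(1-5) zero_carrier_mat])
    also have "red X3 * ?M * red (0\<^sub>m 3 1) = 0\<^sub>m 1 1"
      unfolding r3 by (auto intro!: eq_matI)
    also have "mat_trace (0\<^sub>m 1 1 :: 'k mat) = 0" by (simp add: mat_trace_def)
    finally have "phi4 k = psi (mat_trace (A * red X1)) * psi (c * res (X4 $$ (0, 0)))"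
      by (simp add: psi_0)
    moreover have "\<theta> (1\<^sub>m 3 + w \<cdot>\<^sub>m X1) = psi (mat_trace (A * red X1))"
      using \<theta>_phi[OF J1_I[OF X(1)]] by (simp add: phi_eq[OF X(1)])
    ultimately show ?thesis
      using J1_H1_iff(2)[OF X(1-4,6) k(2)] chi_1_w by simp
  qed
  have decomp: "\<exists>k\<in>J1 w 4. \<exists>h\<in>H1. h \<in> stab4 \<and> g = k * h" if g: "g \<in> stab4" for g
  proof -
    have gG: "g \<in> carrier (GL 4)" and comm: "C0 * red g = red g * C0"
      using g C0_carrier by (auto simp: stabilizer_iff)
    obtain a b d f where gb: "a \<in> carrier_mat 3 3" "b \<in> carrier_mat 3 1" "d \<in> carrier_mat 1 3" "f \<in> carrier_mat 1 1"
      "g = four_block_mat a b d f"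
      by (rule four_block_split[of g 3 1 3 1]) (use GL_carrier[OF gG] in auto)
    have rg: "red g = four_block_mat (red a) (red b) (red d) (red f)"
      unfolding gb(5) by (rule map_four_block_mat[OF gb(1-4)])
    have rc: "red a \<in> carrier_mat 3 3" "red b \<in> carrier_mat 3 1" "red d \<in> carrier_mat 1 3" "red f \<in> carrier_mat 1 1"
      using gb by auto
    note cm = C0_commute[OF rc comm[unfolded rg]]
    define h where "h = q_mat a (0\<^sub>m 3 1) f"
    have rh: "red h = red g"
      unfolding h_def rg cm(2,3) by (subst map_four_block_mat[OF gb(1) zero_carrier_mat zero_carrier_mat gb(4)]) (simp add: red_zero)
    have hc: "h \<in> carrier_mat 4 4" unfolding h_def using four_block_carrier_mat[OF gb(1,4)] by simp
    have hG: "h \<in> carrier (GL 4)" using GL_of_red[OF hc] rh red_GL[OF gG] by simp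
    have af: "a \<in> carrier (GL 3)" "f \<in> carrier (GL 1)"
      using block_diag_GL_D[of a 3 1 f] hG gb unfolding h_def by auto
    have lh: "levi_3 h = a" unfolding h_def by (rule levi_q_mat[OF gb(1) zero_carrier_mat gb(4)])
    have hH: "h \<in> H1" "h \<in> stab4"
      unfolding H1_def using lh af cm(1) Q31_I[OF af(1) zero_carrier_mat af(2)] A C0_carrier hG rh comm
      by (auto simp: stabilizer_iff h_def)
    note hi = GL_inv[OF hG]
    have "red (g * inv\<^bsub>GL 4\<^esub> h) = red (h * inv\<^bsub>GL 4\<^esub> h)"
      using red_mult[OF GL_carrier[OF gG] hi(4)] red_mult[OF hc hi(4)] rh by simp
    then have "g * inv\<^bsub>GL 4\<^esub> h \<in> J1 w 4"
      unfolding J1_iff using hi GL_carrier[OF gG] by (simp add: res.mat_hom_one)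
    moreover have "g = (g * inv\<^bsub>GL 4\<^esub> h) * h"
      using assoc_mult_mat[OF GL_carrier[OF gG] hi(4) hc] hi(2) GL_carrier[OF gG] by simp
    ultimately show ?thesis using hH by blast
  qed
  have cancel: "\<exists>u0\<in>U. \<exists>\<zeta>. \<zeta> \<noteq> 1 \<and> (\<forall>u\<in>U. phi4 ((u * u0) * k * inv\<^bsub>GL 4\<^esub> (u * u0)) = \<zeta> * phi4 (u * k * inv\<^bsub>GL 4\<^esub> u))"
    if k: "k \<in> J1 w 4" "k \<notin> H1" for k
  proof -
    obtain X1 X2 X3 X4 where X: "X1 \<in> carrier_mat 3 3" "X2 \<in> carrier_mat 3 1" "X3 \<in> carrier_mat 1 3" "X4 \<in> carrier_mat 1 1"
      "k = 1\<^sub>m 4 + w \<cdot>\<^sub>m four_block_mat X1 X2 X3 X4"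
      "k = four_block_mat (1\<^sub>m 3 + w \<cdot>\<^sub>m X1) (w \<cdot>\<^sub>m X2) (w \<cdot>\<^sub>m X3) (1\<^sub>m 1 + w \<cdot>\<^sub>m X4)"
      using k(1) by (rule J1_blocks)
    have r3: "red X3 \<noteq> 0\<^sub>m 1 3" using J1_H1_iff(1)[OF X(1-4,6)] k(2) by blast
    have c3: "red X3 \<in> carrier_mat 1 3" using X by simp
    note Mi = GL_inv[OF A_minus_GL] GL_carrier[OF A_minus_GL]
    have XM: "red X3 * ?M \<in> carrier_mat 1 3" using c3 Mi(5) by auto
    have "red X3 * ?M \<noteq> 0\<^sub>m 1 3"
    proof
      assume z: "red X3 * ?M = 0\<^sub>m 1 3"
      have "red X3 = red X3 * (?M * inv\<^bsub>GL 3\<^esub> ?M)" using Mi(3) c3 by simp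
      also have "\<dots> = (red X3 * ?M) * inv\<^bsub>GL 3\<^esub> ?M" by (rule assoc_mult_mat[OF c3 Mi(5,4), symmetric])
      also have "\<dots> = 0\<^sub>m 1 3" unfolding z using Mi(4) by simp
      finally show False using r3 by simp
    qed
    then obtain Y where Y: "Y \<in> carrier_mat 3 1" "psi (mat_trace (red X3 * ?M * Y)) \<noteq> psi (mat_trace (0\<^sub>m 1 3 * Y))"
      using psi_trace_eqD[OF XM zero_carrier_mat] by blast
    have "mat_trace (0\<^sub>m 1 3 * Y) = 0" using Y(1) by (simp add: mat_trace_def)
    then have Y1: "psi (mat_trace (red X3 * ?M * Y)) \<noteq> 1" using Y(2) psi_0 by simp
    obtain Y0 where Y0: "Y0 \<in> carrier_mat 3 1" "red Y0 = Y" using Y(1) by (rule lift_mat)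
    let ?\<zeta> = "psi (mat_trace (red X3 * ?M * red Y0))"
    have "phi4 ((?u Z * ?u Y0) * k * inv\<^bsub>GL 4\<^esub> (?u Z * ?u Y0)) = ?\<zeta> * phi4 (?u Z * k * inv\<^bsub>GL 4\<^esub> ?u Z)"
      if Z: "Z \<in> carrier_mat 3 1" for Z
    proof -
      have ZY: "Z + Y0 \<in> carrier_mat 3 1" using Z Y0 by simp
      have r: "red (Z + Y0) = red Z + red Y0" using Z Y0 by (auto intro!: eq_matI simp: res_plus)
      have rc: "red Z \<in> carrier_mat 3 1" "red Y0 \<in> carrier_mat 3 1" using Z Y0 by auto
      have "mat_trace (red X3 * ?M * (red Z + red Y0))
          = mat_trace (red X3 * ?M * red Z) + mat_trace (red X3 * ?M * red Y0)"
        unfolding mult_add_distrib_mat[OF XM rc]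
        by (rule mat_trace_add[of _ 1]) (use XM rc in auto)
      then show ?thesis
        unfolding u_mult[OF Z Y0(1)] phi4_conj_U[OF X(1-5) ZY] phi4_conj_U[OF X(1-5) Z] r
        by (simp add: psi_add)
    qed
    then show ?thesis using Y0 Y1 unfolding U_def by (intro bexI[of _ "?u Y0"] exI[of _ ?\<zeta>]) auto
  qed
  show ?thesis
    by (rule m.change_of_polarization[OF normal, of phi4 U, unfolded GL_mult st])
      (use phi_mult[OF C0_carrier] phi_nz agree decomp U_sub U_H1 U_char cancel in \<open>simp_all add: subset_eq\<close>)
qed

end

section \<open>The degenerate Whittaker space\<close>

lemma shear_mult:
  assumes "g \<in> carrier_mat 2 2" "h \<in> carrier_mat 2 2" "X \<in> carrier_mat 2 2" "Y \<in> carrier_mat 2 2"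
  shows "shear g X * shear h Y = four_block_mat (g * h) (g * (h * Y) + g * X * h) (0\<^sub>m 2 2) (g * h)"
  unfolding shear_def by (rule upper_block_mult) (use assms in auto)

lemma shear_diag_unip: "g \<in> carrier_mat 2 2 \<Longrightarrow> X \<in> carrier_mat 2 2 \<Longrightarrow> shear g (0\<^sub>m 2 2) * shear (1\<^sub>m 2) X = shear g X"
  by (subst shear_mult) (auto simp: shear_def)

lemma shear_unip_mult: "X \<in> carrier_mat 2 2 \<Longrightarrow> Y \<in> carrier_mat 2 2 \<Longrightarrow>
    shear (1\<^sub>m 2) X * shear (1\<^sub>m 2) Y = shear (1\<^sub>m 2) (X + Y)"
  by (subst shear_mult) (auto simp: shear_def comm_add_mat[of Y 2 2 X])

lemma shear_diag_mult: "g \<in> carrier_mat 2 2 \<Longrightarrow> h \<in> carrier_mat 2 2 \<Longrightarrow>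
    shear g (0\<^sub>m 2 2) * shear h (0\<^sub>m 2 2) = shear (g * h) (0\<^sub>m 2 2)"
  by (subst shear_mult) (auto simp: shear_def)

lemma shear_unip_0: "shear (1\<^sub>m 2) (0\<^sub>m 2 2) = 1\<^sub>m 4"
  using four_block_one_mat[of 2 2] by (simp add: shear_def)

lemma shear_smult: "g \<in> carrier_mat 2 2 \<Longrightarrow> X \<in> carrier_mat 2 2 \<Longrightarrow> shear (z \<cdot>\<^sub>m g) X = z \<cdot>\<^sub>m shear g X"
  unfolding shear_def
  by (subst smult_four_block_mat[of _ 2 2 _ 2 _ 2]) (auto simp: mat_distrib_dim)

lemma shear_conj:
  assumes g: "g \<in> carrier (GL 2)" and X: "X \<in> carrier_mat 2 2"
  shows "shear g (0\<^sub>m 2 2) * shear (1\<^sub>m 2) X * inv\<^bsub>GL 4\<^esub> (shear g (0\<^sub>m 2 2)) = shear (1\<^sub>m 2) (g * X * inv\<^bsub>GL 2\<^esub> g)"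
proof -
  note gi = GL_inv[OF g] GL_carrier[OF g]
  have d: "shear g (0\<^sub>m 2 2) \<in> carrier (GL 4)" using shear_GL[OF g] by simp
  note di = GL_inv[OF d] GL_carrier[OF d]
  have Zc: "g * X * inv\<^bsub>GL 2\<^esub> g \<in> carrier_mat 2 2" using gi X by auto
  have nZ: "shear (1\<^sub>m 2) (g * X * inv\<^bsub>GL 2\<^esub> g) \<in> carrier_mat 4 4" by simp
  have "g * X * inv\<^bsub>GL 2\<^esub> g * g = g * X"
    using carrier_matD[OF X] carrier_matD[OF gi(4)] carrier_matD[OF gi(5)] gi(2) by (simp add: mat_assoc_dim)
  then have "shear (1\<^sub>m 2) (g * X * inv\<^bsub>GL 2\<^esub> g) * shear g (0\<^sub>m 2 2) = shear g X"
    using gi X Zc by (subst shear_mult) (auto simp: shear_def)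
  then have "shear g (0\<^sub>m 2 2) * shear (1\<^sub>m 2) X = shear (1\<^sub>m 2) (g * X * inv\<^bsub>GL 2\<^esub> g) * shear g (0\<^sub>m 2 2)"
    using shear_diag_unip[OF gi(5) X] by simp
  then show ?thesis
    using assoc_mult_mat[OF nZ di(5,4)] di(3) nZ by simp
qed

definition unip :: "'a::comm_ring_1 mat \<Rightarrow> 'a mat" where
  "unip n = (case split_block n 2 2 of (A, X, C, D) \<Rightarrow> X)"

lemma unip_shear: "X \<in> carrier_mat 2 2 \<Longrightarrow> unip (shear (1\<^sub>m 2) X) = X"
  using split_block_four_block_mat[of "1\<^sub>m 2" 2 2 X 2 "0\<^sub>m 2 2" 2 "1\<^sub>m 2"] by (simp add: unip_def shear_def)

context length_two
begin

lemma red_shear: "g \<in> carrier_mat 2 2 \<Longrightarrow> X \<in> carrier_mat 2 2 \<Longrightarrow> red (shear g X) = shear (red g) (red X)"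
  unfolding shear_def
  by (subst map_four_block_mat[of _ 2 2 _ 2 _ 2]) (auto simp: red_zero red_mult[of g 2 2 X 2])

lemma red_smult: "red (z \<cdot>\<^sub>m g) = res z \<cdot>\<^sub>m red g"
  by (auto intro!: eq_matI simp: res_times)

lemma red_trace: "X \<in> carrier_mat n n \<Longrightarrow> mat_trace (red X) = res (mat_trace X)"
  by (simp add: mat_trace_def res.hom_sum)

lemma red_eq_zero_E:
  assumes X: "X \<in> carrier_mat n m" and "red X = 0\<^sub>m n m"
  obtains Y where "Y \<in> carrier_mat n m" "X = w \<cdot>\<^sub>m Y"
proof -
  have "\<exists>y. X $$ (i, j) = w * y" if "i < n" "j < m" for i j
  proof -
    have "red X $$ (i, j) = 0" using assms(2) that by simp
    then have "res (X $$ (i, j)) = 0" using X that by simp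
    then show ?thesis using kernel by simp
  qed
  then obtain y where y: "\<And>i j. i < n \<Longrightarrow> j < m \<Longrightarrow> X $$ (i, j) = w * y i j" by metis
  show thesis
    by (rule that[of "mat n m (\<lambda>(i, j). y i j)"]) (use X y in \<open>auto intro!: eq_matI\<close>)
qed

lemma shear_J1:
  assumes Y: "Y \<in> carrier_mat 2 2" and X: "X \<in> carrier_mat 2 2"
  shows "shear (1\<^sub>m 2 + w \<cdot>\<^sub>m Y) (w \<cdot>\<^sub>m X) = 1\<^sub>m 4 + w \<cdot>\<^sub>m four_block_mat Y X (0\<^sub>m 2 2) Y"
proof -
  have ww: "w * w = 0" using annihilator res_w by blast
  have "(w \<cdot>\<^sub>m Y) * (w \<cdot>\<^sub>m X) = (w * w) \<cdot>\<^sub>m (Y * X)"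
    using Y X by (auto intro!: eq_matI simp: mult_ac)
  also have "\<dots> = 0\<^sub>m 2 2" using Y X by (auto intro!: eq_matI simp: ww)
  finally have "(1\<^sub>m 2 + w \<cdot>\<^sub>m Y) * (w \<cdot>\<^sub>m X) = w \<cdot>\<^sub>m X"
    using Y X by (simp add: add_mult_distrib_mat[of _ 2 2 _ _ 2])
  moreover have "1\<^sub>m 4 + w \<cdot>\<^sub>m four_block_mat Y X (0\<^sub>m 2 2) Y
      = four_block_mat (1\<^sub>m 2) (0\<^sub>m 2 2) (0\<^sub>m 2 2) (1\<^sub>m 2) + four_block_mat (w \<cdot>\<^sub>m Y) (w \<cdot>\<^sub>m X) (w \<cdot>\<^sub>m 0\<^sub>m 2 2) (w \<cdot>\<^sub>m Y)"
    using smult_four_block_mat[OF Y X zero_carrier_mat Y, of w] four_block_one_mat[of 2 2] by simp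
  moreover have "\<dots> = four_block_mat (1\<^sub>m 2 + w \<cdot>\<^sub>m Y) (0\<^sub>m 2 2 + w \<cdot>\<^sub>m X) (0\<^sub>m 2 2 + w \<cdot>\<^sub>m 0\<^sub>m 2 2) (1\<^sub>m 2 + w \<cdot>\<^sub>m Y)"
    by (rule add_four_block_mat[of _ 2 2 _ 2 _ 2]) (use X Y in auto)
  moreover have "0\<^sub>m 2 2 + w \<cdot>\<^sub>m X = w \<cdot>\<^sub>m X" "0\<^sub>m 2 2 + w \<cdot>\<^sub>m 0\<^sub>m 2 2 = (0\<^sub>m 2 2 :: 'r mat)"
    using X by auto
  ultimately show ?thesis by (simp add: shear_def)
qed

lemma ZJ_E:
  assumes "g \<in> ZJ w"
  obtains z Y where "z dvd 1" "Y \<in> carrier_mat 2 2" "g = z \<cdot>\<^sub>m (1\<^sub>m 2 + w \<cdot>\<^sub>m Y)"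
  using assms by (auto simp: ZJ_def elim!: J1_E)

lemma ZJ_GL: "ZJ w \<subseteq> carrier (GL 2)"
  using smult_GL J1_subset_GL[of 2] by (auto simp: ZJ_def subset_eq)

lemma scalar_ZJ:
  assumes g: "g \<in> carrier (GL 2)" and z: "red g = z \<cdot>\<^sub>m 1\<^sub>m 2"
  shows "g \<in> ZJ w"
proof -
  note gc = GL_carrier[OF g]
  have "z \<noteq> 0"
  proof
    assume "z = 0"
    then have z0: "red g = 0\<^sub>m 2 2" using z by (auto intro!: eq_matI)
    have "(red g * inv\<^bsub>GL 2\<^esub> (red g)) $$ (0, 0) = 1" using GL_inv(3)[OF red_GL[OF g]] by simp
    moreover have "red g * inv\<^bsub>GL 2\<^esub> (red g) = 0\<^sub>m 2 2"
      using z0 GL_inv(4)[OF red_GL[OF g]] by simp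
    ultimately show False by simp
  qed
  moreover obtain x where x: "res x = z" using res_surj by blast
  ultimately have xu: "x dvd 1" using unit_res by blast
  then obtain y where y: "x * y = 1" by (auto simp: dvd_def)
  have "res y * z = 1" using arg_cong[OF y, of res] x by (simp add: res_times res_1 mult.commute)
  then have "red (y \<cdot>\<^sub>m g) = 1\<^sub>m 2" unfolding red_smult z by (auto intro!: eq_matI)
  then have "y \<cdot>\<^sub>m g \<in> J1 w 2" using gc by (simp add: J1_iff)
  moreover have "g = x \<cdot>\<^sub>m (y \<cdot>\<^sub>m g)" using gc y by (auto intro!: eq_matI simp: mult.assoc[symmetric])
  ultimately show ?thesis using xu unfolding ZJ_def by blast
qed

end

text \<open>The induced representation in the form given by \<open>model_C0\<close>, together with a tower for each \<open>B\<close> in \<open>\<B>\<close>. The matrix \<open>\<Gamma> B\<close> conjugates \<open>C0\<close> to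
  this tower, and \<open>\<gamma> B\<close> is a lift of it.\<close>

locale whittaker_model = cuspidal_induction w res \<psi>0 A m0 \<rho> \<theta> \<chi> \<omega>
    + m: monomial_model "GL 4" "parabolic_induction \<rho> \<chi>"
      "stabilizer \<psi>0 w res 4 (four_block_mat A (0\<^sub>m 3 1) (0\<^sub>m 1 3) ((2 * m0 - mat_trace A) \<cdot>\<^sub>m 1\<^sub>m 1))" \<mu> ev e
  for w :: "'r::{comm_ring_1,finite}" and res :: "'r \<Rightarrow> 'k::{field,finite}" and \<psi>0 :: "'r \<Rightarrow> complex"
    and A :: "'k mat" and m0 :: 'k and \<rho> :: "('r mat, 'v::ab_group_add) rep" and \<theta> :: "'r mat \<Rightarrow> complex"
    and \<chi> \<omega> :: "'r \<Rightarrow> complex" and \<mu> :: "'r mat \<Rightarrow> complex" and ev :: "('r mat \<Rightarrow> 'v) \<Rightarrow> complex" and e +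
  fixes \<B> :: "'k mat set" and b \<Gamma> :: "'k mat \<Rightarrow> 'k mat" and \<gamma> :: "'k mat \<Rightarrow> 'r mat"
  assumes \<mu>_phi: "k \<in> J1 w 4 \<Longrightarrow> \<mu> k = phi4 k"
    and Bc: "B \<in> \<B> \<Longrightarrow> B \<in> carrier_mat 2 2" and b: "B \<in> \<B> \<Longrightarrow> b B \<in> carrier_mat 2 2"
    and \<Gamma>: "B \<in> \<B> \<Longrightarrow> \<Gamma> B \<in> carrier (GL 4)"
    and C0\<Gamma>: "B \<in> \<B> \<Longrightarrow> C0 * \<Gamma> B = \<Gamma> B * tower B (b B)"
    and cover: "x \<in> carrier (GL 4) \<Longrightarrow> a \<in> carrier_mat 2 2 \<Longrightarrow> b' \<in> carrier_mat 2 2 \<Longrightarrow> d \<in> carrier_mat 2 2 \<Longrightarrow>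
      C0 * x = x * four_block_mat a b' (1\<^sub>m 2) d \<Longrightarrow>
      \<exists>B\<in>\<B>. \<exists>g\<in>carrier (GL 2). \<exists>X\<in>carrier_mat 2 2.
        four_block_mat a b' (1\<^sub>m 2) d * shear g X = shear g X * tower B (b B)"
    and free: "B \<in> \<B> \<Longrightarrow> B' \<in> \<B> \<Longrightarrow> g \<in> carrier (GL 2) \<Longrightarrow> X \<in> carrier_mat 2 2 \<Longrightarrow>
      tower B (b B) * shear g X = shear g X * tower B' (b B') \<Longrightarrow>
      B = B' \<and> X = 0\<^sub>m 2 2 \<and> (\<exists>z. g = z \<cdot>\<^sub>m 1\<^sub>m 2)"
    and \<gamma>: "B \<in> \<B> \<Longrightarrow> \<gamma> B \<in> carrier (GL 4)" and red\<gamma>: "B \<in> \<B> \<Longrightarrow> red (\<gamma> B) = \<Gamma> B"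
begin

lemma tow: "B \<in> \<B> \<Longrightarrow> tower B (b B) \<in> carrier_mat 4 4"
  using Bc by simp

lemma J1_stab: "k \<in> J1 w 4 \<Longrightarrow> k \<in> stab4"
  using C0_carrier J1_subset_GL[of 4] J1_iff[of k 4] by (auto simp: stabilizer_iff)

lemma center:
  assumes z: "z dvd 1"
  shows "z \<cdot>\<^sub>m 1\<^sub>m 4 \<in> stab4" "\<mu> (z \<cdot>\<^sub>m 1\<^sub>m 4) = \<omega> z"
proof -
  have "red (z \<cdot>\<^sub>m 1\<^sub>m 4) = res z \<cdot>\<^sub>m 1\<^sub>m 4" by (simp add: red_smult res.mat_hom_one)
  then show st: "z \<cdot>\<^sub>m 1\<^sub>m 4 \<in> stab4"
    using smult_GL[OF z one_GL] C0_carrier carrier_matD[OF C0_carrier]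
    by (simp add: stabilizer_iff mat_distrib_dim)
  have "rep_act \<pi> (z \<cdot>\<^sub>m 1\<^sub>m 4) e = rep_scale \<pi> (\<omega> z) e"
    using \<omega> m.e_V z by (simp add: central_character_def)
  then show "\<mu> (z \<cdot>\<^sub>m 1\<^sub>m 4) = \<omega> z"
    using m.char_eq[OF st] m.ev_scale[OF m.e_V] m.ev_e by simp
qed

text \<open>Conjugating \<open>1 + w E\<close> by \<open>\<gamma> B\<close> turns the character of \<open>C0\<close> into that of \<open>tower B (b B)\<close>. The diagonal
  part of \<open>E\<close> then only meets \<open>B\<close>, and its upper right block only meets the block \<open>1\<close>.\<close>

lemma mu_conj_shear:
  assumes B: "B \<in> \<B>" and z: "z dvd 1" and Y: "Y \<in> carrier_mat 2 2" and X: "X \<in> carrier_mat 2 2"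
    and g: "g = z \<cdot>\<^sub>m (1\<^sub>m 2 + w \<cdot>\<^sub>m Y)"
  shows "\<gamma> B * shear g (w \<cdot>\<^sub>m X) * inv\<^bsub>GL 4\<^esub> (\<gamma> B) \<in> stab4 \<and>
    \<mu> (\<gamma> B * shear g (w \<cdot>\<^sub>m X) * inv\<^bsub>GL 4\<^esub> (\<gamma> B))
      = \<omega> z * phi \<psi>0 w res 2 B (1\<^sub>m 2 + w \<cdot>\<^sub>m Y) * \<psi>0 (w * mat_trace X)"
proof -
  let ?E = "four_block_mat Y X (0\<^sub>m 2 2) Y"
  let ?k = "\<gamma> B * (1\<^sub>m 4 + w \<cdot>\<^sub>m ?E) * inv\<^bsub>GL 4\<^esub> (\<gamma> B)"
  note gi = GL_inv[OF \<gamma>[OF B]] GL_carrier[OF \<gamma>[OF B]]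
  have Ec: "?E \<in> carrier_mat 4 4" using four_block_carrier_mat[OF Y Y] by simp
  have "shear g (w \<cdot>\<^sub>m X) = z \<cdot>\<^sub>m (1\<^sub>m 4 + w \<cdot>\<^sub>m ?E)"
    unfolding g using X Y by (simp add: shear_smult shear_J1)
  moreover have "\<gamma> B * (z \<cdot>\<^sub>m j) * inv\<^bsub>GL 4\<^esub> (\<gamma> B) = (z \<cdot>\<^sub>m 1\<^sub>m 4) * (\<gamma> B * j * inv\<^bsub>GL 4\<^esub> (\<gamma> B))"
    if "j \<in> carrier_mat 4 4" for j
    using carrier_matD[OF gi(5)] carrier_matD[OF gi(4)] carrier_matD[OF that] by (simp add: mat_distrib_dim)
  ultimately have s: "\<gamma> B * shear g (w \<cdot>\<^sub>m X) * inv\<^bsub>GL 4\<^esub> (\<gamma> B) = (z \<cdot>\<^sub>m 1\<^sub>m 4) * ?k"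
    using Ec by simp
  have kJ: "?k \<in> J1 w 4"
    unfolding J1_conj[OF \<gamma>[OF B] Ec] using gi Ec by (intro J1_I) auto
  have rc: "red X \<in> carrier_mat 2 2" "red Y \<in> carrier_mat 2 2" using X Y by auto
  have "\<mu> ?k = psi (mat_trace (tower B (b B) * red ?E))"
    unfolding \<mu>_phi[OF kJ]
    by (rule phi_conj[OF C0_carrier \<gamma>[OF B] Ec tow[OF B]]) (unfold red\<gamma>[OF B], rule C0\<Gamma>[OF B])
  also have "red ?E = four_block_mat (red Y) (red X) (0\<^sub>m 2 2) (red Y)"
    by (subst map_four_block_mat[OF Y X zero_carrier_mat Y]) (simp add: red_zero)
  also have "mat_trace (tower B (b B) * \<dots>) = mat_trace (B * red Y) + mat_trace (b B * 0\<^sub>m 2 2)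
      + (mat_trace (1\<^sub>m 2 * red X) + mat_trace (0\<^sub>m 2 2 * red Y))"
    unfolding tower_def by (rule mat_trace_block_mult) (use Bc[OF B] b[OF B] rc in auto)
  also have "\<dots> = mat_trace (B * red Y) + mat_trace (red X)"
    using b[OF B] rc by (simp add: mat_trace_zero)
  finally have "\<mu> ?k = psi (mat_trace (B * red Y)) * \<psi>0 (w * mat_trace X)"
    using red_trace[OF X] by (simp add: psi_add psi_of_res)
  then have "\<mu> ((z \<cdot>\<^sub>m 1\<^sub>m 4) * ?k) = \<omega> z * phi \<psi>0 w res 2 B (1\<^sub>m 2 + w \<cdot>\<^sub>m Y) * \<psi>0 (w * mat_trace X)"
    using m.char_mult[OF center(1)[OF z] J1_stab[OF kJ], unfolded GL_mult] center(2)[OF z] phi_eq[OF Y]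
    by (simp add: mult.assoc)
  moreover have "(z \<cdot>\<^sub>m 1\<^sub>m 4) * ?k \<in> stab4"
    using subgroup.m_closed[OF m.H center(1)[OF z] J1_stab[OF kJ]] by (simp only: GL_mult)
  ultimately show ?thesis unfolding s by blast
qed

lemma mu_conj_diag:
  assumes "B \<in> \<B>" "z dvd 1" "Y \<in> carrier_mat 2 2" "g = z \<cdot>\<^sub>m (1\<^sub>m 2 + w \<cdot>\<^sub>m Y)"
  shows "\<gamma> B * shear g (0\<^sub>m 2 2) * inv\<^bsub>GL 4\<^esub> (\<gamma> B) \<in> stab4 \<and>
    \<mu> (\<gamma> B * shear g (0\<^sub>m 2 2) * inv\<^bsub>GL 4\<^esub> (\<gamma> B)) = \<omega> z * phi \<psi>0 w res 2 B (1\<^sub>m 2 + w \<cdot>\<^sub>m Y)"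
proof -
  have "w \<cdot>\<^sub>m 0\<^sub>m 2 2 = 0\<^sub>m 2 2" by (auto intro!: eq_matI)
  moreover have "\<psi>0 0 = 1" using psi_of_res[of 0] psi_0 by (simp add: res.hom_zero)
  ultimately show ?thesis
    using mu_conj_shear[OF assms(1-3) zero_carrier_mat assms(4)] by (simp add: mat_trace_zero)
qed

text \<open>The right-hand side depends on \<open>g\<close> alone, and by \<open>mu_conj_diag\<close> it is the value of \<open>omega_phi\<close> for every way of writing \<open>g\<close> as the
  product of a scalar and an element of \<open>J1 w 2\<close>. Hence \<open>omega_phi\<close> is well defined.\<close>

lemma omega_phi_eq:
  assumes B: "B \<in> \<B>" and g: "g \<in> ZJ w"
  shows "omega_phi \<psi>0 w res \<omega> B g = \<mu> (\<gamma> B * shear g (0\<^sub>m 2 2) * inv\<^bsub>GL 4\<^esub> (\<gamma> B))"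
  unfolding omega_phi_def
proof (rule the_equality)
  obtain z Y where "z dvd 1" "Y \<in> carrier_mat 2 2" "g = z \<cdot>\<^sub>m (1\<^sub>m 2 + w \<cdot>\<^sub>m Y)" using g by (rule ZJ_E)
  then show "\<exists>z j. z dvd 1 \<and> j \<in> J1 w 2 \<and> g = z \<cdot>\<^sub>m j \<and>
      \<mu> (\<gamma> B * shear g (0\<^sub>m 2 2) * inv\<^bsub>GL 4\<^esub> (\<gamma> B)) = \<omega> z * phi \<psi>0 w res 2 B j"
    by (intro exI[of _ z] exI[of _ "1\<^sub>m 2 + w \<cdot>\<^sub>m Y"]) (use mu_conj_diag[OF B] J1_I in simp)
  show "x = \<mu> (\<gamma> B * shear g (0\<^sub>m 2 2) * inv\<^bsub>GL 4\<^esub> (\<gamma> B))"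
    if x: "\<exists>z j. z dvd 1 \<and> j \<in> J1 w 2 \<and> g = z \<cdot>\<^sub>m j \<and> x = \<omega> z * phi \<psi>0 w res 2 B j" for x
  proof -
    obtain z j where zj: "z dvd 1" "j \<in> J1 w 2" "g = z \<cdot>\<^sub>m j" "x = \<omega> z * phi \<psi>0 w res 2 B j" using x by blast
    obtain Y where "Y \<in> carrier_mat 2 2" "j = 1\<^sub>m 2 + w \<cdot>\<^sub>m Y" using zj(2) by (rule J1_E)
    then show ?thesis using mu_conj_diag[OF B zj(1)] zj by simp
  qed
qed

definition "N = shear (1\<^sub>m 2) ` (carrier_mat 2 2 :: 'r mat set)"
definition "\<psi>N x = \<psi>0 (mat_trace (unip x))" for x :: "'r mat"

abbreviation "d g \<equiv> shear g (0\<^sub>m 2 2) :: 'r mat"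

lemma \<psi>N: "X \<in> carrier_mat 2 2 \<Longrightarrow> \<psi>N (shear (1\<^sub>m 2) X) = \<psi>0 (mat_trace X)"
  using unip_shear[of X] by (simp add: \<psi>N_def)

lemma N_E: "x \<in> N \<Longrightarrow> \<exists>X\<in>carrier_mat 2 2. x = shear (1\<^sub>m 2) X"
  by (auto simp: N_def)

lemma N_GL: "X \<in> carrier_mat 2 2 \<Longrightarrow> shear (1\<^sub>m 2) X \<in> carrier (GL 4)" for X :: "'r mat"
  by (rule shear_GL[OF one_GL])

lemma N_subgroup: "subgroup N (GL 4)"
proof (rule GL.subgroupI)
  show "N \<subseteq> carrier (GL 4)" "N \<noteq> {}" unfolding N_def using N_GL zero_carrier_mat by auto
  show "inv\<^bsub>GL 4\<^esub> x \<in> N" if x: "x \<in> N" for x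
  proof -
    obtain X where X: "X \<in> carrier_mat 2 2" "x = shear (1\<^sub>m 2) X" using N_E[OF x] by blast
    have "shear (1\<^sub>m 2) (- X) * shear (1\<^sub>m 2) X = 1\<^sub>m 4"
      unfolding shear_unip_0[symmetric] using X(1) by (subst shear_unip_mult) auto
    then have "inv\<^bsub>GL 4\<^esub> x = shear (1\<^sub>m 2) (- X)"
      unfolding X(2) using N_GL[OF X(1)] X(1) by (intro GL_inv_eq) auto
    then show ?thesis using X(1) by (auto simp: N_def)
  qed
  show "x \<otimes>\<^bsub>GL 4\<^esub> y \<in> N" if x: "x \<in> N" and y: "y \<in> N" for x y
  proof -
    obtain X Y where XY: "X \<in> carrier_mat 2 2" "x = shear (1\<^sub>m 2) X" "Y \<in> carrier_mat 2 2" "y = shear (1\<^sub>m 2) Y"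
      using N_E[OF x] N_E[OF y] by blast
    show ?thesis
      unfolding GL_mult XY(2,4) shear_unip_mult[OF XY(1,3)] N_def using XY by auto
  qed
qed

lemma d_GL: "g \<in> carrier (GL 2) \<Longrightarrow> d g \<in> carrier (GL 4)"
  by (rule shear_GL[OF _ zero_carrier_mat])

lemma conj_N:
  assumes g: "g \<in> carrier (GL 2)" and X: "X \<in> carrier_mat 2 2"
  shows "d g * shear (1\<^sub>m 2) X * inv\<^bsub>GL 4\<^esub> (d g) = shear (1\<^sub>m 2) (g * X * inv\<^bsub>GL 2\<^esub> g)"
    "g * X * inv\<^bsub>GL 2\<^esub> g \<in> carrier_mat 2 2" "mat_trace (g * X * inv\<^bsub>GL 2\<^esub> g) = mat_trace X"
  using shear_conj[OF g X] GL_inv[OF g] GL_carrier[OF g] X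
    mat_trace_conj[OF X GL_carrier[OF g] GL_inv(4)[OF g] GL_inv(2)[OF g]]
  by auto

lemma assoc_dn:
  assumes "B \<in> \<B>" "g \<in> carrier (GL 2)" "X \<in> carrier_mat 2 2"
  shows "\<gamma> B * d g * shear (1\<^sub>m 2) X * inv\<^bsub>GL 4\<^esub> (\<gamma> B') = \<gamma> B * shear g X * inv\<^bsub>GL 4\<^esub> (\<gamma> B')"
  using assoc_mult_mat[OF GL_carrier[OF \<gamma>[OF assms(1)]] GL_carrier[OF d_GL[OF assms(2)]] GL_carrier[OF N_GL[OF assms(3)]]]
    shear_diag_unip[OF GL_carrier[OF assms(2)] assms(3)] by simp

text \<open>If this element lies in the stabilizer, then modulo \<open>w\<close> the product \<open>d g * x\<close> intertwines the towers of \<open>B\<close> and \<open>B'\<close>. So \<open>B = B'\<close>, the reduction of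
  \<open>g\<close> is scalar and \<open>x\<close> reduces to \<open>1\<close>.\<close>

lemma double_coset_free:
  assumes B: "B \<in> \<B>" and B': "B' \<in> \<B>" and g: "g \<in> carrier (GL 2)" and x: "x \<in> N"
    and st: "\<gamma> B * d g * x * inv\<^bsub>GL 4\<^esub> (\<gamma> B') \<in> stab4"
  shows "B = B' \<and> g \<in> ZJ w \<and>
    \<mu> (\<gamma> B * d g * x * inv\<^bsub>GL 4\<^esub> (\<gamma> B')) = omega_phi \<psi>0 w res \<omega> B g * \<psi>N x"
proof -
  obtain X where X: "X \<in> carrier_mat 2 2" "x = shear (1\<^sub>m 2) X" using N_E[OF x] by blast
  note gc = GL_carrier[OF g] and \<gamma>c = GL_carrier[OF \<gamma>[OF B]] GL_carrier[OF \<gamma>[OF B']]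
    and \<gamma>i = GL_inv[OF \<gamma>[OF B']] and \<Gamma>c = GL_carrier[OF \<Gamma>[OF B]] GL_carrier[OF \<Gamma>[OF B']]
  let ?s = "\<gamma> B * shear g X * inv\<^bsub>GL 4\<^esub> (\<gamma> B')"
  have st': "?s \<in> stab4" using st unfolding X(2) assoc_dn[OF B g X(1)] .
  have sc: "?s \<in> carrier_mat 4 4" and C0s: "C0 * red ?s = red ?s * C0"
    using st' C0_carrier GL_carrier by (auto simp: stabilizer_iff)
  have rs: "red ?s \<in> carrier_mat 4 4" using sc by simp
  have shc: "shear g X \<in> carrier_mat 4 4" using gc by simp
  let ?S = "shear (red g) (red X)"
  have Sc: "?S \<in> carrier_mat 4 4" using gc by simp
  have "?s * \<gamma> B' = \<gamma> B * shear g X"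
    using assoc_mult_mat[OF mult_carrier_mat[OF \<gamma>c(1) shc] \<gamma>i(4) \<gamma>c(2)] \<gamma>i(2) right_mult_one_mat[OF mult_carrier_mat[OF \<gamma>c(1) shc]] by simp
  then have eq: "red ?s * \<Gamma> B' = \<Gamma> B * ?S"
    using red_mult[OF sc \<gamma>c(2)] red_mult[OF \<gamma>c(1) shc] red\<gamma>[OF B] red\<gamma>[OF B'] red_shear[OF gc X(1)] by simp
  have "\<Gamma> B * (tower B (b B) * ?S) = C0 * \<Gamma> B * ?S"
    unfolding C0\<Gamma>[OF B] by (rule assoc_mult_mat[OF \<Gamma>c(1) tow[OF B] Sc, symmetric])
  also have "\<dots> = C0 * red ?s * \<Gamma> B'"
    unfolding assoc_mult_mat[OF C0_carrier \<Gamma>c(1) Sc] eq[symmetric]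
    by (rule assoc_mult_mat[OF C0_carrier rs \<Gamma>c(2), symmetric])
  also have "\<dots> = red ?s * (\<Gamma> B' * tower B' (b B'))"
    unfolding C0s C0\<Gamma>[OF B', symmetric] by (rule assoc_mult_mat[OF rs C0_carrier \<Gamma>c(2)])
  also have "\<dots> = red ?s * \<Gamma> B' * tower B' (b B')"
    by (rule assoc_mult_mat[OF rs \<Gamma>c(2) tow[OF B'], symmetric])
  also have "\<dots> = \<Gamma> B * (?S * tower B' (b B'))"
    unfolding eq by (rule assoc_mult_mat[OF \<Gamma>c(1) Sc tow[OF B']])
  finally have "tower B (b B) * ?S = ?S * tower B' (b B')"
    by (rule mult_cancel_GL[OF \<Gamma>[OF B] mult_carrier_mat[OF tow[OF B] Sc] mult_carrier_mat[OF Sc tow[OF B']]])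
  then have fr: "B = B'" "red X = 0\<^sub>m 2 2" "\<exists>z. red g = z \<cdot>\<^sub>m 1\<^sub>m 2"
    using free[OF B B' red_GL[OF g], of "red X"] X(1) by (simp_all only: red_carrier)
  have gZ: "g \<in> ZJ w" using scalar_ZJ[OF g] fr(3) by blast
  obtain z Y where zY: "z dvd 1" "Y \<in> carrier_mat 2 2" "g = z \<cdot>\<^sub>m (1\<^sub>m 2 + w \<cdot>\<^sub>m Y)" using gZ by (rule ZJ_E)
  obtain X' where X': "X' \<in> carrier_mat 2 2" "X = w \<cdot>\<^sub>m X'" using X(1) fr(2) by (rule red_eq_zero_E)
  have "\<psi>N x = \<psi>0 (w * mat_trace X')"
    unfolding X(2) \<psi>N[OF X(1)] by (simp add: X'(2) mat_trace_smult[OF X'(1)])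
  then have "\<mu> ?s = omega_phi \<psi>0 w res \<omega> B g * \<psi>N x"
    using mu_conj_shear[OF B zY(1,2) X'(1) zY(3)] mu_conj_diag[OF B zY] omega_phi_eq[OF B gZ] fr(1)
    by (simp only: X'(2))
  then show "B = B' \<and> g \<in> ZJ w \<and> \<mu> (\<gamma> B * d g * x * inv\<^bsub>GL 4\<^esub> (\<gamma> B')) = omega_phi \<psi>0 w res \<omega> B g * \<psi>N x"
    using fr(1) gZ unfolding X(2) assoc_dn[OF B g X(1)] by simp
qed

text \<open>Compatibility on the congruence subgroup of \<open>N\<close> says that \<open>x\<close>, modulo \<open>w\<close>, conjugates \<open>C0\<close> to a matrix with lower
  left block \<open>1\<close>. Such a matrix is conjugate to one of the towers by some \<open>shear g X\<close>.\<close>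

lemma double_coset_cover:
  assumes x: "x \<in> carrier (GL 4)"
    and compat: "\<And>n. n \<in> N \<Longrightarrow> x * n * inv\<^bsub>GL 4\<^esub> x \<in> stab4 \<Longrightarrow> \<mu> (x * n * inv\<^bsub>GL 4\<^esub> x) = \<psi>N n"
  shows "\<exists>B\<in>\<B>. \<exists>g\<in>carrier (GL 2). \<exists>n\<in>N. \<exists>h\<in>stab4. x = h * \<gamma> B * d g * n"
proof -
  have w0: "w \<cdot>\<^sub>m 0\<^sub>m 2 2 = 0\<^sub>m 2 2" by (auto intro!: eq_matI)
  note xi = GL_inv[OF x] GL_carrier[OF x]
  have rx: "red x \<in> carrier (GL 4)" using red_GL[OF x] .
  note rxi = GL_inv[OF rx] GL_carrier[OF rx]
  let ?C = "inv\<^bsub>GL 4\<^esub> (red x) * (C0 * red x)"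
  have Cc: "?C \<in> carrier_mat 4 4" using rxi C0_carrier by auto
  have C0x: "C0 * red x = red x * ?C"
    using assoc_mult_mat[OF rxi(5,4) mult_carrier_mat[OF C0_carrier rxi(5)]] rxi(3)
      left_mult_one_mat[OF mult_carrier_mat[OF C0_carrier rxi(5)]] by simp
  obtain a b' d' f where C: "a \<in> carrier_mat 2 2" "b' \<in> carrier_mat 2 2" "d' \<in> carrier_mat 2 2" "f \<in> carrier_mat 2 2"
    "?C = four_block_mat a b' d' f"
    by (rule four_block_split[of ?C 2 2 2 2]) (use Cc in auto)
  have "d' = 1\<^sub>m 2"
  proof (rule psi_trace_eqD[OF C(3) one_carrier_mat])
    fix Z :: "'k mat" assume "Z \<in> carrier_mat 2 2"
    then obtain X where X: "X \<in> carrier_mat 2 2" "red X = Z" by (rule lift_mat)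
    let ?E = "four_block_mat (0\<^sub>m 2 2) X (0\<^sub>m 2 2) (0\<^sub>m 2 2)"
    let ?n = "shear (1\<^sub>m 2) (w \<cdot>\<^sub>m X)"
    have Ec: "?E \<in> carrier_mat 4 4" using four_block_carrier_mat[of "0\<^sub>m 2 2" 2 2 "0\<^sub>m 2 2" 2 2] by simp
    have n: "?n = 1\<^sub>m 4 + w \<cdot>\<^sub>m ?E" using shear_J1[OF zero_carrier_mat X(1)] by (simp add: w0)
    have rc: "red X \<in> carrier_mat 2 2" using X(1) by simp
    have xJ: "x * ?n * inv\<^bsub>GL 4\<^esub> x \<in> J1 w 4"
      unfolding n J1_conj[OF x Ec] using xi Ec by (intro J1_I) auto
    have "\<psi>0 (w * mat_trace X) = \<mu> (x * ?n * inv\<^bsub>GL 4\<^esub> x)"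
      using compat[of ?n] J1_stab[OF xJ] X(1) \<psi>N[of "w \<cdot>\<^sub>m X"] by (simp add: N_def mat_trace_smult[OF X(1)])
    also have "\<dots> = psi (mat_trace (?C * red ?E))"
      unfolding n \<mu>_phi[OF xJ[unfolded n]] by (rule phi_conj[OF C0_carrier x Ec Cc C0x])
    also have "red ?E = four_block_mat (0\<^sub>m 2 2) (red X) (0\<^sub>m 2 2) (0\<^sub>m 2 2)"
      by (subst map_four_block_mat[OF zero_carrier_mat X(1) zero_carrier_mat zero_carrier_mat]) (simp add: red_zero)
    also have "mat_trace (?C * \<dots>) = mat_trace (a * 0\<^sub>m 2 2) + mat_trace (b' * 0\<^sub>m 2 2)
        + (mat_trace (d' * red X) + mat_trace (f * 0\<^sub>m 2 2))"
      unfolding C(5) by (rule mat_trace_block_mult) (use C rc in auto)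
    also have "\<dots> = mat_trace (d' * red X)" using C by (simp add: mat_trace_zero)
    finally have "psi (mat_trace (d' * red X)) = \<psi>0 (w * mat_trace X)" by simp
    also have "\<dots> = psi (mat_trace (red X))" using red_trace[OF X(1)] by (simp add: psi_of_res)
    finally show "psi (mat_trace (d' * Z)) = psi (mat_trace (1\<^sub>m 2 * Z))"
      using X rc by simp
  qed
  then obtain B g X where B: "B \<in> \<B>" "g \<in> carrier (GL 2)" "X \<in> carrier_mat 2 2"
    "?C * shear g X = shear g X * tower B (b B)"
    using cover[OF rx C(1,2,4)] C0x C(5) by auto
  obtain g' where g': "g' \<in> carrier (GL 2)" "red g' = g" using B(2) by (rule lift_GL)
  obtain X' where X': "X' \<in> carrier_mat 2 2" "red X' = X" using B(3) by (rule lift_mat)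
  have sh: "shear g' X' \<in> carrier (GL 4)" using shear_GL[OF g'(1) X'(1)] .
  note shi = GL_inv[OF sh] GL_carrier[OF sh] and \<gamma>i = GL_inv[OF \<gamma>[OF B(1)]] GL_carrier[OF \<gamma>[OF B(1)]]
    and \<Gamma>c = GL_carrier[OF \<Gamma>[OF B(1)]]
  let ?h = "x * shear g' X' * inv\<^bsub>GL 4\<^esub> (\<gamma> B)"
  have hG: "?h \<in> carrier (GL 4)" using GL_m_closed[OF GL_m_closed[OF x sh] \<gamma>i(1)] .
  note hc = GL_carrier[OF hG]
  have rh: "red ?h \<in> carrier_mat 4 4" using hc by simp
  have Sc: "shear g X \<in> carrier_mat 4 4" using GL_carrier[OF B(2)] by simp
  have h\<gamma>: "?h * \<gamma> B = x * shear g' X'"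
    using assoc_mult_mat[OF mult_carrier_mat[OF xi(5) shi(5)] \<gamma>i(4,5)] \<gamma>i(2) right_mult_one_mat[OF mult_carrier_mat[OF xi(5) shi(5)]] by simp
  then have eq: "red ?h * \<Gamma> B = red x * shear g X"
    using red_mult[OF hc \<gamma>i(5)] red_mult[OF xi(5) shi(5)] red\<gamma>[OF B(1)] red_shear[OF GL_carrier[OF g'(1)] X'(1)] g'(2) X'(2) by simp
  have "red ?h * C0 * \<Gamma> B = red ?h * (\<Gamma> B * tower B (b B))"
    unfolding C0\<Gamma>[OF B(1), symmetric] by (rule assoc_mult_mat[OF rh C0_carrier \<Gamma>c])
  also have "\<dots> = red x * shear g X * tower B (b B)"
    unfolding eq[symmetric] by (rule assoc_mult_mat[OF rh \<Gamma>c tow[OF B(1)], symmetric])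
  also have "\<dots> = red x * (?C * shear g X)"
    unfolding B(4) by (rule assoc_mult_mat[OF rxi(5) Sc tow[OF B(1)]])
  also have "\<dots> = (red x * ?C) * shear g X"
    by (rule assoc_mult_mat[OF rxi(5) Cc Sc, symmetric])
  also have "red x * ?C = C0 * red x" by (rule C0x[symmetric])
  also have "C0 * red x * shear g X = C0 * (red ?h * \<Gamma> B)"
    unfolding eq by (rule assoc_mult_mat[OF C0_carrier rxi(5) Sc])
  also have "\<dots> = C0 * red ?h * \<Gamma> B"
    by (rule assoc_mult_mat[OF C0_carrier rh \<Gamma>c, symmetric])
  finally have e1: "red ?h * C0 * \<Gamma> B = C0 * red ?h * \<Gamma> B" .
  have "C0 * red ?h = red ?h * C0"
  proof -
    note \<Gamma>i = GL_inv[OF \<Gamma>[OF B(1)]]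
    have "red ?h * C0 * \<Gamma> B * inv\<^bsub>GL 4\<^esub> (\<Gamma> B) = C0 * red ?h * \<Gamma> B * inv\<^bsub>GL 4\<^esub> (\<Gamma> B)" using e1 by simp
    then show ?thesis
      using assoc_mult_mat[OF mult_carrier_mat[OF rh C0_carrier] \<Gamma>c \<Gamma>i(4)]
        assoc_mult_mat[OF mult_carrier_mat[OF C0_carrier rh] \<Gamma>c \<Gamma>i(4)] \<Gamma>i(3)
        right_mult_one_mat[OF mult_carrier_mat[OF rh C0_carrier]]
        right_mult_one_mat[OF mult_carrier_mat[OF C0_carrier rh]] by simp
  qed
  then have hst: "?h \<in> stab4" using hG C0_carrier by (simp add: stabilizer_iff)
  \<comment> \<open>The inverse of \<open>d g * n\<close> is again of this form, because \<open>d g\<close> normalizes \<open>N\<close>.\<close>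
  let ?g = "inv\<^bsub>GL 2\<^esub> g'" and ?n = "shear (1\<^sub>m 2) (- (g' * X' * inv\<^bsub>GL 2\<^esub> g'))"
  note g'i = GL_inv[OF g'(1)] GL_carrier[OF g'(1)]
  have nZ: "- (g' * X' * inv\<^bsub>GL 2\<^esub> g') \<in> carrier_mat 2 2" using g'i X' by auto
  have dc: "d ?g \<in> carrier_mat 4 4" and nc: "?n \<in> carrier_mat 4 4" using g'i(4) by simp_all
  have "shear g' X' * (d ?g * ?n) = 1\<^sub>m 4"
  proof -
    have e: "?g * - (g' * X' * ?g) = - (X' * ?g)"
    proof -
      have "?g * (g' * (X' * ?g)) = X' * ?g"
        using assoc_mult_mat[OF g'i(4,5) mult_carrier_mat[OF X'(1) g'i(4)]] g'i(2)
          left_mult_one_mat[OF mult_carrier_mat[OF X'(1) g'i(4)]] by simp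
      then show ?thesis using carrier_matD[OF g'i(4)] carrier_matD[OF g'i(5)] carrier_matD[OF X'(1)]
        by (simp add: mat_assoc_dim)
    qed
    have "d ?g * ?n = shear ?g (- (g' * X' * ?g))" by (rule shear_diag_unip[OF g'i(4) nZ])
    then have "shear g' X' * (d ?g * ?n)
        = four_block_mat (g' * ?g) (g' * (?g * - (g' * X' * ?g)) + g' * X' * ?g) (0\<^sub>m 2 2) (g' * ?g)"
      using shear_mult[OF g'i(5,4) X'(1) nZ] by simp
    also have "g' * (?g * - (g' * X' * ?g)) + g' * X' * ?g = 0\<^sub>m 2 2"
      unfolding e using carrier_matD[OF g'i(4)] carrier_matD[OF g'i(5)] carrier_matD[OF X'(1)]
      by (simp add: mat_assoc_dim) (auto intro!: eq_matI)
    finally show ?thesis using g'i(3) four_block_one_mat[of 2 2] by simp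
  qed
  then have "x = x * shear g' X' * (d ?g * ?n)"
    using assoc_mult_mat[OF xi(5) shi(5) mult_carrier_mat[OF dc nc]] right_mult_one_mat[OF xi(5)] by simp
  also have "\<dots> = ?h * \<gamma> B * d ?g * ?n"
    unfolding h\<gamma> by (rule assoc_mult_mat[OF mult_carrier_mat[OF xi(5) shi(5)] dc nc, symmetric])
  finally show "\<exists>B\<in>\<B>. \<exists>g\<in>carrier (GL 2). \<exists>n\<in>N. \<exists>h\<in>stab4. x = h * \<gamma> B * d g * n"
    using B(1) g'i(1) hst nZ unfolding N_def by blast
qed

text \<open>The double cosets that meet the compatibility condition are those of the \<open>\<gamma> B * d g\<close>, and the stabilizers are \<open>ZJ w\<close>.\<close>

theorem whittaker_iso:
  "rep_iso (GL 2) (degenerate_whittaker \<psi>0 \<pi>)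
    (direct_sum \<B> (\<lambda>B. induced (GL 2) (ZJ w) (char_rep (omega_phi \<psi>0 w res \<omega> B))))"
proof -
  have fin: "finite \<B>"
    by (rule finite_subset[OF _ finite_carrier_mat[of 2 2]]) (use Bc in auto)
  have d_hom: "d \<in> hom (GL 2) (GL 4)"
    using d_GL by (auto simp: hom_def GL_mult shear_diag_mult GL_carrier)
  have \<psi>0_add: "\<psi>0 (x + y) = \<psi>0 x * \<psi>0 y" and \<psi>0_nz: "\<psi>0 x \<noteq> 0" for x y
    using \<psi>0 by (auto simp: additive_character_def)
  have iso: "rep_iso (GL 2)
    \<lparr>rep_scale = rep_scale \<pi>, rep_space = {v \<in> rep_space \<pi>. \<forall>n\<in>N. rep_act \<pi> n v = rep_scale \<pi> (\<psi>N n) v},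
      rep_act = \<lambda>g. rep_act \<pi> (d g)\<rparr>
    (direct_sum \<B> (\<lambda>B. induced (GL 2) (ZJ w) (char_rep (omega_phi \<psi>0 w res \<omega> B))))"
  proof (rule m.isotypic_part_decomposition[OF group_GL finite_GL d_hom N_subgroup, of \<psi>N \<B> \<gamma>], unfold GL_mult)
    fix x y :: "'r mat" assume x: "x \<in> N" and y: "y \<in> N"
    obtain X Y where "X \<in> carrier_mat 2 2" "x = shear (1\<^sub>m 2) X" "Y \<in> carrier_mat 2 2" "y = shear (1\<^sub>m 2) Y"
      using N_E[OF x] N_E[OF y] by blast
    then show "\<psi>N (x * y) = \<psi>N x * \<psi>N y"
      by (simp add: shear_unip_mult \<psi>N mat_trace_add[of _ 2] \<psi>0_add)
  next
    show "\<psi>N x \<noteq> 0" for x unfolding \<psi>N_def by (rule \<psi>0_nz)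
  next
    fix g x :: "'r mat" assume g: "g \<in> carrier (GL 2)" and "x \<in> N"
    then obtain X where X: "X \<in> carrier_mat 2 2" "x = shear (1\<^sub>m 2) X" using N_E by blast
    show "d g * x * inv\<^bsub>GL 4\<^esub> (d g) \<in> N"
      unfolding X(2) conj_N(1)[OF g X(1)] using conj_N(2)[OF g X(1)] by (auto simp: N_def)
    show "\<psi>N (d g * x * inv\<^bsub>GL 4\<^esub> (d g)) = \<psi>N x"
      unfolding X(2) conj_N(1)[OF g X(1)] \<psi>N[OF conj_N(2)[OF g X(1)]] \<psi>N[OF X(1)] conj_N(3)[OF g X(1)] ..
  next
    show "finite \<B>" by (rule fin)
    show "ZJ w \<subseteq> carrier (GL 2)" by (rule ZJ_GL)
  next
    fix B assume "B \<in> \<B>" then show "\<gamma> B \<in> carrier (GL 4)" by (rule \<gamma>)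
  next
    fix B :: "'k mat" and g :: "'r mat" assume B: "B \<in> \<B>" and g: "g \<in> ZJ w"
    obtain z Y where "z dvd 1" "Y \<in> carrier_mat 2 2" "g = z \<cdot>\<^sub>m (1\<^sub>m 2 + w \<cdot>\<^sub>m Y)" using g by (rule ZJ_E)
    then show "\<gamma> B * d g * inv\<^bsub>GL 4\<^esub> (\<gamma> B) \<in> stab4" using mu_conj_diag[OF B] by blast
    show "\<mu> (\<gamma> B * d g * inv\<^bsub>GL 4\<^esub> (\<gamma> B)) = omega_phi \<psi>0 w res \<omega> B g" using omega_phi_eq[OF B g] by simp
  qed (rule double_coset_free double_coset_cover; assumption)+
  have sp: "{v \<in> rep_space \<pi>. \<forall>n\<in>N. rep_act \<pi> n v = rep_scale \<pi> (\<psi>N n) v} =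
      {v \<in> rep_space \<pi>. \<forall>X\<in>carrier_mat 2 2.
        rep_act \<pi> (four_block_mat (1\<^sub>m 2) X (0\<^sub>m 2 2) (1\<^sub>m 2)) v = rep_scale \<pi> (\<psi>0 (mat_trace X)) v}"
  proof -
    have "shear (1\<^sub>m 2) X = four_block_mat (1\<^sub>m 2) X (0\<^sub>m 2 2) (1\<^sub>m 2)" if "X \<in> carrier_mat 2 2" for X :: "'r mat"
      using that by (simp add: shear_def)
    then show ?thesis unfolding N_def using \<psi>N by (auto simp: ball_simps)
  qed
  have dg: "d g = four_block_mat g (0\<^sub>m 2 2) (0\<^sub>m 2 2) g" if "g \<in> carrier (GL 2)" for g
    using GL_carrier[OF that] by (simp add: shear_def)
  \<comment> \<open>The two descriptions of the Whittaker space have actions that agree on the group.\<close>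
  show ?thesis
    using iso unfolding sp degenerate_whittaker_def rep_iso_def representation_def
    by (simp add: dg group.is_monoid[OF group_GL, THEN monoid.m_closed] GL.one_closed)
qed

end

theorem (in cuspidal_induction) whittaker_decomposition:
  assumes reps: "class_representatives {B \<in> carrier_mat 2 2. regular_mat B \<and> mat_trace B = 2 * m0} \<B>"
  shows "rep_iso (GL 2) (degenerate_whittaker \<psi>0 \<pi>)
    (direct_sum \<B> (\<lambda>B. induced (GL 2) (ZJ w) (char_rep (omega_phi \<psi>0 w res \<omega> B))))"
proof -
  have tc: "t + c = 2 * m0" by (simp add: t_def)
  obtain b \<Gamma> where
    b: "\<And>B. B \<in> \<B> \<Longrightarrow> b B \<in> carrier_mat 2 2"
    and \<Gamma>: "\<And>B. B \<in> \<B> \<Longrightarrow> \<Gamma> B \<in> carrier (GL 4)"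
    and C0\<Gamma>: "\<And>B. B \<in> \<B> \<Longrightarrow> C0 * \<Gamma> B = \<Gamma> B * tower B (b B)"
    and cover: "\<And>x a b' d. x \<in> carrier (GL 4) \<Longrightarrow> a \<in> carrier_mat 2 2 \<Longrightarrow> b' \<in> carrier_mat 2 2 \<Longrightarrow> d \<in> carrier_mat 2 2 \<Longrightarrow>
      C0 * x = x * four_block_mat a b' (1\<^sub>m 2) d \<Longrightarrow>
      \<exists>B\<in>\<B>. \<exists>g\<in>carrier (GL 2). \<exists>X\<in>carrier_mat 2 2.
        four_block_mat a b' (1\<^sub>m 2) d * shear g X = shear g X * tower B (b B)"
    and free: "\<And>B B' g X. B \<in> \<B> \<Longrightarrow> B' \<in> \<B> \<Longrightarrow> g \<in> carrier (GL 2) \<Longrightarrow> X \<in> carrier_mat 2 2 \<Longrightarrow>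
      tower B (b B) * shear g X = shear g X * tower B' (b B') \<Longrightarrow>
      B = B' \<and> X = 0\<^sub>m 2 2 \<and> (\<exists>z. g = z \<cdot>\<^sub>m 1\<^sub>m 2)"
    by (rule tower_classification[unfolded tc, OF reps]) (rule that)
  have "\<forall>B\<in>\<B>. \<exists>g. g \<in> carrier (GL 4) \<and> red g = \<Gamma> B" using lift_GL \<Gamma> by metis
  then obtain \<gamma> where \<gamma>: "\<And>B. B \<in> \<B> \<Longrightarrow> \<gamma> B \<in> carrier (GL 4)" "\<And>B. B \<in> \<B> \<Longrightarrow> red (\<gamma> B) = \<Gamma> B"
    by metis
  obtain \<mu> ev e where m: "monomial_model (GL 4) \<pi> stab4 \<mu> ev e" and \<mu>: "\<And>k. k \<in> J1 w 4 \<Longrightarrow> \<mu> k = phi4 k"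
    using model_C0 by blast
  have "B \<in> carrier_mat 2 2" if "B \<in> \<B>" for B
    using reps that by (auto simp: class_representatives_def)
  then have "whittaker_model_axioms w res \<psi>0 A m0 \<mu> \<B> b \<Gamma> \<gamma>"
    by (intro whittaker_model_axioms.intro \<mu> b \<Gamma> C0\<Gamma> cover free \<gamma>)
  then show ?thesis
    by (rule whittaker_model.whittaker_iso[OF whittaker_model.intro[OF cuspidal_induction_axioms m]])
qed

section \<open>Quotients of rings of integers\<close>

text \<open>The monic polynomial is \<open>x - 1\<close>.\<close>

lemma one_in_integral_closure:
  fixes \<iota> :: "'a::field \<Rightarrow> 'b::field"
  assumes \<iota>: "field_embedding \<iota>" and S: "0 \<in> S" "1 \<in> S" "- 1 \<in> S"
  shows "1 \<in> integral_closure \<iota> S"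
proof -
  have add: "\<iota> (x + y) = \<iota> x + \<iota> y" and \<iota>1: "\<iota> 1 = 1" for x y
    using \<iota> by (auto simp: field_embedding_def)
  have \<iota>0: "\<iota> 0 = 0" using add[of 0 0] by (simp only: add_0_left add_cancel_right_right)
  have "\<iota> (- 1) = - 1" using add[of 1 "- 1"] \<iota>0 \<iota>1 by (simp add: eq_neg_iff_add_eq_0 add.commute)
  then have "poly (map_poly \<iota> [:- 1, 1:]) 1 = 0"
    using \<iota>0 \<iota>1 by (simp add: map_poly_pCons)
  moreover have "poly.coeff [:- 1, 1:] i \<in> S" for i
    using S by (simp add: coeff_pCons split: nat.split)
  ultimately show ?thesis
    unfolding integral_closure_def by (intro CollectI exI[of _ "[:- 1, 1:]"]) simp
qed

lemma one_in_unramified_integers: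
  assumes "unramified_integers TYPE('p::prime_card) R"
  shows "1 \<in> R"
proof -
  have "0 \<in> range (to_fract :: 'p padic_int \<Rightarrow> _)" "1 \<in> range (to_fract :: 'p padic_int \<Rightarrow> _)"
    "- 1 \<in> range (to_fract :: 'p padic_int \<Rightarrow> _)"
    by (auto intro: range_eqI[of _ _ 0] range_eqI[of _ _ 1] range_eqI[of _ _ "- 1"])
  moreover have "0 \<in> range (fps_to_fls :: 'p mod_ring fps \<Rightarrow> _)" "1 \<in> range (fps_to_fls :: 'p mod_ring fps \<Rightarrow> _)"
    "- 1 \<in> range (fps_to_fls :: 'p mod_ring fps \<Rightarrow> _)"
    by (auto intro: range_eqI[of _ _ 0] range_eqI[of _ _ 1] range_eqI[of _ _ "- 1"])
  ultimately show ?thesis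
    using assms unfolding unramified_integers_def finite_extension_def
    by (elim disjE exE conjE) (simp_all only: one_in_integral_closure)
qed

text \<open>Multiplication by \<open>varpi\<close> is injective on the field, so that \<open>varpi * a\<close> is a multiple of \<open>varpi\<^sup>2\<close> exactly if \<open>a\<close> is a multiple of
  \<open>varpi\<close>. This is the annihilator condition.\<close>

lemma length_two_quotient:
  assumes one: "1 \<in> R" and unif: "uniformizer R varpi"
    and quo: "quotient_map R {varpi\<^sup>2 * x |x. x \<in> R} quo"
    and res: "quotient_map R {varpi * x |x. x \<in> R} (\<lambda>x. res (quo x))"
    and \<psi>0: "additive_character \<psi>0" "\<exists>x. \<psi>0 (quo varpi * x) \<noteq> 1"
  shows "length_two (quo varpi) res \<psi>0"
proof -
  have v0: "varpi \<noteq> 0" and nonunits: "{x \<in> R. \<forall>y\<in>R. x * y \<noteq> 1} = {varpi * y |y. y \<in> R}"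
    using unif by (auto simp: uniformizer_def)
  have vR: "varpi * x \<in> R" if "x \<in> R" for x using nonunits that by blast
  have v: "varpi \<in> R" using vR[OF one] by simp
  have q1: "quo 1 = 1" and qadd: "quo (x + y) = quo x + quo y" and qmult: "quo (x * y) = quo x * quo y"
    if "x \<in> R" "y \<in> R" for x y
    using quo that by (auto simp: quotient_map_def)
  have qsurj: "\<exists>a\<in>R. y = quo a" for y
  proof -
    have "y \<in> quo ` R" using quo unfolding quotient_map_def by simp
    then show ?thesis by blast
  qed
  have qker: "quo a = 0 \<longleftrightarrow> (\<exists>x\<in>R. a = varpi\<^sup>2 * x)" if "a \<in> R" for a
    using quo that unfolding quotient_map_def by blast
  have r1: "res (quo 1) = 1" and radd: "res (quo (x + y)) = res (quo x) + res (quo y)"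
    and rmult: "res (quo (x * y)) = res (quo x) * res (quo y)" if "x \<in> R" "y \<in> R" for x y
    using res that by (auto simp: quotient_map_def)
  have rsurj: "\<exists>a\<in>R. y = res (quo a)" for y
  proof -
    have "y \<in> (\<lambda>x. res (quo x)) ` R" using res unfolding quotient_map_def by simp
    then show ?thesis by blast
  qed
  have rker: "res (quo a) = 0 \<longleftrightarrow> (\<exists>x\<in>R. a = varpi * x)" if "a \<in> R" for a
    using res that unfolding quotient_map_def by blast
  show ?thesis
  proof
    show "res 1 = 1" using q1[OF one one] r1[OF one one] by simp
    fix x y
    obtain a b where a: "a \<in> R" "x = quo a" and b: "b \<in> R" "y = quo b" using qsurj by metis
    show "res (x + y) = res x + res y" "res (x * y) = res x * res y"
      unfolding a(2) b(2) qadd[OF a(1) b(1), symmetric] qmult[OF a(1) b(1), symmetric]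
      using radd rmult a b by auto
    have "quo varpi * x = 0 \<longleftrightarrow> (\<exists>x\<in>R. varpi * a = varpi\<^sup>2 * x)"
      unfolding a(2) qmult[OF v a(1), symmetric] by (rule qker[OF vR[OF a(1)]])
    then show "quo varpi * x = 0 \<longleftrightarrow> res x = 0"
      unfolding a(2) rker[OF a(1)] using v0 by (simp add: power2_eq_square mult.assoc)
    show "res x = 0 \<longleftrightarrow> (\<exists>y. x = quo varpi * y)"
    proof
      assume "res x = 0"
      then obtain z where "z \<in> R" "a = varpi * z" using rker[OF a(1)] a(2) by blast
      then show "\<exists>y. x = quo varpi * y" using a(2) qmult[OF v] by blast
    next
      assume "\<exists>y. x = quo varpi * y"
      then obtain z where z: "z \<in> R" "x = quo varpi * quo z" using qsurj by metis
      then show "res x = 0" using qmult[OF v z(1)] rker[OF vR[OF z(1)]] by auto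
    qed
  next
    show "\<exists>y. res y = z" for z using rsurj by metis
  qed (rule \<psi>0)+
qed

theorem theorem1p4:
  fixes \<oo> :: "'f::field set" and varpi :: 'f
    and quo :: "'f \<Rightarrow> 'r::{comm_ring_1,finite}" and res :: "'r \<Rightarrow> 'k::{field,finite}"
    and \<psi>0 :: "'r \<Rightarrow> complex"
    and \<rho> :: "('r mat, 'v::ab_group_add) rep"
    and \<chi> \<omega> :: "'r \<Rightarrow> complex"
    and m0 :: 'k and \<B> :: "'k mat set"
  assumes "odd CARD('p::prime_card)"
    and "unramified_integers TYPE('p) \<oo>"
    and "uniformizer \<oo> varpi"
    and "quotient_map \<oo> {varpi\<^sup>2 * x |x. x \<in> \<oo>} quo"
    and "quotient_map \<oo> {varpi * x |x. x \<in> \<oo>} (\<lambda>x. res (quo x))"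
    and "additive_character \<psi>0"
    and "\<exists>x. \<psi>0 (quo varpi * x) \<noteq> 1"
    and "strongly_cuspidal \<psi>0 (quo varpi) res 3 \<rho>"
    and "unit_character \<chi>"
    and "central_character 4 (parabolic_induction \<rho> \<chi>) \<omega>"
    and "\<And>x y. res y = x \<Longrightarrow> psi_res \<psi>0 (quo varpi) res (2 * m0 * x) = \<omega> (1 + quo varpi * y)"
    and "class_representatives
           {B \<in> carrier_mat 2 2. regular_mat B \<and> mat_trace B = 2 * m0} \<B>"
  shows "rep_iso (GL 2)
           (degenerate_whittaker \<psi>0 (parabolic_induction \<rho> \<chi>))
           (direct_sum \<B> (\<lambda>B. induced (GL 2) (ZJ (quo varpi))
              (char_rep (omega_phi \<psi>0 (quo varpi) res \<omega> B))))"
proof -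
  let ?w = "quo varpi"
  interpret length_two ?w res \<psi>0
    by (rule length_two_quotient[OF one_in_unramified_integers[OF assms(2)] assms(3-7)])
  obtain A \<theta> where A: "A \<in> carrier_mat 3 3" "irreducible (char_poly A)"
    and \<theta>: "is_character (GL 3) (stabilizer \<psi>0 ?w res 3 A) \<theta>" "\<forall>j\<in>J1 ?w 3. \<theta> j = phi \<psi>0 ?w res 3 A j"
      "rep_iso (GL 3) \<rho> (induced (GL 3) (stabilizer \<psi>0 ?w res 3 A) (char_rep \<theta>))"
    using assms(8) unfolding strongly_cuspidal_def by blast
  interpret cuspidal_induction ?w res \<psi>0 A m0 \<rho> \<theta> \<chi> \<omega>
    by unfold_locales (use A \<theta> assms(9-11) in auto)
  show ?thesis by (rule whittaker_decomposition[OF assms(12)])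
qed

end
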